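(* There exists an absolute constant $C>0$ (independent of $d,\rho,\sigma,h$, the domain and the triangulation) such that the following holds. Let $d\ge1$, let $\Omega\subset\mathbb{R}^d$ be a bounded polyhedral domain, and let $\mathcal{T}_h$ be a $(\rho,\sigma)$-quasi-uniform triangulation of $\Omega$ with mesh size $h$. Then $$\|v\|_{L^2(\partial\Omega)}\le C\,\rho^{1/2}\sigma^{-1/2}\,d\,h^{-1/2}\,\|v\|_{L^2(\Omega)},\qquad v\in V_h.$$
   Context: A triangulation $\mathcal{T}_h$ of $\Omega$ is a finite conforming collection of pairwise disjoint open $d$-simplices whose closures have union $\overline\Omega$. For a $d$-simplex $\tau$, $h_\tau$ is its diameter and $r_\tau$ its inradius; the mesh size is $h=\max_{\tau\in\mathcal{T}_h}h_\tau$. $\mathcal{T}_h$ is $(\rho,\sigma)$-quasi-uniform ($\rho,\sigma>0$) if $h_\tau\le\rho\,r_\tau$ and $\sigma h\le h_\tau\le h$ for all $\tau\in\mathcal{T}_h$. $V_h=\{v\in C(\overline\Omega):v|_\tau\text{ is affine for all }\tau\in\mathcal{T}_h\}$. *)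

theory Defs
  imports "HOL-Analysis.Analysis"
begin

text \<open>
  The dimension \<open>d\<close> has to be bound after the absolute constant, so it must be a natural number
  inside the formula and not a type.  Accordingly \<open>\<real>\<^sup>d\<close> is the set of functions on \<open>{..<d}\<close>
  that are \<open>undefined\<close> elsewhere; this is both the carrier of the library's product topology and
  the space of the library's finite product measures.
\<close>

definition rspace :: "nat \<Rightarrow> (nat \<Rightarrow> real) set" where
  "rspace d = {..<d} \<rightarrow>\<^sub>E UNIV"

definition rtop :: "nat \<Rightarrow> (nat \<Rightarrow> real) topology" where
  "rtop d = product_topology (\<lambda>_. euclideanreal) {..<d}"

definition rdist :: "nat \<Rightarrow> (nat \<Rightarrow> real) \<Rightarrow> (nat \<Rightarrow> real) \<Rightarrow> real" where
  "rdist d x y = L2_set (\<lambda>i. x i - y i) {..<d}"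

definition rball :: "nat \<Rightarrow> (nat \<Rightarrow> real) \<Rightarrow> real \<Rightarrow> (nat \<Rightarrow> real) set" where
  "rball d x r = {y \<in> rspace d. rdist d x y < r}"

text \<open>As for the library's \<^const>\<open>diameter\<close>, only meaningful for bounded sets.\<close>

definition rdiam :: "nat \<Rightarrow> (nat \<Rightarrow> real) set \<Rightarrow> real" where
  "rdiam d S = (if S = {} then 0 else SUP (x, y)\<in>S \<times> S. rdist d x y)"

section \<open>Volume and surface measure\<close>

definition rlebesgue :: "nat \<Rightarrow> (nat \<Rightarrow> real) measure" where
  "rlebesgue d = Pi\<^sub>M {..<d} (\<lambda>_. lborel)"

text \<open>
  The surface measure on \<open>\<partial>\<Omega>\<close> is the \<open>(d - 1)\<close>-dimensional Hausdorff measure of \<open>\<real>\<^sup>d\<close>, normalised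
  by the volume of the Euclidean ball so that it agrees with \<open>(d - 1)\<close>-dimensional Lebesgue measure
  on hyperplanes.  Empty covering sets have weight \<open>0\<close> also for \<open>s = 0\<close>, where a nonempty set has
  weight \<open>1\<close>; thus \<open>s = 0\<close> gives counting measure.
\<close>

definition hausdorff_weight :: "nat \<Rightarrow> nat \<Rightarrow> (nat \<Rightarrow> real) set \<Rightarrow> real" where
  "hausdorff_weight d s S =
     (if S = {} then 0 else unit_ball_vol (real s) * (rdiam d S / 2) ^ s)"

definition hausdorff_covers ::
  "nat \<Rightarrow> real \<Rightarrow> (nat \<Rightarrow> real) set \<Rightarrow> (nat \<Rightarrow> (nat \<Rightarrow> real) set) set" where
  "hausdorff_covers d \<delta> A =
     {U. A \<subseteq> (\<Union>k. U k) \<and> (\<forall>k. U k \<subseteq> rspace d \<and> (\<forall>x\<in>U k. \<forall>y\<in>U k. rdist d x y \<le> \<delta>))}"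

definition hausdorff_outer :: "nat \<Rightarrow> nat \<Rightarrow> (nat \<Rightarrow> real) set \<Rightarrow> ennreal" where
  "hausdorff_outer d s A =
     (SUP \<delta>\<in>{0<..}. INF U\<in>hausdorff_covers d \<delta> A. \<Sum>k. ennreal (hausdorff_weight d s (U k)))"

text \<open>
  \<^const>\<open>measure_of\<close> does not collapse here: \<^const>\<open>hausdorff_outer\<close> is a metric outer
  measure, hence countably additive on the Borel sets of \<open>\<real>\<^sup>d\<close> by Caratheodory's criterion.
\<close>

definition hausdorff_measure :: "nat \<Rightarrow> nat \<Rightarrow> (nat \<Rightarrow> real) measure" where
  "hausdorff_measure d s =
     measure_of (rspace d) (sets (Pi\<^sub>M {..<d} (\<lambda>_. borel))) (hausdorff_outer d s)"

text \<open>The \<open>L\<^sup>2\<close> norm is \<open>\<infinity>\<close>, not \<open>0\<close>, when the function is not square-integrable.\<close>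

definition L2_norm_on :: "'a measure \<Rightarrow> 'a set \<Rightarrow> ('a \<Rightarrow> real) \<Rightarrow> ennreal" where
  "L2_norm_on M A v =
     (let I = (\<integral>\<^sup>+x\<in>A. ennreal ((v x)\<^sup>2) \<partial>M)
      in if I = \<infinity> then \<infinity> else ennreal (sqrt (enn2real I)))"

section \<open>Simplices and polyhedral domains\<close>

definition rhull :: "nat \<Rightarrow> (nat \<Rightarrow> real) set \<Rightarrow> (nat \<Rightarrow> real) set" where
  "rhull d V = {\<lambda>i\<in>{..<d}. \<Sum>p\<in>V. t p * p i | t. (\<forall>p\<in>V. 0 \<le> t p) \<and> (\<Sum>p\<in>V. t p) = 1}"

definition open_rhull :: "nat \<Rightarrow> (nat \<Rightarrow> real) set \<Rightarrow> (nat \<Rightarrow> real) set" where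
  "open_rhull d V = {\<lambda>i\<in>{..<d}. \<Sum>p\<in>V. t p * p i | t. (\<forall>p\<in>V. 0 < t p) \<and> (\<Sum>p\<in>V. t p) = 1}"

definition raffine_independent :: "nat \<Rightarrow> (nat \<Rightarrow> real) set \<Rightarrow> bool" where
  "raffine_independent d V \<longleftrightarrow>
     (\<forall>c. (\<Sum>p\<in>V. c p) = 0 \<and> (\<forall>i<d. (\<Sum>p\<in>V. c p * p i) = 0) \<longrightarrow> (\<forall>p\<in>V. c p = 0))"

definition simplex_vertices :: "nat \<Rightarrow> (nat \<Rightarrow> real) set \<Rightarrow> bool" where
  "simplex_vertices d V \<longleftrightarrow>
     finite V \<and> V \<subseteq> rspace d \<and> card V = d + 1 \<and> raffine_independent d V"

definition open_simplex :: "nat \<Rightarrow> (nat \<Rightarrow> real) set \<Rightarrow> bool" where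
  "open_simplex d \<tau> \<longleftrightarrow> (\<exists>V. simplex_vertices d V \<and> \<tau> = open_rhull d V)"

text \<open>\<open>F\<close> is a face (possibly empty) of the closure of the open simplex \<open>\<tau>\<close>.\<close>

definition closed_face :: "nat \<Rightarrow> (nat \<Rightarrow> real) set \<Rightarrow> (nat \<Rightarrow> real) set \<Rightarrow> bool" where
  "closed_face d F \<tau> \<longleftrightarrow>
     (\<exists>V W. simplex_vertices d V \<and> \<tau> = open_rhull d V \<and> W \<subseteq> V \<and> F = rhull d W)"

text \<open>
  A bounded polyhedral domain is a nonempty connected open set that is the interior of a
  finite union of convex polytopes.  It need be neither convex nor Lipschitz, but it equals the
  interior of its closure, so that there are no slits.
\<close>

definition bounded_polyhedral_domain :: "nat \<Rightarrow> (nat \<Rightarrow> real) set \<Rightarrow> bool" where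
  "bounded_polyhedral_domain d \<Omega> \<longleftrightarrow>
     \<Omega> \<noteq> {} \<and> connectedin (rtop d) \<Omega> \<and>
     (\<exists>\<V>. finite \<V> \<and> (\<forall>V\<in>\<V>. finite V \<and> V \<subseteq> rspace d) \<and>
        \<Omega> = rtop d interior_of (\<Union>V\<in>\<V>. rhull d V))"

section \<open>Triangulations and finite elements\<close>

definition triangulation_of ::
  "nat \<Rightarrow> (nat \<Rightarrow> real) set \<Rightarrow> (nat \<Rightarrow> real) set set \<Rightarrow> bool" where
  "triangulation_of d \<Omega> T \<longleftrightarrow>
     finite T \<and> (\<forall>\<tau>\<in>T. open_simplex d \<tau>) \<and> disjoint T \<and>
     (\<Union>\<tau>\<in>T. rtop d closure_of \<tau>) = rtop d closure_of \<Omega> \<and>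
     (\<forall>\<tau>\<in>T. \<forall>\<tau>'\<in>T. let F = (rtop d closure_of \<tau>) \<inter> (rtop d closure_of \<tau>')
                     in closed_face d F \<tau> \<and> closed_face d F \<tau>')"

definition inradius :: "nat \<Rightarrow> (nat \<Rightarrow> real) set \<Rightarrow> real" where
  "inradius d \<tau> = Sup {r. 0 < r \<and> (\<exists>x\<in>rspace d. rball d x r \<subseteq> \<tau>)}"

definition mesh_size :: "nat \<Rightarrow> (nat \<Rightarrow> real) set set \<Rightarrow> real" where
  "mesh_size d T = Max (rdiam d ` T)"

definition quasi_uniform :: "nat \<Rightarrow> real \<Rightarrow> real \<Rightarrow> (nat \<Rightarrow> real) set set \<Rightarrow> bool" where
  "quasi_uniform d \<rho> \<sigma> T \<longleftrightarrow>
     0 < \<rho> \<and> 0 < \<sigma> \<and>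
     (\<forall>\<tau>\<in>T. rdiam d \<tau> \<le> \<rho> * inradius d \<tau> \<and>
             \<sigma> * mesh_size d T \<le> rdiam d \<tau> \<and> rdiam d \<tau> \<le> mesh_size d T)"

definition raffine_on :: "nat \<Rightarrow> (nat \<Rightarrow> real) set \<Rightarrow> ((nat \<Rightarrow> real) \<Rightarrow> real) \<Rightarrow> bool" where
  "raffine_on d S v \<longleftrightarrow> (\<exists>a b. \<forall>x\<in>S. v x = (\<Sum>i<d. a i * x i) + b)"

text \<open>Values of \<open>v\<close> outside the closure of \<open>\<Omega>\<close> are irrelevant.\<close>

definition fe_space ::
  "nat \<Rightarrow> (nat \<Rightarrow> real) set \<Rightarrow> (nat \<Rightarrow> real) set set \<Rightarrow> ((nat \<Rightarrow> real) \<Rightarrow> real) set" where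
  "fe_space d \<Omega> T =
     {v. continuous_map (subtopology (rtop d) (rtop d closure_of \<Omega>)) euclideanreal v \<and>
         (\<forall>\<tau>\<in>T. raffine_on d \<tau> v)}"

end

theory Submission
  imports Defs "HOL-Library.Function_Algebras"
begin

text \<open>
  Let \<open>F\<close> be a facet of a simplex \<open>\<tau>\<close>, opposite to the vertex \<open>q\<close> and at distance \<open>h\<^sub>F\<close> from it.
  Slicing \<open>\<tau>\<close> parallel to \<open>F\<close>, an affine \<open>v\<close> is affine along each ray from \<open>F\<close> to \<open>q\<close>, so a one-dimensional
  inequality bounds \<open>\<integral>\<^sub>F v\<^sup>2\<close> by \<open>2 (d + 1) / h\<^sub>F\<close> times \<open>\<integral>\<^sub>\<tau> v\<^sup>2\<close>.  The barycentric coordinate of \<open>q\<close> has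
  gradient of norm \<open>1 / h\<^sub>F\<close>; evaluating all barycentric coordinates at the centre of an inscribed ball
  gives \<open>\<Sum>\<^sub>F 1 / h\<^sub>F \<le> c / r\<^sub>\<tau>\<close> with an absolute \<open>c\<close>.  Summing over facets yields a squared constant of order \<open>d / r\<^sub>\<tau>\<close>.

  This leaves a spare factor \<open>d\<close>, which pays for comparing surface and volume measure without
  rotations or determinants.  In affine coordinates both Hausdorff measure on \<open>F\<close> and volume near \<open>\<tau>\<close>
  are translation invariant, hence multiples of Lebesgue measure.  The multiples are compared through
  the pullback of the unit ball: its Hausdorff measure is at most \<open>\<omega>\<^bsub>d - 1\<^esub>\<close> by a packing argument, the
  \<open>d\<close>-dimensional ball lies in a slab over it, and \<open>\<omega>\<^bsub>d - 1\<^esub> \<le> d \<omega>\<^sub>d\<close>.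
\<close>

section \<open>Translation-invariant measures\<close>

text \<open>The surface measure is the obstacle: it is given by covers, while integrals over facets
  call for formulas. Every estimate of it is from above, by explicit covers of arbitrarily small
  mesh. Translation invariance, together with finiteness on the image of one cube, then turns a
  single number into a formula for all Borel sets of the flat and all integrals over it.

  A ball is the right test body because its Hausdorff weight equals its volume: a set of diameter
  \<open>D\<close> costs \<open>omega_n (D / 2) ^ n\<close>, and a ball attains this. The
  pulled-back unit ball of the facet flat enters both the bound for the area and the bound for the
  volume, and cancels; what remains of the comparison is the factor
  \<open>2 omega_(d-1) / omega_d \<le> 2 d\<close> in place of 1.

  Thus the squared constant is \<open>2 d\<close> from the measures times \<open>2 (d + 1)\<close>
  from slicing times \<open>2 / r\<close> from the gradients, at most \<open>16 d^2 / r\<close>.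
  Facets inside the domain are not sorted out: each simplex bounds the integral over its entire
  boundary by its own volume integral.\<close>

abbreviation rcube :: "nat \<Rightarrow> (nat \<Rightarrow> real) set" where
  "rcube n \<equiv> {..<n} \<rightarrow>\<^sub>E {0..<1}"

definition rtranslate :: "nat \<Rightarrow> (nat \<Rightarrow> real) \<Rightarrow> (nat \<Rightarrow> real) \<Rightarrow> nat \<Rightarrow> real" where
  "rtranslate n a x = (\<lambda>i\<in>{..<n}. a i + x i)"

definition translation_invariant :: "nat \<Rightarrow> (nat \<Rightarrow> real) measure \<Rightarrow> bool" where
  "translation_invariant n M \<longleftrightarrow> sets M = sets (rlebesgue n) \<and>
     (\<forall>a. \<forall>B\<in>sets M. emeasure M (rtranslate n a -` B \<inter> rspace n) = emeasure M B)"

interpretation lborel_product: product_sigma_finite "\<lambda>_::nat. lborel :: real measure"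
  by standard

lemma space_rlebesgue [simp]: "space (rlebesgue n) = rspace n"
  by (simp add: rlebesgue_def rspace_def space_PiM)

lemma sets_rlebesgue: "sets (rlebesgue n) = sets (Pi\<^sub>M {..<n} (\<lambda>_. borel))"
  unfolding rlebesgue_def by (rule sets_PiM_cong) auto

lemma measurable_rlebesgue_component [measurable]:
  "i < n \<Longrightarrow> (\<lambda>x. x i) \<in> borel_measurable (rlebesgue n)"
  unfolding rlebesgue_def by measurable

lemma measurable_rlebesgue_restrict [measurable (raw)]:
  assumes "\<And>i. i < n \<Longrightarrow> (\<lambda>x. f x i) \<in> borel_measurable M"
  shows "(\<lambda>x. restrict (f x) {..<n}) \<in> measurable M (rlebesgue n)"
  unfolding rlebesgue_def by (rule measurable_restrict) (use assms in auto)

lemma sigma_finite_rlebesgue: "sigma_finite_measure (rlebesgue n)"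
  unfolding rlebesgue_def by (rule lborel_product.sigma_finite) auto

lemma emeasure_rlebesgue_PiE:
  "(\<And>i. i < n \<Longrightarrow> A i \<in> sets borel) \<Longrightarrow>
    emeasure (rlebesgue n) (Pi\<^sub>E {..<n} A) = (\<Prod>i<n. emeasure lborel (A i))"
  unfolding rlebesgue_def by (rule lborel_product.emeasure_PiM) auto

lemma sets_rlebesgue_PiE [measurable]:
  "(\<And>i. i < n \<Longrightarrow> A i \<in> sets borel) \<Longrightarrow> Pi\<^sub>E {..<n} A \<in> sets (rlebesgue n)"
  unfolding rlebesgue_def by (rule sets_PiM_I_finite) auto

lemma emeasure_rcube [simp]: "emeasure (rlebesgue n) (rcube n) = 1"
  by (subst emeasure_rlebesgue_PiE) auto

lemma emeasure_lborel_affine: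
  fixes a c :: real
  assumes c: "c \<noteq> 0" and A: "A \<in> sets borel"
  shows "ennreal \<bar>c\<bar> * emeasure lborel ((\<lambda>x. a + c * x) -` A) = emeasure lborel A"
proof -
  have "emeasure lborel A = emeasure (density (distr lborel borel (\<lambda>x. a + c * x)) (\<lambda>_. ennreal \<bar>c\<bar>)) A"
    using lborel_real_affine[OF c, of a] by simp
  also have "\<dots> = ennreal \<bar>c\<bar> * emeasure (distr lborel borel (\<lambda>x. a + c * x)) A"
    using A by (simp add: emeasure_density nn_integral_cmult_indicator)
  also have "emeasure (distr lborel borel (\<lambda>x. a + c * x)) A = emeasure lborel ((\<lambda>x. a + c * x) -` A)"
    using A by (subst emeasure_distr) auto
  finally show ?thesis by simp
qed

text \<open>A product measure is determined by its values on boxes, and on boxes the map acts one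
  coordinate at a time. The common factor \<open>c\<close> will be \<open>-1\<close> in the
  uniqueness argument, \<open>1 - s\<close> for the slices of a cone, and \<open>N\<close> or
  \<open>1 / s\<close> for rescaled copies of a set.\<close>

lemma rlebesgue_affine:
  assumes c: "c \<noteq> 0"
  shows "rlebesgue n = density (distr (rlebesgue n) (rlebesgue n) (\<lambda>x. \<lambda>i\<in>{..<n}. a i + c * x i))
           (\<lambda>_. ennreal (\<bar>c\<bar> ^ n))" (is "_ = density (distr _ _ ?T) _")
proof -
  have [measurable]: "?T \<in> measurable (rlebesgue n) (rlebesgue n)"
    by measurable
  let ?P = "density (distr (rlebesgue n) (rlebesgue n) ?T) (\<lambda>_. ennreal (\<bar>c\<bar> ^ n))"
  have "?P = Pi\<^sub>M {..<n} (\<lambda>_. lborel)"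
  proof (rule lborel_product.PiM_eqI)
    show "sets ?P = sets (Pi\<^sub>M {..<n} (\<lambda>_. lborel))" by (simp add: rlebesgue_def)
    fix A :: "nat \<Rightarrow> real set" assume "\<And>i. i \<in> {..<n} \<Longrightarrow> A i \<in> sets lborel"
    then have A: "\<And>i. i < n \<Longrightarrow> A i \<in> sets borel" by auto
    have "?P (Pi\<^sub>E {..<n} A) = ennreal (\<bar>c\<bar> ^ n) * emeasure (rlebesgue n) (?T -` Pi\<^sub>E {..<n} A \<inter> rspace n)"
      using A by (simp add: emeasure_density nn_integral_cmult_indicator emeasure_distr)
    also have "?T -` Pi\<^sub>E {..<n} A \<inter> rspace n = (\<Pi>\<^sub>E i\<in>{..<n}. (\<lambda>x. a i + c * x) -` A i)"
      by (auto simp: rspace_def PiE_def Pi_def)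
    also have "emeasure (rlebesgue n) \<dots> = (\<Prod>i<n. emeasure lborel ((\<lambda>x. a i + c * x) -` A i))"
    proof (rule emeasure_rlebesgue_PiE)
      fix i assume "i < n"
      then have [measurable]: "A i \<in> sets borel" using A by simp
      have "(\<lambda>x. a i + c * x) -` A i \<inter> space borel \<in> sets borel" by measurable
      then show "(\<lambda>x. a i + c * x) -` A i \<in> sets borel" by simp
    qed
    also have "ennreal (\<bar>c\<bar> ^ n) * \<dots> = (\<Prod>i<n. ennreal \<bar>c\<bar> * emeasure lborel ((\<lambda>x. a i + c * x) -` A i))"
      by (simp add: prod.distrib ennreal_power)
    also have "\<dots> = (\<Prod>i<n. emeasure lborel (A i))"
      by (intro prod.cong refl emeasure_lborel_affine c A) auto
    finally show "?P (Pi\<^sub>E {..<n} A) = (\<Prod>i\<in>{..<n}. emeasure lborel (A i))" .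
  qed simp
  then show ?thesis by (simp add: rlebesgue_def)
qed

lemma nn_integral_rlebesgue_affine:
  assumes c: "c \<noteq> 0" and f [measurable]: "f \<in> borel_measurable (rlebesgue n)"
  shows "(\<integral>\<^sup>+x. f x \<partial>rlebesgue n) =
           ennreal (\<bar>c\<bar> ^ n) * (\<integral>\<^sup>+x. f (\<lambda>i\<in>{..<n}. a i + c * x i) \<partial>rlebesgue n)"
  by (subst rlebesgue_affine[OF c, of _ a])
     (simp add: nn_integral_density nn_integral_distr nn_integral_cmult)

lemma nn_integral_rlebesgue_translate:
  assumes f: "f \<in> borel_measurable (rlebesgue n)"
  shows "(\<integral>\<^sup>+x. f x \<partial>rlebesgue n) = (\<integral>\<^sup>+x. f (\<lambda>i\<in>{..<n}. a i + x i) \<partial>rlebesgue n)"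
  using nn_integral_rlebesgue_affine[of 1, OF _ f, where a = a] by (simp only: mult_1 power_one abs_one ennreal_1)

lemma emeasure_rlebesgue_affine:
  assumes c: "c \<noteq> 0" and B [measurable]: "B \<in> sets (rlebesgue n)"
  shows "emeasure (rlebesgue n) B =
           ennreal (\<bar>c\<bar> ^ n) * emeasure (rlebesgue n) ((\<lambda>x. \<lambda>i\<in>{..<n}. a i + c * x i) -` B \<inter> rspace n)"
  by (subst rlebesgue_affine[OF c, of _ a])
     (simp add: emeasure_density nn_integral_cmult_indicator emeasure_distr)

lemma rtranslate_in_rspace [simp]: "rtranslate n a x \<in> rspace n"
  by (simp add: rtranslate_def rspace_def)

lemma measurable_rtranslate [measurable]: "rtranslate n a \<in> measurable (rlebesgue n) (rlebesgue n)"
  unfolding rtranslate_def by measurable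

lemma translation_invariant_rlebesgue: "translation_invariant n (rlebesgue n)"
  unfolding translation_invariant_def
  using emeasure_rlebesgue_affine[of 1 _ n] by (auto simp: rtranslate_def[abs_def])

lemma translation_invariant_distr:
  assumes "translation_invariant n M"
  shows "distr M M (rtranslate n a) = M"
proof (rule measure_eqI)
  fix B assume B: "B \<in> sets (distr M M (rtranslate n a))"
  have s: "sets M = sets (rlebesgue n)" using assms by (simp add: translation_invariant_def)
  have [measurable]: "rtranslate n a \<in> measurable M M"
    using measurable_rtranslate measurable_cong_sets[OF s s] by blast
  have "space M = rspace n" using sets_eq_imp_space_eq[OF s] by simp
  then show "emeasure (distr M M (rtranslate n a)) B = emeasure M B"
    using B assms by (simp add: emeasure_distr translation_invariant_def)
qed simp

lemma rtranslate_uminus [simp]: "x \<in> rspace n \<Longrightarrow> rtranslate n (\<lambda>i. - a i) (rtranslate n a x) = x"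
  "x \<in> rspace n \<Longrightarrow> rtranslate n a (rtranslate n (\<lambda>i. - a i) x) = x"
  by (auto simp: rtranslate_def restrict_def fun_eq_iff rspace_def PiE_def extensional_def)

text \<open>Integer translates of the half-open cube tile the space, and all of them have the finite
  measure of the cube.\<close>

lemma translation_invariant_sigma_finite:
  assumes ti: "translation_invariant n M" and fin: "emeasure M (rcube n) < \<infinity>"
  shows "sigma_finite_measure M"
proof
  have s [simp]: "sets M = sets (rlebesgue n)" using ti by (simp add: translation_invariant_def)
  have sp: "space M = rspace n" using sets_eq_imp_space_eq[OF s] by simp
  let ?C = "\<lambda>k::nat \<Rightarrow> int. rtranslate n (\<lambda>i. - real_of_int (k i)) -` rcube n \<inter> rspace n"
  let ?A = "?C ` ({..<n} \<rightarrow>\<^sub>E UNIV)"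
  have "x \<in> \<Union>?A" if "x \<in> rspace n" for x
  proof -
    have "x \<in> ?C (\<lambda>i\<in>{..<n}. \<lfloor>x i\<rfloor>)" using that
      by (auto simp: rtranslate_def PiE_def Pi_def) linarith
    moreover have "(\<lambda>i\<in>{..<n}. \<lfloor>x i\<rfloor>) \<in> {..<n} \<rightarrow>\<^sub>E (UNIV :: int set)" by simp
    ultimately show ?thesis by blast
  qed
  then have un: "\<Union>?A = space M" using sp by auto
  have m: "?C k \<in> sets M" for k
    using measurable_sets[OF measurable_rtranslate, of "rcube n" n] by simp
  have "emeasure M (?C k) = emeasure M (rcube n)" for k
    using ti by (simp add: translation_invariant_def)
  then have "\<forall>a\<in>?A. emeasure M a \<noteq> \<infinity>" using fin by auto
  moreover have "countable ?A" by (intro countable_image countable_PiE) auto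
  moreover have "?A \<subseteq> sets M" using m by blast
  ultimately show "\<exists>A. countable A \<and> A \<subseteq> sets M \<and> \<Union>A = space M \<and> (\<forall>a\<in>A. emeasure M a \<noteq> \<infinity>)"
    using un by blast
qed

text \<open>Uniqueness of Haar measure: integrate \<open>1\<^sub>B(x) 1\<^sub>Q(x + y)\<close> over \<open>M \<Otimes> L\<close> in both orders, \<open>Q\<close> the unit cube.\<close>

lemma translation_invariant_unique:
  assumes ti: "translation_invariant n M" and fin: "emeasure M (rcube n) < \<infinity>"
    and B: "B \<in> sets M"
  shows "emeasure M B = emeasure M (rcube n) * emeasure (rlebesgue n) B"
proof -
  let ?L = "rlebesgue n" and ?Q = "rcube n"
  let ?s = "\<lambda>x y. \<lambda>i\<in>{..<n}. x i + (y i :: real)" and ?d = "\<lambda>x y. \<lambda>i\<in>{..<n}. x i + - 1 * (y i :: real)"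
  have s [measurable_cong]: "sets M = sets ?L" using ti by (simp add: translation_invariant_def)
  have sp [simp]: "space M = rspace n" using sets_eq_imp_space_eq[OF s] by simp
  have [measurable]: "B \<in> sets ?L" using B s by simp
  interpret M: sigma_finite_measure M by (rule translation_invariant_sigma_finite[OF ti fin])
  interpret L: sigma_finite_measure ?L by (rule sigma_finite_rlebesgue)
  interpret pair_sigma_finite M ?L ..
  have [measurable]: "(\<lambda>z. ?s (fst z) (snd z)) \<in> measurable (M \<Otimes>\<^sub>M ?L) ?L"
    "(\<lambda>z. ?d (fst z) (snd z)) \<in> measurable (M \<Otimes>\<^sub>M ?L) ?L"
    by measurable
  have m1: "(\<lambda>(x, y). indicator B x * indicator ?Q (?s x y) :: ennreal) \<in> borel_measurable (M \<Otimes>\<^sub>M ?L)"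
    unfolding split_beta by measurable
  have m2: "(\<lambda>(x, y). indicator ?Q x * indicator B (?d x y) :: ennreal) \<in> borel_measurable (M \<Otimes>\<^sub>M ?L)"
    unfolding split_beta by measurable
  have "(\<integral>\<^sup>+x. (\<integral>\<^sup>+y. indicator B x * indicator ?Q (?s x y) \<partial>?L) \<partial>M) = (\<integral>\<^sup>+x. indicator B x \<partial>M)"
  proof (rule nn_integral_cong)
    fix x assume "x \<in> space M"
    have "(\<integral>\<^sup>+y. indicator B x * indicator ?Q (?s x y) \<partial>?L)
        = indicator B x * (\<integral>\<^sup>+y. indicator ?Q (?s x y) \<partial>?L)"
      by (subst nn_integral_cmult) simp_all
    also have "(\<integral>\<^sup>+y. indicator ?Q (?s x y) \<partial>?L) = (\<integral>\<^sup>+y. indicator ?Q y \<partial>?L)"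
      by (rule nn_integral_rlebesgue_translate[symmetric]) simp
    also have "\<dots> = 1" by (subst nn_integral_indicator) simp_all
    finally show "(\<integral>\<^sup>+y. indicator B x * indicator ?Q (?s x y) \<partial>?L) = indicator B x"
      by (simp only: mult.right_neutral)
  qed
  also have "\<dots> = emeasure M B" using B by simp
  finally have 1: "(\<integral>\<^sup>+x. (\<integral>\<^sup>+y. indicator B x * indicator ?Q (?s x y) \<partial>?L) \<partial>M) = emeasure M B" .
  \<comment> \<open>Replacing \<open>x\<close> by \<open>x - y\<close>, which \<open>M\<close> does
    not notice, moves the shift from the cube to \<open>B\<close>. After that the integral over
    \<open>y\<close> sees only the reflection \<open>x - y\<close>, so its value no longer depends
    on \<open>x\<close>.\<close>
  have "(\<integral>\<^sup>+x. indicator B x * indicator ?Q (?s x y) \<partial>M)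
      = (\<integral>\<^sup>+x. indicator ?Q x * indicator B (?d x y) \<partial>M)" if "y \<in> rspace n" for y
  proof -
    have "(\<integral>\<^sup>+x. indicator B x * indicator ?Q (?s x y) \<partial>M)
        = (\<integral>\<^sup>+x. indicator B x * indicator ?Q (?s x y) \<partial>distr M M (rtranslate n (\<lambda>i. - y i)))"
      using translation_invariant_distr[OF ti] by simp
    also have "\<dots> = (\<integral>\<^sup>+x. indicator B (rtranslate n (\<lambda>i. - y i) x) *
          indicator ?Q (?s (rtranslate n (\<lambda>i. - y i) x) y) \<partial>M)"
      by (subst nn_integral_distr) measurable
    also have "\<dots> = (\<integral>\<^sup>+x. indicator ?Q x * indicator B (?d x y) \<partial>M)"
    proof (rule nn_integral_cong)
      fix x assume "x \<in> space M"
      then have x: "x \<in> rspace n" by simp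
      have a: "rtranslate n (\<lambda>i. - y i) x = ?d x y"
        by (auto simp: rtranslate_def restrict_def fun_eq_iff)
      have b: "?s (?d x y) y = x" using x
        by (auto simp: restrict_def fun_eq_iff rspace_def PiE_def extensional_def)
      show "indicator B (rtranslate n (\<lambda>i. - y i) x) * indicator ?Q (?s (rtranslate n (\<lambda>i. - y i) x) y)
          = (indicator ?Q x * indicator B (?d x y) :: ennreal)"
        unfolding a b by (rule mult.commute)
    qed
    finally show ?thesis .
  qed
  then have "(\<integral>\<^sup>+y. (\<integral>\<^sup>+x. indicator B x * indicator ?Q (?s x y) \<partial>M) \<partial>?L)
      = (\<integral>\<^sup>+y. (\<integral>\<^sup>+x. indicator ?Q x * indicator B (?d x y) \<partial>M) \<partial>?L)"
    by (rule nn_integral_cong) (simp only: space_rlebesgue)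
  also have "\<dots> = (\<integral>\<^sup>+x. (\<integral>\<^sup>+y. indicator ?Q x * indicator B (?d x y) \<partial>?L) \<partial>M)"
    by (rule Fubini'[OF m2])
  also have "\<dots> = (\<integral>\<^sup>+x. emeasure ?L B * indicator ?Q x \<partial>M)"
  proof (rule nn_integral_cong)
    fix x
    have "(\<integral>\<^sup>+y. indicator B (\<lambda>i\<in>{..<n}. x i + - 1 * y i) \<partial>?L) = (\<integral>\<^sup>+y. indicator B y \<partial>?L)"
      by (subst (2) nn_integral_rlebesgue_affine[of "-1" _ n x]) simp_all
    also have "\<dots> = emeasure ?L B" by simp
    finally show "(\<integral>\<^sup>+y. indicator ?Q x * indicator B (?d x y) \<partial>?L) = emeasure ?L B * indicator ?Q x"
      by (subst nn_integral_cmult) (simp_all add: mult.commute)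
  qed
  also have "\<dots> = emeasure ?L B * emeasure M ?Q"
    by (subst nn_integral_cmult_indicator) (simp_all add: s)
  finally show ?thesis using 1 Fubini'[OF m1] by (simp add: mult.commute)
qed

section \<open>Affine images\<close>

text \<open>Affine chart of a \<open>k\<close>-dimensional flat with base point \<open>b\<close> and
  edge vectors \<open>G j\<close>. Since \<open>k\<close> is an argument, the chart of a simplex and
  the chart of its facet share \<open>b\<close> and \<open>G\<close>; the facet drops the last
  edge.\<close>

definition raffine_map :: "nat \<Rightarrow> nat \<Rightarrow> (nat \<Rightarrow> real) \<Rightarrow> (nat \<Rightarrow> nat \<Rightarrow> real) \<Rightarrow> (nat \<Rightarrow> real) \<Rightarrow> nat \<Rightarrow> real" where
  "raffine_map m k b G x = (\<lambda>i\<in>{..<m}. b i + (\<Sum>j<k. x j * G j i))"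

lemma raffine_map_in_rspace [simp]: "raffine_map m k b G x \<in> rspace m"
  by (simp add: raffine_map_def rspace_def)

lemma measurable_raffine_map [measurable]:
  "raffine_map m k b G \<in> measurable (rlebesgue k) (rlebesgue m)"
proof -
  have "(\<lambda>x. \<Sum>j<k. x j * G j i) \<in> borel_measurable (rlebesgue k)" for i
    by (rule borel_measurable_sum) auto
  then show ?thesis unfolding raffine_map_def by measurable
qed

text \<open>Images of Borel sets need not be Borel in general. The measurable left inverse
  \<open>P\<close> turns the image into the set of points fixed by \<open>P\<close> followed by the
  chart, intersected with a preimage under \<open>P\<close>.\<close>

lemma raffine_map_image_measurable:
  assumes P: "P \<in> measurable (rlebesgue m) (rlebesgue k)"
    and inv: "\<And>x. x \<in> rspace k \<Longrightarrow> P (raffine_map m k b G x) = x"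
    and B: "B \<in> sets (rlebesgue k)"
  shows "raffine_map m k b G ` B = {z\<in>rspace m. (\<forall>i<m. raffine_map m k b G (P z) i = z i) \<and> P z \<in> B}"
    and "raffine_map m k b G ` B \<in> sets (rlebesgue m)"
proof -
  let ?\<Phi> = "raffine_map m k b G"
  have [measurable]: "P \<in> measurable (rlebesgue m) (rlebesgue k)" "B \<in> sets (rlebesgue k)" using P B by auto
  have B': "B \<subseteq> rspace k" using sets.sets_into_space[OF B] by simp
  have eqI: "?\<Phi> (P z) = z" if "z \<in> rspace m" "\<forall>i<m. ?\<Phi> (P z) i = z i" for z
    using that by (auto simp: fun_eq_iff raffine_map_def rspace_def PiE_def extensional_def)
  show eq: "?\<Phi> ` B = {z\<in>rspace m. (\<forall>i<m. ?\<Phi> (P z) i = z i) \<and> P z \<in> B}" (is "_ = ?R")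
  proof (intro set_eqI iffI)
    fix z assume "z \<in> ?\<Phi> ` B" then show "z \<in> ?R" using B' inv by auto
  next
    fix z assume "z \<in> ?R" then show "z \<in> ?\<Phi> ` B" using eqI by (metis (mono_tags, lifting) imageI mem_Collect_eq)
  qed
  have m: "(\<lambda>z. ?\<Phi> (P z) i) \<in> borel_measurable (rlebesgue m)" if "i \<in> {..<m}" for i
    using measurable_compose[OF measurable_compose[OF P measurable_raffine_map]
        measurable_rlebesgue_component[of i m]] that by simp
  have m': "(\<lambda>z. z i) \<in> borel_measurable (rlebesgue m)" if "i \<in> {..<m}" for i
    using that by auto
  have "{z\<in>space (rlebesgue m). \<forall>i\<in>{..<m}. ?\<Phi> (P z) i = z i} \<in> sets (rlebesgue m)" (is "?X \<in> _")
    by (intro sets.sets_Collect_finite_All borel_measurable_eq m m') auto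
  moreover have "{z\<in>space (rlebesgue m). P z \<in> B} \<in> sets (rlebesgue m)" (is "?Y \<in> _") by measurable
  ultimately have "?X \<inter> ?Y \<in> sets (rlebesgue m)" by (rule sets.Int)
  moreover have "?X \<inter> ?Y = ?R" unfolding space_rlebesgue by blast
  ultimately show "?\<Phi> ` B \<in> sets (rlebesgue m)" unfolding eq by metis
qed

lemma raffine_map_rtranslate:
  assumes "x \<in> rspace k"
  shows "raffine_map m k b G (rtranslate k a x) =
     rtranslate m (\<lambda>i. \<Sum>j<k. a j * G j i) (raffine_map m k b G x)"
  by (auto simp: raffine_map_def rtranslate_def restrict_def fun_eq_iff algebra_simps sum.distrib)

context
  fixes m k :: nat and b :: "nat \<Rightarrow> real" and G :: "nat \<Rightarrow> nat \<Rightarrow> real" and M P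
  assumes ti: "translation_invariant m M"
    and P: "P \<in> measurable (rlebesgue m) (rlebesgue k)"
    and inv: "\<And>x. x \<in> rspace k \<Longrightarrow> P (raffine_map m k b G x) = x"
    and fin: "emeasure M (raffine_map m k b G ` rcube k) < \<infinity>"
begin

text \<open>Sending \<open>B\<close> to the \<open>M\<close>-measure of its image is translation
  invariant, because the chart carries translations to translations; uniqueness makes it a multiple
  of Lebesgue measure. This replaces a Jacobian: the multiple is the measure of the image of the
  unit cube. Restricting \<open>M\<close> to the range before pushing forward along \<open>P\<close>
  discards the points off the flat that \<open>P\<close> also sends into \<open>B\<close>.\<close>

lemma pullback_measure_eq:
  "distr (density M (indicator (raffine_map m k b G ` rspace k))) (rlebesgue k) P =
   density (rlebesgue k) (\<lambda>_. emeasure M (raffine_map m k b G ` rcube k))" (is "?N = _")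
  and emeasure_raffine_image:
  "B \<in> sets (rlebesgue k) \<Longrightarrow> emeasure M (raffine_map m k b G ` B) =
     emeasure M (raffine_map m k b G ` rcube k) * emeasure (rlebesgue k) B"
proof -
  let ?\<Phi> = "raffine_map m k b G"
  have s [measurable_cong]: "sets M = sets (rlebesgue m)" using ti by (simp add: translation_invariant_def)
  have sp: "space M = rspace m" using sets_eq_imp_space_eq[OF s] by simp
  note [measurable] = P
  have full [measurable]: "rspace k \<in> sets (rlebesgue k)" using sets.top[of "rlebesgue k"] by simp
  have img: "?\<Phi> ` B \<in> sets M" if "B \<in> sets (rlebesgue k)" for B
    using raffine_map_image_measurable(2)[OF P inv that] s by simp
  have [measurable]: "?\<Phi> ` rspace k \<in> sets M" by (rule img[OF full])
  have N: "emeasure ?N B = emeasure M (?\<Phi> ` B)" if B [measurable]: "B \<in> sets (rlebesgue k)" for B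
  proof -
    have B': "B \<subseteq> rspace k" using sets.sets_into_space[OF B] by simp
    have "emeasure ?N B = (\<integral>\<^sup>+z. indicator (?\<Phi> ` rspace k) z * indicator (P -` B \<inter> space M) z \<partial>M)"
      by (subst emeasure_distr) (simp_all add: emeasure_density)
    also have "\<dots> = (\<integral>\<^sup>+z. indicator (?\<Phi> ` B) z \<partial>M)"
      by (rule nn_integral_cong) (use B' inv in \<open>auto simp: indicator_def sp\<close>)
    also have "\<dots> = emeasure M (?\<Phi> ` B)" using img[OF B] by simp
    finally show ?thesis .
  qed
  have tiN: "translation_invariant k ?N"
    unfolding translation_invariant_def
  proof (intro conjI allI ballI)
    fix a B assume "B \<in> sets ?N"
    then have B: "B \<in> sets (rlebesgue k)" by simp
    then have B': "B \<subseteq> rspace k" using sets.sets_into_space by fastforce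
    have pre: "rtranslate k a -` B \<inter> rspace k \<in> sets (rlebesgue k)"
      using measurable_sets[OF measurable_rtranslate B] by simp
    let ?a = "\<lambda>i. \<Sum>j<k. a j * G j i"
    have "?\<Phi> ` (rtranslate k a -` B \<inter> rspace k) = rtranslate m ?a -` (?\<Phi> ` B) \<inter> rspace m"
    proof (intro set_eqI iffI)
      fix z assume "z \<in> ?\<Phi> ` (rtranslate k a -` B \<inter> rspace k)"
      then show "z \<in> rtranslate m ?a -` (?\<Phi> ` B) \<inter> rspace m"
        using raffine_map_rtranslate[of _ k m b G a] by (auto intro!: rev_image_eqI)
    next
      fix z assume "z \<in> rtranslate m ?a -` (?\<Phi> ` B) \<inter> rspace m"
      then obtain x where x: "x \<in> B" "rtranslate m ?a z = ?\<Phi> x" and z: "z \<in> rspace m" by auto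
      have "x \<in> rspace k" using x B' by auto
      have "z = rtranslate m (\<lambda>i. - ?a i) (?\<Phi> x)" using x(2) z by (metis rtranslate_uminus(1))
      also have "\<dots> = ?\<Phi> (rtranslate k (\<lambda>i. - a i) x)"
        using raffine_map_rtranslate[OF \<open>x \<in> rspace k\<close>, of m b G "\<lambda>i. - a i"] by (simp add: sum_negf)
      finally show "z \<in> ?\<Phi> ` (rtranslate k a -` B \<inter> rspace k)"
        using x(1) \<open>x \<in> rspace k\<close> by (auto intro!: rev_image_eqI)
    qed
    then show "emeasure ?N (rtranslate k a -` B \<inter> rspace k) = emeasure ?N B"
      using N[OF B] N[OF pre] ti img[OF B] by (simp add: translation_invariant_def)
  qed simp
  have finN: "emeasure ?N (rcube k) < \<infinity>" using fin by (subst N) auto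
  have main: "emeasure ?N B = emeasure M (?\<Phi> ` rcube k) * emeasure (rlebesgue k) B"
    if "B \<in> sets (rlebesgue k)" for B
    using translation_invariant_unique[OF tiN finN, of B] N[OF that] N[of "rcube k"] that by simp
  show "B \<in> sets (rlebesgue k) \<Longrightarrow> emeasure M (?\<Phi> ` B) =
     emeasure M (?\<Phi> ` rcube k) * emeasure (rlebesgue k) B" using main N by metis
  show "?N = density (rlebesgue k) (\<lambda>_. emeasure M (?\<Phi> ` rcube k))"
  proof (rule measure_eqI)
    fix B assume "B \<in> sets ?N"
    then have B: "B \<in> sets (rlebesgue k)" by (simp only: sets_distr)
    then show "emeasure ?N B = emeasure (density (rlebesgue k) (\<lambda>_. emeasure M (?\<Phi> ` rcube k))) B"
      unfolding main[OF B] by (simp add: emeasure_density nn_integral_cmult_indicator)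
  qed simp
qed

lemma nn_integral_raffine_image:
  assumes B: "B \<in> sets (rlebesgue k)" and f: "f \<in> borel_measurable (rlebesgue m)"
  shows "(\<integral>\<^sup>+z\<in>raffine_map m k b G ` B. f z \<partial>M) =
     emeasure M (raffine_map m k b G ` rcube k) * (\<integral>\<^sup>+x\<in>B. f (raffine_map m k b G x) \<partial>rlebesgue k)"
proof -
  let ?\<Phi> = "raffine_map m k b G"
  have s [measurable_cong]: "sets M = sets (rlebesgue m)" using ti by (simp add: translation_invariant_def)
  have sp: "space M = rspace m" using sets_eq_imp_space_eq[OF s] by simp
  note [measurable] = P B f
  have full: "rspace k \<in> sets (rlebesgue k)" using sets.top[of "rlebesgue k"] by simp
  have [measurable]: "?\<Phi> ` rspace k \<in> sets M"
    using raffine_map_image_measurable(2)[OF P inv full] s by simp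
  have B': "B \<subseteq> rspace k" using sets.sets_into_space[OF B] by simp
  have "(\<integral>\<^sup>+z\<in>?\<Phi> ` B. f z \<partial>M) =
      (\<integral>\<^sup>+z. indicator (?\<Phi> ` rspace k) z * (f (?\<Phi> (P z)) * indicator B (P z)) \<partial>M)"
    by (rule nn_integral_cong) (use B' inv in \<open>auto simp: indicator_def sp\<close>)
  also have "\<dots> = (\<integral>\<^sup>+x. f (?\<Phi> x) * indicator B x
      \<partial>distr (density M (indicator (?\<Phi> ` rspace k))) (rlebesgue k) P)"
    by (simp add: nn_integral_distr nn_integral_density)
  also have "\<dots> = emeasure M (?\<Phi> ` rcube k) * (\<integral>\<^sup>+x. f (?\<Phi> x) * indicator B x \<partial>rlebesgue k)"
    unfolding pullback_measure_eq by (simp add: nn_integral_density nn_integral_cmult)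
  finally show ?thesis .
qed

end

section \<open>Slicing, null hyperplanes and reference simplices\<close>

lemma measurable_fun_upd_rlebesgue:
  "(\<lambda>(y, s). y(n := s)) \<in> measurable (rlebesgue n \<Otimes>\<^sub>M lborel) (rlebesgue (Suc n))"
  unfolding rlebesgue_def lessThan_Suc split_beta by measurable

lemma nn_integral_rlebesgue_Suc:
  assumes f: "f \<in> borel_measurable (rlebesgue (Suc n))"
  shows "(\<integral>\<^sup>+x. f x \<partial>rlebesgue (Suc n)) = (\<integral>\<^sup>+s. (\<integral>\<^sup>+y. f (y(n := s)) \<partial>rlebesgue n) \<partial>lborel)"
  using lborel_product.product_nn_integral_insert_rev[of "{..<n}" n f] f
  unfolding rlebesgue_def lessThan_Suc by simp

text \<open>Integrating first over the coordinate \<open>j\<close> with nonzero coefficient leaves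
  slices of at most one point.\<close>

lemma emeasure_rlebesgue_hyperplane:
  assumes j: "j < n" and a: "a j \<noteq> 0"
  shows "{y\<in>rspace n. (\<Sum>i<n. a i * y i) = \<beta>} \<in> null_sets (rlebesgue n)"
proof -
  let ?S = "{y\<in>rspace n. (\<Sum>i<n. a i * y i) = \<beta>}"
  have "(\<lambda>y. \<Sum>i<n. a i * y i) \<in> borel_measurable (rlebesgue n)"
    by (rule borel_measurable_sum) auto
  then have "{y\<in>space (rlebesgue n). (\<Sum>i<n. a i * y i) = \<beta>} \<in> sets (rlebesgue n)" by measurable
  then have S: "?S \<in> sets (rlebesgue n)" by simp
  let ?I = "{..<n} - {j}"
  have I: "insert j ?I = {..<n}" using j by auto
  have "emeasure (rlebesgue n) ?S = (\<integral>\<^sup>+y. indicator ?S y \<partial>rlebesgue n)" using S by simp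
  also have "\<dots> = (\<integral>\<^sup>+y. (\<integral>\<^sup>+s. indicator ?S (y(j := s)) \<partial>lborel) \<partial>Pi\<^sub>M ?I (\<lambda>_. lborel))"
    using lborel_product.product_nn_integral_insert[of ?I j "indicator ?S"] S
    unfolding I rlebesgue_def by simp
  also have "\<dots> = (\<integral>\<^sup>+y. 0 \<partial>Pi\<^sub>M ?I (\<lambda>_. lborel :: real measure))"
  proof (rule nn_integral_cong)
    fix y :: "nat \<Rightarrow> real"
    have "(\<Sum>i<n. a i * (y(j := s)) i) = a j * s + (\<Sum>i\<in>?I. a i * y i)" for s
      using j by (subst sum.remove[of _ j]) (auto intro!: sum.cong)
    then have sub: "indicator ?S (y(j := s)) \<le> (indicator {(\<beta> - (\<Sum>i\<in>?I. a i * y i)) / a j} s :: ennreal)" for s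
      using a by (auto simp: indicator_def field_simps)
    have "(\<integral>\<^sup>+s. indicator ?S (y(j := s)) \<partial>lborel) \<le>
        (\<integral>\<^sup>+s. indicator {(\<beta> - (\<Sum>i\<in>?I. a i * y i)) / a j} s \<partial>lborel)"
      by (rule nn_integral_mono) (rule sub)
    then show "(\<integral>\<^sup>+s. indicator ?S (y(j := s)) \<partial>lborel) = 0" by simp
  qed
  finally show ?thesis using S by auto
qed

definition open_ref_simplex :: "nat \<Rightarrow> (nat \<Rightarrow> real) set" where
  "open_ref_simplex n = {y\<in>rspace n. (\<forall>j<n. 0 < y j) \<and> (\<Sum>j<n. y j) < 1}"

definition closed_ref_simplex :: "nat \<Rightarrow> (nat \<Rightarrow> real) set" where
  "closed_ref_simplex n = {y\<in>rspace n. (\<forall>j<n. 0 \<le> y j) \<and> (\<Sum>j<n. y j) \<le> 1}"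

lemma sets_ref_simplex [measurable]:
  "open_ref_simplex n \<in> sets (rlebesgue n)" "closed_ref_simplex n \<in> sets (rlebesgue n)"
proof -
  have [measurable]: "(\<lambda>y. \<Sum>j<n. y j) \<in> borel_measurable (rlebesgue n)"
    by (rule borel_measurable_sum) auto
  have "{y\<in>space (rlebesgue n). (\<forall>j\<in>{..<n}. 0 < y j) \<and> (\<Sum>j<n. y j) < 1} \<in> sets (rlebesgue n)"
    "{y\<in>space (rlebesgue n). (\<forall>j\<in>{..<n}. 0 \<le> y j) \<and> (\<Sum>j<n. y j) \<le> 1} \<in> sets (rlebesgue n)"
    by measurable
  then show "open_ref_simplex n \<in> sets (rlebesgue n)" "closed_ref_simplex n \<in> sets (rlebesgue n)"
    by (simp_all only: open_ref_simplex_def closed_ref_simplex_def Ball_def lessThan_iff space_rlebesgue)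
qed

text \<open>The difference lies in the hyperplanes \<open>y j = 0\<close> and the one where the
  coordinates sum to 1. This lets a closed facet be compared with the open base of a cone. For
  \<open>n = 0\<close> both simplices are the single point.\<close>

lemma AE_closed_ref_simplex:
  "AE y in rlebesgue n. y \<in> closed_ref_simplex n \<longrightarrow> y \<in> open_ref_simplex n"
proof -
  have "AE y in rlebesgue n. \<forall>j\<in>{..<n}. y j \<noteq> 0"
  proof (rule AE_finite_allI)
    fix j assume j: "j \<in> {..<n}"
    have "(\<Sum>i<n. (if i = j then 1 else 0) * y i) = y j" for y :: "nat \<Rightarrow> real"
      using j by (subst sum.remove[of _ j]) (auto intro!: sum.neutral)
    then have "{y\<in>rspace n. y j = 0} \<in> null_sets (rlebesgue n)"
      using emeasure_rlebesgue_hyperplane[of j n "\<lambda>i. if i = j then 1 else 0" 0] j by simp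
    then show "AE y in rlebesgue n. y j \<noteq> 0" by (rule AE_I') auto
  qed simp
  moreover have "AE y in rlebesgue n. (\<Sum>j<n. y j) \<noteq> 1"
  proof (cases "n = 0")
    case False
    then have "{y\<in>rspace n. (\<Sum>i<n. y i) = 1} \<in> null_sets (rlebesgue n)"
      using emeasure_rlebesgue_hyperplane[of 0 n "\<lambda>_. 1" 1] by simp
    then show ?thesis by (rule AE_I') auto
  qed simp
  ultimately show ?thesis
    by eventually_elim (force simp: closed_ref_simplex_def open_ref_simplex_def less_le)
qed

text \<open>The constant is the minimum of the integral over \<open>b\<close>, so it is sharp.\<close>

lemma cone_integral_ge:
  fixes a b :: real
  shows "ennreal (a\<^sup>2) \<le> ennreal (2 * (real n + 2)) *
    (\<integral>\<^sup>+s\<in>{0<..<1}. ennreal ((1 - s) ^ n * ((1 - s) * a + s * b)\<^sup>2) \<partial>lborel)"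
proof -
  \<comment> \<open>Antiderivative of the integrand: write \<open>(1 - s) a + s b\<close> as
    \<open>b + (a - b) (1 - s)\<close> and integrate the powers of \<open>1 - s\<close>.\<close>
  define F where "F s = - (b\<^sup>2 * (1 - s) ^ (n + 1) / (real n + 1) + 2 * b * (a - b) * (1 - s) ^ (n + 2) / (real n + 2)
      + (a - b)\<^sup>2 * (1 - s) ^ (n + 3) / (real n + 3))" for s
  have D: "((\<lambda>s. - (c * (1 - s) ^ Suc m / (1 + real m))) has_real_derivative c * (1 - s) ^ m) (at s)"
    for c s :: real and m
    by (rule derivative_eq_intros refl | simp add: divide_simps)+
  have F: "(F has_real_derivative (1 - s) ^ n * ((1 - s) * a + s * b)\<^sup>2) (at s)" for s
  proof -
    have e: "(1 - s) ^ n * ((1 - s) * a + s * b)\<^sup>2 =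
        b\<^sup>2 * (1 - s) ^ n + 2 * b * (a - b) * (1 - s) ^ (n + 1) + (a - b)\<^sup>2 * (1 - s) ^ (n + 2)"
      by (simp add: power2_eq_square power_add algebra_simps)
    have "F = (\<lambda>s. - (b\<^sup>2 * (1 - s) ^ Suc n / (1 + real n)) + - (2 * b * (a - b) * (1 - s) ^ Suc (n + 1) / (1 + real (n + 1)))
        + - ((a - b)\<^sup>2 * (1 - s) ^ Suc (n + 2) / (1 + real (n + 2))))"
      by (auto simp: F_def fun_eq_iff algebra_simps numeral_eq_Suc)
    then show ?thesis unfolding e by (simp only:) (intro DERIV_add D)
  qed
  have I: "(\<integral>\<^sup>+s. ennreal ((1 - s) ^ n * ((1 - s) * a + s * b)\<^sup>2) * indicator {0..1} s \<partial>lborel) = ennreal (F 1 - F 0)"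
    by (rule nn_integral_FTC_Icc[where F = F])
       (use F in auto)
  have J: "(\<integral>\<^sup>+s\<in>{0<..<1}. ennreal ((1 - s) ^ n * ((1 - s) * a + s * b)\<^sup>2) \<partial>lborel) = ennreal (F 1 - F 0)"
    unfolding I[symmetric]
    by (intro nn_integral_cong_AE AE_I[of _ _ "{0, 1}"])
       (auto simp: indicator_def emeasure_lborel_countable)
  \<comment> \<open>With \<open>x\<close> standing for \<open>n\<close>, the right-hand side is the
    completed square in \<open>b\<close>; it vanishes at the minimiser
    \<open>b = - (x + 1) a / 2\<close>.\<close>
  have id: "2 * (x + 2) * (b\<^sup>2 / (x + 1) + 2 * b * (a - b) / (x + 2) + (a - b)\<^sup>2 / (x + 3)) - a\<^sup>2 =
      ((x + 1) * a + 2 * b)\<^sup>2 / ((x + 1) * (x + 3))" if "x \<ge> 0" for x :: real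
  proof -
    have "x + 1 \<noteq> 0" "x + 2 \<noteq> 0" "x + 3 \<noteq> 0" using that by auto
    then show ?thesis by (simp add: divide_simps) algebra
  qed
  have "F 1 = 0" by (simp add: F_def)
  then have "2 * (real n + 2) * (F 1 - F 0) - a\<^sup>2 =
      ((real n + 1) * a + 2 * b)\<^sup>2 / ((real n + 1) * (real n + 3))"
    unfolding id[symmetric, OF of_nat_0_le_iff] by (simp add: F_def)
  also have "\<dots> \<ge> 0" by simp
  finally have "a\<^sup>2 \<le> 2 * (real n + 2) * (F 1 - F 0)" by simp
  then have "ennreal (a\<^sup>2) \<le> ennreal (2 * (real n + 2) * (F 1 - F 0))" by (rule ennreal_leI)
  also have "\<dots> = ennreal (2 * (real n + 2)) * ennreal (F 1 - F 0)" by (rule ennreal_mult') simp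
  finally show ?thesis by (simp add: J)
qed

section \<open>Trace inequality on the reference simplex\<close>

lemma affine_measurable:
  "(\<lambda>x. (\<Sum>i<n. a i * x i) + c) \<in> borel_measurable (rlebesgue n)"
  by (intro borel_measurable_add borel_measurable_sum) auto

text \<open>The facet is the base of a cone whose apex is the last unit vector. The slice at height
  \<open>s\<close> is the base shrunk by \<open>1 - s\<close>, which yields the weight
  \<open>(1 - s) ^ n\<close>, and on the ray from a base point \<open>z\<close> the function runs
  linearly from \<open>\<alpha> z\<close> to the apex value \<open>b\<close>. After Fubini,
  \<open>cone_integral_ge\<close> applies for each \<open>z\<close>.\<close>

lemma reference_trace_inequality:
  fixes a :: "nat \<Rightarrow> real" and c :: real
  shows "(\<integral>\<^sup>+y\<in>closed_ref_simplex n. ennreal (((\<Sum>i<n. a i * y i) + c)\<^sup>2) \<partial>rlebesgue n)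
    \<le> ennreal (2 * (real n + 2)) *
      (\<integral>\<^sup>+x\<in>open_ref_simplex (Suc n). ennreal (((\<Sum>i<Suc n. a i * x i) + c)\<^sup>2) \<partial>rlebesgue (Suc n))"
proof -
  let ?L = "rlebesgue n" and ?S = "open_ref_simplex n" and ?K = "ennreal (2 * (real n + 2))"
  define \<alpha> where "\<alpha> z = (\<Sum>i<n. a i * z i) + c" for z :: "nat \<Rightarrow> real"
  define b where "b = a n + c"
  let ?g = "\<lambda>s z. ennreal ((1 - s) ^ n * ((1 - s) * \<alpha> z + s * b)\<^sup>2)"
  have [measurable]: "\<alpha> \<in> borel_measurable ?L" unfolding \<alpha>_def[abs_def] by (rule affine_measurable)
  have "(\<lambda>x. ennreal (((\<Sum>i<Suc n. a i * x i) + c)\<^sup>2) * indicator (open_ref_simplex (Suc n)) x)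
      \<in> borel_measurable (rlebesgue (Suc n))"
    using affine_measurable[of a "Suc n" c] by measurable
  then have "(\<integral>\<^sup>+x\<in>open_ref_simplex (Suc n). ennreal (((\<Sum>i<Suc n. a i * x i) + c)\<^sup>2) \<partial>rlebesgue (Suc n))
      = (\<integral>\<^sup>+s. (\<integral>\<^sup>+y. ennreal (((\<Sum>i<Suc n. a i * (y(n := s)) i) + c)\<^sup>2) *
          indicator (open_ref_simplex (Suc n)) (y(n := s)) \<partial>?L) \<partial>lborel)"
    by (rule nn_integral_rlebesgue_Suc)
  also have "\<dots> \<ge> (\<integral>\<^sup>+s. (\<integral>\<^sup>+z. ?g s z * indicator {0<..<1} s * indicator ?S z \<partial>?L) \<partial>lborel)"
  proof (rule nn_integral_mono)
    fix s :: real
    show "(\<integral>\<^sup>+z. ?g s z * indicator {0<..<1} s * indicator ?S z \<partial>?L) \<le>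
       (\<integral>\<^sup>+y. ennreal (((\<Sum>i<Suc n. a i * (y(n := s)) i) + c)\<^sup>2) *
          indicator (open_ref_simplex (Suc n)) (y(n := s)) \<partial>?L)" (is "?l \<le> ?r")
    proof (cases "s \<in> {0<..<1}")
      case True
      define T where "T = (\<lambda>z. \<lambda>i\<in>{..<n}. 0 + (1 - s) * (z i :: real))"
      have [measurable]: "(\<lambda>y. y(n := s)) \<in> measurable ?L (rlebesgue (Suc n))"
        using measurable_compose[OF _ measurable_fun_upd_rlebesgue, of "\<lambda>y. (y, s)" ?L n] by simp
      have fm: "(\<lambda>y. ennreal (((\<Sum>i<Suc n. a i * (y(n := s)) i) + c)\<^sup>2) *
          indicator (open_ref_simplex (Suc n)) (y(n := s))) \<in> borel_measurable ?L"
        using measurable_compose[OF _ affine_measurable[of a "Suc n" c], of "\<lambda>y. y(n := s)" ?L] by measurable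
      have "?r = ennreal (\<bar>1 - s\<bar> ^ n) * (\<integral>\<^sup>+z. ennreal (((\<Sum>i<Suc n. a i * ((T z)(n := s)) i) + c)\<^sup>2) *
          indicator (open_ref_simplex (Suc n)) ((T z)(n := s)) \<partial>?L)"
        unfolding T_def by (rule nn_integral_rlebesgue_affine[OF _ fm]) (use True in auto)
      also have "\<dots> = ennreal (\<bar>1 - s\<bar> ^ n) * (\<integral>\<^sup>+z. ennreal (((1 - s) * \<alpha> z + s * b)\<^sup>2) * indicator ?S z \<partial>?L)"
      proof (rule arg_cong[where f = "\<lambda>x. _ * x"], rule nn_integral_cong)
        fix z assume "z \<in> space ?L"
        then have z: "z \<in> rspace n" by simp
        have 1: "(\<Sum>i<Suc n. a i * ((T z)(n := s)) i) + c = (1 - s) * \<alpha> z + s * b"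
          by (simp add: T_def \<alpha>_def b_def algebra_simps sum_distrib_left sum_subtractf)
        have "(\<Sum>i<Suc n. ((T z)(n := s)) i) = (1 - s) * (\<Sum>i<n. z i) + s"
          by (simp add: T_def sum_distrib_left)
        moreover have "(1 - s) * x + s < 1 \<longleftrightarrow> x < 1" for x :: real
        proof -
          have "1 - ((1 - s) * x + s) = (1 - s) * (1 - x)" by (simp add: algebra_simps)
          then have "0 < 1 - ((1 - s) * x + s) \<longleftrightarrow> 0 < 1 - x" using True by (simp add: zero_less_mult_iff)
          then show ?thesis by simp
        qed
        moreover have "(T z)(n := s) \<in> rspace (Suc n)"
          by (auto simp: T_def rspace_def PiE_def extensional_def)
        moreover have "(\<forall>j<Suc n. 0 < ((T z)(n := s)) j) \<longleftrightarrow> (\<forall>j<n. 0 < z j)"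
          using True by (auto simp: T_def less_Suc_eq zero_less_mult_iff)
        ultimately have 2: "(T z)(n := s) \<in> open_ref_simplex (Suc n) \<longleftrightarrow> z \<in> ?S"
          using z unfolding open_ref_simplex_def by simp
        show "ennreal (((\<Sum>i<Suc n. a i * ((T z)(n := s)) i) + c)\<^sup>2) *
            indicator (open_ref_simplex (Suc n)) ((T z)(n := s)) =
            ennreal (((1 - s) * \<alpha> z + s * b)\<^sup>2) * indicator ?S z"
          unfolding 1 indicator_def 2 ..
      qed
      also have "\<dots> = (\<integral>\<^sup>+z. ennreal (\<bar>1 - s\<bar> ^ n) * (ennreal (((1 - s) * \<alpha> z + s * b)\<^sup>2) * indicator ?S z) \<partial>?L)"
        by (rule nn_integral_cmult[symmetric]) measurable
      also have "\<dots> = ?l"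
        using True by (intro nn_integral_cong) (simp add: ennreal_mult' mult.assoc)
      finally show ?thesis by simp
    qed simp
  qed
  also have "(\<integral>\<^sup>+s. (\<integral>\<^sup>+z. ?g s z * indicator {0<..<1} s * indicator ?S z \<partial>?L) \<partial>lborel)
      = (\<integral>\<^sup>+z. (\<integral>\<^sup>+s. ?g s z * indicator {0<..<1} s * indicator ?S z \<partial>lborel) \<partial>?L)"
  proof -
    interpret L: sigma_finite_measure ?L by (rule sigma_finite_rlebesgue)
    interpret pair_sigma_finite ?L lborel ..
    show ?thesis by (rule Fubini') measurable
  qed
  finally have main: "(\<integral>\<^sup>+z. (\<integral>\<^sup>+s. ?g s z * indicator {0<..<1} s * indicator ?S z \<partial>lborel) \<partial>?L) \<le>
    (\<integral>\<^sup>+x\<in>open_ref_simplex (Suc n). ennreal (((\<Sum>i<Suc n. a i * x i) + c)\<^sup>2) \<partial>rlebesgue (Suc n))"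
    (is "?m \<le> ?I") .
  have "(\<integral>\<^sup>+y\<in>closed_ref_simplex n. ennreal ((\<alpha> y)\<^sup>2) \<partial>?L) \<le> (\<integral>\<^sup>+y\<in>?S. ennreal ((\<alpha> y)\<^sup>2) \<partial>?L)"
    by (rule nn_integral_mono_AE, use AE_closed_ref_simplex[of n] in eventually_elim)
       (auto simp: indicator_def)
  also have "\<dots> \<le> (\<integral>\<^sup>+z. ?K * (\<integral>\<^sup>+s. ?g s z * indicator {0<..<1} s * indicator ?S z \<partial>lborel) \<partial>?L)"
  proof (rule nn_integral_mono)
    fix z show "ennreal ((\<alpha> z)\<^sup>2) * indicator ?S z \<le>
        ?K * (\<integral>\<^sup>+s. ?g s z * indicator {0<..<1} s * indicator ?S z \<partial>lborel)"
      using cone_integral_ge[of "\<alpha> z" n b] by (cases "z \<in> ?S") simp_all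
  qed
  also have "\<dots> = ?K * ?m" by (rule nn_integral_cmult) measurable
  also have "\<dots> \<le> ?K * ?I" by (rule mult_left_mono[OF main]) simp
  finally show ?thesis unfolding \<alpha>_def .
qed

section \<open>Slabs and ball volumes\<close>

text \<open>The shear moves the slice at height \<open>s\<close> by \<open>s m\<close>, which
  preserves its measure and puts it inside \<open>E\<close>; the heights fill an interval of length
  \<open>2 u\<close>.\<close>

lemma emeasure_sheared_slab_le:
  assumes D: "D \<in> sets (rlebesgue (Suc n))" and E [measurable]: "E \<in> sets (rlebesgue n)" and u: "0 \<le> u"
    and sub: "\<And>x. x \<in> D \<Longrightarrow> \<bar>x n\<bar> \<le> u \<and> (\<lambda>j\<in>{..<n}. x n * m j + x j) \<in> E"
  shows "emeasure (rlebesgue (Suc n)) D \<le> ennreal (2 * u) * emeasure (rlebesgue n) E"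
proof -
  have "emeasure (rlebesgue (Suc n)) D = (\<integral>\<^sup>+x. indicator D x \<partial>rlebesgue (Suc n))" using D by simp
  also have "\<dots> = (\<integral>\<^sup>+s. (\<integral>\<^sup>+y. indicator D (y(n := s)) \<partial>rlebesgue n) \<partial>lborel)"
    by (rule nn_integral_rlebesgue_Suc) (use D in simp)
  also have "\<dots> \<le> (\<integral>\<^sup>+s. emeasure (rlebesgue n) E * indicator {-u..u} s \<partial>lborel)"
  proof (rule nn_integral_mono)
    fix s
    have "(\<integral>\<^sup>+y. indicator D (y(n := s)) \<partial>rlebesgue n) \<le>
        (\<integral>\<^sup>+y. indicator {-u..u} s * indicator E (\<lambda>j\<in>{..<n}. s * m j + y j) \<partial>rlebesgue n)"
    proof (rule nn_integral_mono)
      fix y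
      have e: "(\<lambda>j\<in>{..<n}. (y(n := s)) n * m j + (y(n := s)) j) = (\<lambda>j\<in>{..<n}. s * m j + y j)"
        by (auto simp: restrict_def fun_eq_iff)
      show "indicator D (y(n := s)) \<le>
          (indicator {-u..u} s * indicator E (\<lambda>j\<in>{..<n}. s * m j + y j) :: ennreal)"
        using sub[of "y(n := s)"] unfolding e by (auto simp: indicator_def abs_le_iff)
    qed
    also have "\<dots> = indicator {-u..u} s * (\<integral>\<^sup>+y. indicator E (\<lambda>j\<in>{..<n}. s * m j + y j) \<partial>rlebesgue n)"
      by (rule nn_integral_cmult) measurable
    also have "(\<integral>\<^sup>+y. indicator E (\<lambda>j\<in>{..<n}. s * m j + y j) \<partial>rlebesgue n) = (\<integral>\<^sup>+y. indicator E y \<partial>rlebesgue n)"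
      by (rule nn_integral_rlebesgue_translate[symmetric]) simp
    also have "\<dots> = emeasure (rlebesgue n) E" by simp
    finally show "(\<integral>\<^sup>+y. indicator D (y(n := s)) \<partial>rlebesgue n) \<le> emeasure (rlebesgue n) E * indicator {-u..u} s"
      by (simp only: mult.commute)
  qed
  also have "\<dots> = emeasure (rlebesgue n) E * ennreal (2 * u)"
    using u by (subst nn_integral_cmult_indicator) auto
  finally show ?thesis by (simp add: mult.commute)
qed

text \<open>The true ratio grows like the square root of \<open>n\<close>. The linear factor follows
  from monotonicity of Gamma, comparing \<open>Gamma ((n + 1) / 2 + 1)\<close> with
  \<open>Gamma (n / 2 + 2)\<close>, and the functional equation; \<open>n = 0\<close> is
  computed.\<close>

lemma unit_ball_vol_Suc_ge: "unit_ball_vol (real n) \<le> real (Suc n) * unit_ball_vol (real (Suc n))"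
proof -
  have 1: "Gamma ((real n + 1) / 2 + 1) \<le> (real n + 1) * sqrt pi * Gamma (real n / 2 + 1)"
  proof (cases "n = 0")
    case True
    have "Gamma (1 / 2 + 1 :: real) = 1 / 2 * sqrt pi"
      by (subst Gamma_plus1) (auto simp: Gamma_one_half_real elim!: nonpos_Ints_cases)
    also have "\<dots> \<le> sqrt pi" using real_sqrt_ge_zero[OF pi_ge_zero] by linarith
    finally show ?thesis using True by simp
  next
    case False
    have "Gamma ((real n + 1) / 2 + 1) \<le> Gamma (real n / 2 + 1 + 1)"
      by (rule less_imp_le, rule Gamma_real_strict_mono) (use False in auto)
    also have "\<dots> = (real n / 2 + 1) * Gamma (real n / 2 + 1)"
      by (subst Gamma_plus1) (auto elim!: nonpos_Ints_cases)
    also have "\<dots> \<le> (real n + 1) * sqrt pi * Gamma (real n / 2 + 1)"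
    proof (rule mult_right_mono)
      have "(real n + 1) * 1 \<le> (real n + 1) * sqrt pi"
        by (rule mult_left_mono) (use pi_gt3 in auto)
      moreover have "real n / 2 + 1 \<le> (real n + 1) * 1" by simp
      ultimately show "real n / 2 + 1 \<le> (real n + 1) * sqrt pi" by (rule order_trans[rotated])
    qed simp
    finally show ?thesis .
  qed
  have pos: "0 < Gamma (real n / 2 + 1)" "0 < Gamma ((real n + 1) / 2 + 1)"
    by (auto intro!: Gamma_real_pos add_nonneg_pos)
  have p: "pi powr ((real n + 1) / 2) = pi powr (real n / 2) * sqrt pi"
    by (simp add: add_divide_distrib powr_add powr_half_sqrt)
  have "pi powr (real n / 2) * Gamma ((real n + 1) / 2 + 1) \<le>
      pi powr (real n / 2) * ((real n + 1) * sqrt pi * Gamma (real n / 2 + 1))"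
    by (rule mult_left_mono[OF 1]) simp
  then show ?thesis
    using pos unfolding unit_ball_vol_def of_nat_Suc add.commute[of 1] p by (simp add: field_simps)
qed

section \<open>Hausdorff measure\<close>

text \<open>The expression under the supremum in \<open>hausdorff_outer\<close>. Explicit covers are
  estimated at a fixed mesh \<open>\<delta>\<close>, with bounds free of \<open>\<delta>\<close>,
  before the supremum is taken.\<close>

definition hausdorff_content :: "nat \<Rightarrow> nat \<Rightarrow> real \<Rightarrow> (nat \<Rightarrow> real) set \<Rightarrow> ennreal" where
  "hausdorff_content d s \<delta> A = (INF U\<in>hausdorff_covers d \<delta> A. \<Sum>k. ennreal (hausdorff_weight d s (U k)))"

lemma hausdorff_outer_eq: "hausdorff_outer d s A = (SUP \<delta>\<in>{0<..}. hausdorff_content d s \<delta> A)"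
  by (simp add: hausdorff_outer_def hausdorff_content_def)

lemma hausdorff_content_le_outer: "0 < \<delta> \<Longrightarrow> hausdorff_content d s \<delta> A \<le> hausdorff_outer d s A"
  unfolding hausdorff_outer_eq by (rule SUP_upper) simp

lemma rdist_self [simp]: "rdist d x x = 0"
  by (simp add: rdist_def L2_set_def)

lemma hausdorff_weight_le:
  assumes D: "\<And>x y. x \<in> S \<Longrightarrow> y \<in> S \<Longrightarrow> rdist d x y \<le> D" and "0 \<le> D"
  shows "hausdorff_weight d s S \<le> unit_ball_vol (real s) * (D / 2) ^ s"
proof (cases "S = {}")
  case True
  then show ?thesis using \<open>0 \<le> D\<close> by (simp add: hausdorff_weight_def)
next
  case False
  then obtain x where x: "x \<in> S" by auto
  have "rdiam d S \<le> D" unfolding rdiam_def using False D by (auto intro!: cSUP_least)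
  moreover have "0 \<le> rdiam d S"
  proof -
    have "bdd_above ((\<lambda>(x, y). rdist d x y) ` (S \<times> S))" using D by (auto intro!: bdd_aboveI[of _ D])
    then have "rdist d x x \<le> (SUP (x, y)\<in>S \<times> S. rdist d x y)"
      using cSUP_upper[of "(x, x)" "S \<times> S" "\<lambda>(x, y). rdist d x y"] x by simp
    then show ?thesis using False by (simp add: rdiam_def)
  qed
  ultimately show ?thesis using False
    by (auto simp: hausdorff_weight_def intro!: mult_left_mono power_mono)
qed

lemma hausdorff_content_empty [simp]: "0 < \<delta> \<Longrightarrow> hausdorff_content d s \<delta> {} = 0"
proof -
  assume "0 < \<delta>"
  have "hausdorff_content d s \<delta> {} \<le> (\<Sum>k. ennreal (hausdorff_weight d s ((\<lambda>_. {}) k)))"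
    unfolding hausdorff_content_def by (rule INF_lower) (simp add: hausdorff_covers_def)
  then show ?thesis by (simp add: hausdorff_weight_def)
qed

lemma hausdorff_content_mono: "A \<subseteq> B \<Longrightarrow> hausdorff_content d s \<delta> A \<le> hausdorff_content d s \<delta> B"
  unfolding hausdorff_content_def by (rule INF_superset_mono) (auto simp: hausdorff_covers_def)

lemma hausdorff_content_Un:
  assumes U: "U \<subseteq> rspace d" "\<And>x y. x \<in> U \<Longrightarrow> y \<in> U \<Longrightarrow> rdist d x y \<le> \<delta>"
  shows "hausdorff_content d s \<delta> (U \<union> A) \<le> ennreal (hausdorff_weight d s U) + hausdorff_content d s \<delta> A"
proof -
  let ?w = "\<lambda>S. ennreal (hausdorff_weight d s S)"
  \<comment> \<open>The weight of \<open>U\<close> is moved to the left by truncated subtraction, so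
    that the infimum over the covers of \<open>A\<close> can be taken on the right.\<close>
  have "hausdorff_content d s \<delta> (U \<union> A) - ?w U \<le> (\<Sum>k. ?w (W k))" if W: "W \<in> hausdorff_covers d \<delta> A" for W
  proof -
    let ?V = "case_nat U W"
    have "?V \<in> hausdorff_covers d \<delta> (U \<union> A)"
    proof -
      have "U \<union> A \<subseteq> (\<Union>k. ?V k)"
      proof
        fix x assume "x \<in> U \<union> A"
        then consider "x \<in> ?V 0" | k where "x \<in> ?V (Suc k)" using W by (auto simp: hausdorff_covers_def)
        then show "x \<in> (\<Union>k. ?V k)" by cases blast+
      qed
      then show ?thesis using W U by (auto simp: hausdorff_covers_def split: nat.split)
    qed
    then have "hausdorff_content d s \<delta> (U \<union> A) \<le> (\<Sum>k. ?w (?V k))"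
      unfolding hausdorff_content_def by (rule INF_lower)
    also have "\<dots> = ?w U + (\<Sum>k. ?w (W k))"
      using suminf_offset[of "\<lambda>k. ?w (?V k)" 1] by (simp add: add.commute)
    finally show ?thesis by (simp add: ennreal_minus_le_iff)
  qed
  then have "hausdorff_content d s \<delta> (U \<union> A) - ?w U \<le> hausdorff_content d s \<delta> A"
    unfolding hausdorff_content_def[of d s \<delta> A] by (rule INF_greatest)
  then show ?thesis by (simp add: ennreal_minus_le_iff)
qed

lemma hausdorff_content_UN:
  assumes "finite I" and U: "\<And>i. i \<in> I \<Longrightarrow> U i \<subseteq> rspace d"
    "\<And>i x y. i \<in> I \<Longrightarrow> x \<in> U i \<Longrightarrow> y \<in> U i \<Longrightarrow> rdist d x y \<le> \<delta>"
  shows "hausdorff_content d s \<delta> ((\<Union>i\<in>I. U i) \<union> A) \<le>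
    (\<Sum>i\<in>I. ennreal (hausdorff_weight d s (U i))) + hausdorff_content d s \<delta> A"
  using assms
proof (induction I rule: finite_induct)
  case (insert i I)
  have "hausdorff_content d s \<delta> (U i \<union> ((\<Union>i\<in>I. U i) \<union> A)) \<le>
     ennreal (hausdorff_weight d s (U i)) + hausdorff_content d s \<delta> ((\<Union>i\<in>I. U i) \<union> A)"
    using insert.prems(1)[of i] insert.prems(2)[of i] by (intro hausdorff_content_Un) simp_all
  also have "\<dots> \<le> ennreal (hausdorff_weight d s (U i)) +
      ((\<Sum>i\<in>I. ennreal (hausdorff_weight d s (U i))) + hausdorff_content d s \<delta> A)"
    by (intro add_left_mono insert.IH) (use insert.prems in blast)+
  finally show ?case using insert.hyps by (simp add: Un_assoc add.assoc)
qed simp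

lemma rdist_rtranslate [simp]: "rdist d (rtranslate d a x) (rtranslate d a y) = rdist d x y"
  unfolding rdist_def by (rule L2_set_cong) (auto simp: rtranslate_def)

lemma rtranslate_vimage_image:
  assumes "A \<subseteq> rspace d"
  shows "rtranslate d a -` A \<inter> rspace d = rtranslate d (\<lambda>i. - a i) ` A"
proof (intro set_eqI iffI)
  fix x assume "x \<in> rtranslate d a -` A \<inter> rspace d"
  then show "x \<in> rtranslate d (\<lambda>i. - a i) ` A"
    using rtranslate_uminus(1)[of x d a] by (auto intro!: rev_image_eqI)
next
  fix x assume "x \<in> rtranslate d (\<lambda>i. - a i) ` A"
  then show "x \<in> rtranslate d a -` A \<inter> rspace d"
    using rtranslate_uminus(2)[of _ d a] assms by auto
qed

lemma hausdorff_weight_rtranslate: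
  "hausdorff_weight d s (rtranslate d a ` S) = hausdorff_weight d s S"
proof -
  have "(\<lambda>(x, y). rdist d x y) ` (rtranslate d a ` S \<times> rtranslate d a ` S) = (\<lambda>(x, y). rdist d x y) ` (S \<times> S)"
  proof -
    have "(\<lambda>(x, y). rdist d x y) ` (A \<times> A) = {rdist d x y |x y. x \<in> A \<and> y \<in> A}" for A
      by auto
    moreover have "{rdist d x y |x y. x \<in> rtranslate d a ` S \<and> y \<in> rtranslate d a ` S} =
        {rdist d (rtranslate d a x) (rtranslate d a y) |x y. x \<in> S \<and> y \<in> S}" by blast
    ultimately show ?thesis by simp
  qed
  then have "rdiam d (rtranslate d a ` S) = rdiam d S" unfolding rdiam_def by simp
  then show ?thesis by (simp add: hausdorff_weight_def)
qed

lemma hausdorff_outer_rtranslate_le: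
  "hausdorff_outer d s (rtranslate d a ` A) \<le> hausdorff_outer d s A"
proof -
  have "hausdorff_content d s \<delta> (rtranslate d a ` A) \<le> hausdorff_content d s \<delta> A" for \<delta>
    unfolding hausdorff_content_def
  proof (rule INF_greatest)
    fix U assume U: "U \<in> hausdorff_covers d \<delta> A"
    have "(\<lambda>k. rtranslate d a ` U k) \<in> hausdorff_covers d \<delta> (rtranslate d a ` A)"
      using U by (auto simp: hausdorff_covers_def) blast
    then have "(INF U\<in>hausdorff_covers d \<delta> (rtranslate d a ` A). \<Sum>k. ennreal (hausdorff_weight d s (U k))) \<le>
        (\<Sum>k. ennreal (hausdorff_weight d s (rtranslate d a ` U k)))"
      by (rule INF_lower)
    then show "(INF U\<in>hausdorff_covers d \<delta> (rtranslate d a ` A). \<Sum>k. ennreal (hausdorff_weight d s (U k))) \<le>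
        (\<Sum>k. ennreal (hausdorff_weight d s (U k)))"
      by (simp add: hausdorff_weight_rtranslate)
  qed
  then show ?thesis unfolding hausdorff_outer_eq by (intro SUP_mono) auto
qed

lemma sets_hausdorff_measure [simp]: "sets (hausdorff_measure d s) = sets (rlebesgue d)"
proof -
  have "sets (Pi\<^sub>M {..<d} (\<lambda>_. borel :: real measure)) \<subseteq> Pow (rspace d)"
    using sets.space_closed[of "rlebesgue d"] by (simp add: sets_rlebesgue)
  then have "sets (hausdorff_measure d s) = sigma_sets (rspace d) (sets (rlebesgue d))"
    unfolding hausdorff_measure_def sets_rlebesgue by (rule sets_measure_of)
  then show ?thesis using sets.sigma_sets_eq[of "rlebesgue d"] by simp
qed

text \<open>\<open>measure_of\<close> yields the zero measure unless the set function is a measure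
  on the generated sigma-algebra. Both outcomes are kept: in the first every upper bound is trivial,
  in the second Borel sets can be estimated by covers.\<close>

lemma emeasure_hausdorff_measure_cases:
  obtains (null) "\<And>A. emeasure (hausdorff_measure d s) A = 0"
  | (outer) "\<And>A. A \<in> sets (rlebesgue d) \<Longrightarrow> emeasure (hausdorff_measure d s) A = hausdorff_outer d s A"
proof -
  let ?S = "sets (Pi\<^sub>M {..<d} (\<lambda>_. borel :: real measure))"
  have e: "emeasure (hausdorff_measure d s) A =
      (if A \<in> sigma_sets (rspace d) ?S \<and> measure_space (rspace d) (sigma_sets (rspace d) ?S) (hausdorff_outer d s)
       then hausdorff_outer d s A else 0)" for A
    unfolding hausdorff_measure_def by (subst emeasure_measure_of_conv) simp
  show thesis
  proof (cases "measure_space (rspace d) (sigma_sets (rspace d) ?S) (hausdorff_outer d s)")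
    case True
    then show thesis using e by (intro outer) (auto simp: sets_rlebesgue)
  next
    case False
    then show thesis using e by (intro null) auto
  qed
qed

text \<open>Translating a cover preserves its weights, which gives one inequality; translating back
  gives the other.\<close>

lemma translation_invariant_hausdorff_measure: "translation_invariant d (hausdorff_measure d s)"
  unfolding translation_invariant_def
proof (intro conjI allI ballI)
  fix a B assume "B \<in> sets (hausdorff_measure d s)"
  then have B: "B \<in> sets (rlebesgue d)" by simp
  then have B': "B \<subseteq> rspace d" using sets.sets_into_space by fastforce
  have m: "rtranslate d a -` B \<inter> rspace d \<in> sets (rlebesgue d)"
    using measurable_sets[OF measurable_rtranslate B] by simp
  have "rtranslate d a ` (rtranslate d (\<lambda>i. - a i) ` B) = B"
    using B' by (force simp: image_image)
  then have "hausdorff_outer d s B \<le> hausdorff_outer d s (rtranslate d (\<lambda>i. - a i) ` B)"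
    using hausdorff_outer_rtranslate_le[of d s a "rtranslate d (\<lambda>i. - a i) ` B"] by simp
  then have "hausdorff_outer d s (rtranslate d a -` B \<inter> rspace d) = hausdorff_outer d s B"
    unfolding rtranslate_vimage_image[OF B'] using hausdorff_outer_rtranslate_le by (intro antisym) auto
  then show "emeasure (hausdorff_measure d s) (rtranslate d a -` B \<inter> rspace d) = emeasure (hausdorff_measure d s) B"
    using m B by (cases rule: emeasure_hausdorff_measure_cases[of d s]) auto
qed simp

section \<open>Affine charts with linear left inverses\<close>

definition raffine_coords :: "nat \<Rightarrow> nat \<Rightarrow> (nat \<Rightarrow> real) \<Rightarrow> (nat \<Rightarrow> nat \<Rightarrow> real) \<Rightarrow> (nat \<Rightarrow> real) \<Rightarrow> nat \<Rightarrow> real" where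
  "raffine_coords d n b R z = (\<lambda>j\<in>{..<n}. \<Sum>i<d. R j i * (z i - b i))"

text \<open>As a matrix, \<open>R\<close> is a left inverse of \<open>G\<close>. In the application
  \<open>G\<close> holds the edge vectors of a simplex and \<open>R\<close> the gradients of its
  barycentric coordinates.\<close>

definition dual_family :: "nat \<Rightarrow> nat \<Rightarrow> (nat \<Rightarrow> nat \<Rightarrow> real) \<Rightarrow> (nat \<Rightarrow> nat \<Rightarrow> real) \<Rightarrow> bool" where
  "dual_family d n G R \<longleftrightarrow> (\<forall>j<n. \<forall>l<n. (\<Sum>i<d. R j i * G l i) = (if j = l then 1 else 0))"

lemma measurable_raffine_coords: "raffine_coords d n b R \<in> measurable (rlebesgue d) (rlebesgue n)"
proof -
  have "(\<lambda>z. \<Sum>i<d. R j i * (z i - b i)) \<in> borel_measurable (rlebesgue d)" for j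
    by (rule borel_measurable_sum) auto
  then show ?thesis unfolding raffine_coords_def by measurable
qed

lemma dual_family_coeff:
  assumes "dual_family d n G R" "j < n"
  shows "(\<Sum>i<d. R j i * (\<Sum>l<n. y l * G l i)) = y j"
proof -
  have "(\<Sum>i<d. R j i * (\<Sum>l<n. y l * G l i)) = (\<Sum>l<n. y l * (\<Sum>i<d. R j i * G l i))"
    by (simp add: sum_distrib_left mult_ac) (rule sum.swap)
  also have "\<dots> = (\<Sum>l<n. y l * (if j = l then 1 else 0))"
    using assms unfolding dual_family_def by (intro sum.cong) auto
  also have "\<dots> = y j" using assms(2) by (simp add: if_distrib cong: if_cong)
  finally show ?thesis .
qed

lemma raffine_coords_map:
  assumes "dual_family d n G R" "x \<in> rspace n"
  shows "raffine_coords d n b R (raffine_map d n b G x) = x"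
proof -
  have "raffine_coords d n b R (raffine_map d n b G x) = (\<lambda>j\<in>{..<n}. \<Sum>i<d. R j i * (\<Sum>l<n. x l * G l i))"
    unfolding raffine_coords_def raffine_map_def by (intro restrict_ext sum.cong) auto
  also have "\<dots> = (\<lambda>j\<in>{..<n}. x j)"
    by (rule restrict_ext) (simp add: dual_family_coeff[OF assms(1)])
  also have "\<dots> = x" using assms(2) by (auto simp: rspace_def PiE_def extensional_restrict)
  finally show ?thesis .
qed

lemma rdist_raffine_map:
  "rdist d (raffine_map d n b G x) (raffine_map d n b G y) = L2_set (\<lambda>i. \<Sum>j<n. (x j - y j) * G j i) {..<d}"
  unfolding rdist_def raffine_map_def
  by (rule L2_set_cong) (auto simp: sum_subtractf algebra_simps)

lemma rdist_raffine_map_scale: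
  assumes "0 \<le> c" "\<And>j. j < n \<Longrightarrow> x j - y j = c * (x' j - y' j)"
  shows "rdist d (raffine_map d n b G x) (raffine_map d n b G y) =
    c * rdist d (raffine_map d n b G x') (raffine_map d n b G y')"
  unfolding rdist_raffine_map L2_set_right_distrib[OF assms(1)]
  by (rule L2_set_cong) (simp_all add: sum_distrib_left assms(2) mult.assoc)

section \<open>Hausdorff measure on affine subspaces\<close>

text \<open>The copy \<open>(k + C) / N\<close>, written as a preimage so that measurability and the
  scaling law of Lebesgue measure apply directly.\<close>

definition grid_cell :: "nat \<Rightarrow> nat \<Rightarrow> (nat \<Rightarrow> real) set \<Rightarrow> (nat \<Rightarrow> nat) \<Rightarrow> (nat \<Rightarrow> real) set" where
  "grid_cell n N C k = (\<lambda>x. \<lambda>i\<in>{..<n}. - real (k i) + real N * x i) -` C \<inter> rspace n"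

lemma grid_cell_measurable:
  assumes "C \<in> sets (rlebesgue n)"
  shows "grid_cell n N C k \<in> sets (rlebesgue n)"
proof -
  have "(\<lambda>x. \<lambda>i\<in>{..<n}. - real (k i) + real N * x i) \<in> measurable (rlebesgue n) (rlebesgue n)" by measurable
  from measurable_sets[OF this assms] show ?thesis by (simp add: grid_cell_def)
qed

lemma grid_cell_bounds:
  assumes "C \<subseteq> rcube n" "x \<in> grid_cell n N C k" "i < n"
  shows "real (k i) \<le> real N * x i" "real N * x i < real (k i) + 1"
proof -
  have "(\<lambda>i\<in>{..<n}. - real (k i) + real N * x i) i \<in> {0..<1}"
    using assms by (auto simp: grid_cell_def PiE_def Pi_def)
  then show "real (k i) \<le> real N * x i" "real N * x i < real (k i) + 1" using assms(3) by auto
qed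

lemma grid_cells_subset:
  assumes C: "C \<subseteq> rcube n" and N: "0 < N"
  shows "(\<Union>k\<in>{..<n} \<rightarrow>\<^sub>E {..<N}. grid_cell n N C k) \<subseteq> rcube n"
proof (rule UN_least)
  fix k :: "nat \<Rightarrow> nat" assume k: "k \<in> {..<n} \<rightarrow>\<^sub>E {..<N}"
  show "grid_cell n N C k \<subseteq> rcube n"
  proof
    fix x assume x: "x \<in> grid_cell n N C k"
    have "0 \<le> x i \<and> x i < 1" if "i < n" for i
    proof -
      note b = grid_cell_bounds[OF C x that]
      have "real (k i) + 1 \<le> real N" using k that by (auto simp: PiE_def Pi_def Suc_le_eq[symmetric])
      then have "real N * x i < real N * 1" "0 \<le> real N * x i" using b by linarith+
      moreover have "0 < real N" using N by simp
      ultimately show ?thesis using mult_less_cancel_left_pos zero_le_mult_iff by (metis less_le_not_le)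
    qed
    moreover have "x \<in> rspace n" using x by (simp add: grid_cell_def)
    ultimately show "x \<in> rcube n" by (auto simp: rspace_def PiE_def)
  qed
qed

lemma grid_cells_rcube:
  assumes N: "0 < N"
  shows "rcube n \<subseteq> (\<Union>k\<in>{..<n} \<rightarrow>\<^sub>E {..<N}. grid_cell n N (rcube n) k)"
proof
  fix x assume x: "x \<in> rcube n"
  define k where "k = (\<lambda>i\<in>{..<n}. nat \<lfloor>real N * x i\<rfloor>)"
  have b: "0 \<le> real N * x i" "real N * x i < real N" if "i < n" for i
    using x that N by (auto simp: PiE_def Pi_def)
  have "k i < N" if "i < n" for i
    using b[OF that] that by (simp add: k_def) linarith
  then have "k \<in> {..<n} \<rightarrow>\<^sub>E {..<N}" by (auto simp: k_def)
  moreover have "x \<in> grid_cell n N (rcube n) k"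
    using x b by (auto simp: grid_cell_def rspace_def k_def PiE_def Pi_def) linarith
  ultimately show "x \<in> (\<Union>k\<in>{..<n} \<rightarrow>\<^sub>E {..<N}. grid_cell n N (rcube n) k)" by blast
qed

lemma emeasure_grid_cells:
  assumes C: "C \<in> sets (rlebesgue n)" "C \<subseteq> rcube n" and N: "0 < N"
  shows "emeasure (rlebesgue n) (\<Union>k\<in>{..<n} \<rightarrow>\<^sub>E {..<N}. grid_cell n N C k) = emeasure (rlebesgue n) C"
proof -
  let ?I = "{..<n} \<rightarrow>\<^sub>E {..<N}"
  have fin: "finite ?I" by (rule finite_PiE) auto
  have disj: "disjoint_family_on (grid_cell n N C) ?I"
    unfolding disjoint_family_on_def
  proof (intro ballI impI equals0I)
    fix k l x assume kl: "k \<in> ?I" "l \<in> ?I" "k \<noteq> l" "x \<in> grid_cell n N C k \<inter> grid_cell n N C l"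
    have "k i = l i" if "i < n" for i
      using grid_cell_bounds[OF C(2) _ that, of x N k] grid_cell_bounds[OF C(2) _ that, of x N l] kl(4) by auto
    then have "k = l" using kl(1,2) by (intro PiE_ext) auto
    then show False using kl(3) by simp
  qed
  have "emeasure (rlebesgue n) (\<Union>k\<in>?I. grid_cell n N C k) = (\<Sum>k\<in>?I. emeasure (rlebesgue n) (grid_cell n N C k))"
    using grid_cell_measurable[OF C(1)] fin disj by (intro sum_emeasure[symmetric]) auto
  also have "\<dots> = (\<Sum>k\<in>?I. emeasure (rlebesgue n) (grid_cell n N C (\<lambda>_. 0)))"
  proof (rule sum.cong[OF refl])
    have e: "ennreal (real N ^ n) * emeasure (rlebesgue n) (grid_cell n N C k) = emeasure (rlebesgue n) C" for k
      unfolding grid_cell_def using emeasure_rlebesgue_affine[of "real N" C n "\<lambda>i. - real (k i)"] C N by simp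
    show "emeasure (rlebesgue n) (grid_cell n N C k) = emeasure (rlebesgue n) (grid_cell n N C (\<lambda>_. 0))" for k
      using trans[OF e[of k] e[of "\<lambda>_. 0", symmetric]] N by (simp add: ennreal_mult_cancel_left)
  qed
  also have "\<dots> = ennreal (real N ^ n) * emeasure (rlebesgue n) (grid_cell n N C (\<lambda>_. 0))"
    by (simp add: card_PiE ennreal_of_nat_eq_real_of_nat)
  also have "\<dots> = emeasure (rlebesgue n) C"
    unfolding grid_cell_def using emeasure_rlebesgue_affine[of "real N" C n "\<lambda>i. 0"] C N by simp
  finally show ?thesis .
qed

context
  fixes d n :: nat and b :: "nat \<Rightarrow> real" and G R :: "nat \<Rightarrow> nat \<Rightarrow> real"
  assumes dual: "dual_family d n G R"
begin

text \<open>Each of the \<open>N ^ n\<close> copies has an image of diameter at most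
  \<open>D / N\<close>, hence of weight at most \<open>omega_n (D / (2 N)) ^ n\<close>. The total is
  free of \<open>N\<close>, so the cover can be made as fine as \<open>\<delta>\<close> demands at
  no cost.\<close>

lemma hausdorff_content_grid_cells:
  assumes N: "0 < N" and D: "\<And>x y. x \<in> C \<Longrightarrow> y \<in> C \<Longrightarrow> rdist d (raffine_map d n b G x) (raffine_map d n b G y) \<le> D"
    and "0 \<le> D" and \<delta>: "D / real N \<le> \<delta>"
  shows "hausdorff_content d n \<delta>
      (raffine_map d n b G ` (\<Union>k\<in>{..<n} \<rightarrow>\<^sub>E {..<N}. grid_cell n N C k) \<union> A)
    \<le> ennreal (unit_ball_vol (real n) * (D / 2) ^ n) + hausdorff_content d n \<delta> A"
proof -
  let ?\<Phi> = "raffine_map d n b G" and ?I = "{..<n} \<rightarrow>\<^sub>E {..<N}"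
  have diam: "rdist d x y \<le> D / real N" if xy: "x \<in> ?\<Phi> ` grid_cell n N C k" "y \<in> ?\<Phi> ` grid_cell n N C k" for x y k
  proof -
    let ?f = "\<lambda>x. \<lambda>i\<in>{..<n}. - real (k i) + real N * x i"
    obtain x' y' where x': "x = ?\<Phi> x'" "?f x' \<in> C" and y': "y = ?\<Phi> y'" "?f y' \<in> C"
      using xy by (auto simp: grid_cell_def)
    have "rdist d x y = (1 / real N) * rdist d (?\<Phi> (?f x')) (?\<Phi> (?f y'))"
      unfolding x' y' by (rule rdist_raffine_map_scale) (use N in \<open>auto simp: field_simps\<close>)
    also have "\<dots> \<le> (1 / real N) * D" by (rule mult_left_mono[OF D[OF x'(2) y'(2)]]) simp
    finally show ?thesis by simp
  qed
  have "hausdorff_content d n \<delta> ((\<Union>k\<in>?I. ?\<Phi> ` grid_cell n N C k) \<union> A)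
    \<le> (\<Sum>k\<in>?I. ennreal (hausdorff_weight d n (?\<Phi> ` grid_cell n N C k))) + hausdorff_content d n \<delta> A"
  proof (rule hausdorff_content_UN)
    show "finite ?I" by (rule finite_PiE) auto
    show "rdist d x y \<le> \<delta>" if "x \<in> ?\<Phi> ` grid_cell n N C k" "y \<in> ?\<Phi> ` grid_cell n N C k" for x y k
      using diam[OF that] \<delta> by linarith
    show "?\<Phi> ` grid_cell n N C k \<subseteq> rspace d" for k by (simp add: image_subset_iff)
  qed
  also have "(\<Sum>k\<in>?I. ennreal (hausdorff_weight d n (?\<Phi> ` grid_cell n N C k)))
      \<le> (\<Sum>k\<in>?I. ennreal (unit_ball_vol (real n) * (D / real N / 2) ^ n))"
    by (intro sum_mono ennreal_leI hausdorff_weight_le diam) (use \<open>0 \<le> D\<close> in auto)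
  also have "\<dots> = ennreal (real (N ^ n) * (unit_ball_vol (real n) * (D / real N / 2) ^ n))"
    using \<open>0 \<le> D\<close> by (simp add: card_PiE ennreal_of_nat_eq_real_of_nat ennreal_mult)
  also have "real (N ^ n) * (unit_ball_vol (real n) * (D / real N / 2) ^ n) = unit_ball_vol (real n) * (D / 2) ^ n"
    using N by (simp add: power_divide power_mult_distrib)
  finally show ?thesis by (simp add: image_UN add_right_mono)
qed

lemma rcube_image_diam:
  obtains D where "0 \<le> D"
    "\<And>x y. x \<in> rcube n \<Longrightarrow> y \<in> rcube n \<Longrightarrow> rdist d (raffine_map d n b G x) (raffine_map d n b G y) \<le> D"
proof (rule that)
  let ?D = "\<Sum>i<d. \<Sum>j<n. \<bar>G j i\<bar>"
  show "0 \<le> ?D" by (intro sum_nonneg) auto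
  fix x y assume xy: "x \<in> rcube n" "y \<in> rcube n"
  have "rdist d (raffine_map d n b G x) (raffine_map d n b G y) \<le> (\<Sum>i<d. \<bar>\<Sum>j<n. (x j - y j) * G j i\<bar>)"
    unfolding rdist_raffine_map by (rule L2_set_le_sum_abs)
  also have "\<dots> \<le> ?D"
  proof (rule sum_mono)
    fix i
    have "\<bar>(x j - y j) * G j i\<bar> \<le> \<bar>G j i\<bar>" if "j < n" for j
    proof -
      have "x j \<in> {0..<1}" "y j \<in> {0..<1}" using xy that by (auto simp: PiE_def Pi_def)
      then have "\<bar>x j - y j\<bar> \<le> 1" by (auto simp: abs_le_iff)
      then show ?thesis by (simp add: abs_mult mult_left_le_one_le)
    qed
    then show "\<bar>\<Sum>j<n. (x j - y j) * G j i\<bar> \<le> (\<Sum>j<n. \<bar>G j i\<bar>)"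
      by (intro order_trans[OF sum_abs] sum_mono) auto
  qed
  finally show "rdist d (raffine_map d n b G x) (raffine_map d n b G y) \<le> ?D" .
qed

lemma raffine_map_image_sets:
  "B \<in> sets (rlebesgue n) \<Longrightarrow> raffine_map d n b G ` B \<in> sets (rlebesgue d)"
  using raffine_map_image_measurable(2)[OF measurable_raffine_coords raffine_coords_map[OF dual]] .

text \<open>The cube is covered by its own grid of small cubes, so the content of its image has a
  bound uniform in \<open>\<delta>\<close>. Uniqueness of the invariant measure asks for this
  finiteness, and it later permits a subtraction.\<close>

lemma emeasure_hausdorff_rcube_image_finite:
  "emeasure (hausdorff_measure d n) (raffine_map d n b G ` rcube n) < \<infinity>"
proof (cases rule: emeasure_hausdorff_measure_cases[of d n])
  case null
  then show ?thesis by simp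
next
  case outer
  obtain D where D: "0 \<le> D"
    "\<And>x y. x \<in> rcube n \<Longrightarrow> y \<in> rcube n \<Longrightarrow> rdist d (raffine_map d n b G x) (raffine_map d n b G y) \<le> D"
    using rcube_image_diam by metis
  let ?K = "ennreal (unit_ball_vol (real n) * (D / 2) ^ n)"
  have "hausdorff_content d n \<delta> (raffine_map d n b G ` rcube n) \<le> ?K" if "0 < \<delta>" for \<delta>
  proof -
    obtain m where m: "D / \<delta> < real (Suc m)" using reals_Archimedean2[of "D / \<delta>"] less_Suc_eq by (metis less_trans lessI of_nat_less_iff)
    then have "D / real (Suc m) \<le> \<delta>" using that by (simp add: field_simps)
    from hausdorff_content_grid_cells[OF zero_less_Suc D(2) D(1) this, where A = "{}"]
    have "hausdorff_content d n \<delta> (raffine_map d n b G ` (\<Union>k\<in>{..<n} \<rightarrow>\<^sub>E {..<Suc m}. grid_cell n (Suc m) (rcube n) k)) \<le> ?K"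
      using that by simp
    then show ?thesis
      using hausdorff_content_mono[OF image_mono[OF grid_cells_rcube[of "Suc m" n]]] order_trans by blast
  qed
  then have "hausdorff_outer d n (raffine_map d n b G ` rcube n) \<le> ?K"
    unfolding hausdorff_outer_eq by (intro SUP_least) auto
  also have "\<dots> < \<infinity>" by simp
  finally show ?thesis using outer raffine_map_image_sets by simp
qed

text \<open>
  Fill the unit cube with \<open>N\<^sup>n\<close> copies of \<open>C\<close> at scale \<open>1 / N\<close>.  With \<open>k\<close> the measure of the
  image of the cube, the rest costs at most its own measure \<open>k (1 - vol C)\<close>, so letting \<open>N\<close> grow gives
  \<open>k \<le> \<omega>\<^sub>n (D / 2)\<^sup>n + k (1 - vol C)\<close>; no Vitali covering is needed.
\<close>

lemma hausdorff_constant_le: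
  assumes C: "C \<in> sets (rlebesgue n)" "C \<subseteq> rcube n"
    and D: "\<And>x y. x \<in> C \<Longrightarrow> y \<in> C \<Longrightarrow> rdist d (raffine_map d n b G x) (raffine_map d n b G y) \<le> D" "0 \<le> D"
  shows "emeasure (hausdorff_measure d n) (raffine_map d n b G ` rcube n) * emeasure (rlebesgue n) C
    \<le> ennreal (unit_ball_vol (real n) * (D / 2) ^ n)"
proof (cases rule: emeasure_hausdorff_measure_cases[of d n])
  case null
  then show ?thesis by simp
next
  case outer
  let ?\<Phi> = "raffine_map d n b G" and ?w = "unit_ball_vol (real n) * (D / 2) ^ n"
  let ?M = "hausdorff_measure d n"
  obtain k where k: "emeasure ?M (?\<Phi> ` rcube n) = ennreal k" "0 \<le> k"
    using emeasure_hausdorff_rcube_image_finite by (metis ennreal_cases infinity_ennreal_def less_irrefl)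
  have "emeasure (rlebesgue n) C \<le> 1" using emeasure_mono[OF C(2), of "rlebesgue n"] by simp
  then obtain l where l: "emeasure (rlebesgue n) C = ennreal l" "0 \<le> l" "l \<le> 1"
    by (cases "emeasure (rlebesgue n) C") (auto simp: top_unique)
  have "hausdorff_content d n \<delta> (?\<Phi> ` rcube n) \<le> ennreal (?w + k * (1 - l))" if "0 < \<delta>" for \<delta>
  proof -
    obtain m where m: "D / \<delta> < real (Suc m)" using reals_Archimedean2[of "D / \<delta>"] less_Suc_eq by (metis less_trans lessI of_nat_less_iff)
    then have Dm: "D / real (Suc m) \<le> \<delta>" using that by (simp add: field_simps)
    define U where "U = (\<Union>k\<in>{..<n} \<rightarrow>\<^sub>E {..<Suc m}. grid_cell n (Suc m) C k)"
    have "finite ({..<n} \<rightarrow>\<^sub>E {..<Suc m})" by (rule finite_PiE) auto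
    then have U: "U \<in> sets (rlebesgue n)" unfolding U_def
      using grid_cell_measurable[OF C(1)] by (intro sets.finite_UN) auto
    have UQ: "U \<subseteq> rcube n" unfolding U_def by (rule grid_cells_subset[OF C(2)]) simp
    have "emeasure (rlebesgue n) (rcube n - U) = emeasure (rlebesgue n) (rcube n) - emeasure (rlebesgue n) U"
      using emeasure_grid_cells[OF C, of "Suc m"] U UQ l by (intro emeasure_Diff) (auto simp: U_def)
    also have "\<dots> = ennreal (1 - l)"
      using emeasure_grid_cells[OF C, of "Suc m"] l by (simp add: U_def ennreal_minus ennreal_1[symmetric] del: ennreal_1)
    finally have rest: "emeasure ?M (?\<Phi> ` (rcube n - U)) = ennreal (k * (1 - l))"
      using emeasure_raffine_image[OF translation_invariant_hausdorff_measure measurable_raffine_coords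
          raffine_coords_map[OF dual] emeasure_hausdorff_rcube_image_finite, of "rcube n - U"] U k l
      by (simp add: ennreal_mult)
    have "?\<Phi> ` rcube n = ?\<Phi> ` U \<union> ?\<Phi> ` (rcube n - U)" using UQ by auto
    then have "hausdorff_content d n \<delta> (?\<Phi> ` rcube n) \<le> ennreal ?w + hausdorff_content d n \<delta> (?\<Phi> ` (rcube n - U))"
      using hausdorff_content_grid_cells[OF zero_less_Suc D Dm, where A = "?\<Phi> ` (rcube n - U)"] by (simp add: U_def)
    \<comment> \<open>The remainder has no good cover at hand. Its measure is known from the
      multiple \<open>k\<close> of Lebesgue measure, and in the present case that measure is the
      outer measure, which dominates the content.\<close>
    also have "hausdorff_content d n \<delta> (?\<Phi> ` (rcube n - U)) \<le> ennreal (k * (1 - l))"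
      using hausdorff_content_le_outer[OF that, of d n "?\<Phi> ` (rcube n - U)"] outer[of "?\<Phi> ` (rcube n - U)"]
        raffine_map_image_sets[of "rcube n - U"] U rest by simp
    finally show ?thesis using D(2) k l by (simp add: add_left_mono ennreal_plus)
  qed
  then have "hausdorff_outer d n (?\<Phi> ` rcube n) \<le> ennreal (?w + k * (1 - l))"
    unfolding hausdorff_outer_eq by (intro SUP_least) auto
  then have "ennreal k \<le> ennreal (?w + k * (1 - l))"
    using outer raffine_map_image_sets k by simp
  then have "k \<le> ?w + k * (1 - l)" using D(2) k l by (subst (asm) ennreal_le_iff) auto
  \<comment> \<open>The common term \<open>k\<close> cancels because it is a finite real
    number.\<close>
  then have "k * l \<le> ?w" by (simp add: algebra_simps)
  then show ?thesis using k l by (simp add: ennreal_mult[symmetric] ennreal_leI)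
qed

text \<open>An ellipsoid: the coordinates of the vectors of length at most 1 in the span of the
  \<open>G j\<close>. The base point \<open>b\<close> is left out, which centres it at the
  origin.\<close>

definition unit_ball_pullback :: "(nat \<Rightarrow> real) set" where
  "unit_ball_pullback = {y\<in>rspace n. L2_set (\<lambda>i. \<Sum>j<n. y j * G j i) {..<d} \<le> 1}"

lemma unit_ball_pullback_measurable: "unit_ball_pullback \<in> sets (rlebesgue n)"
proof -
  have "(\<lambda>y. L2_set (\<lambda>i. \<Sum>j<n. y j * G j i) {..<d}) \<in> borel_measurable (rlebesgue n)"
  proof -
    have "(\<lambda>y. \<Sum>j<n. y j * G j i) \<in> borel_measurable (rlebesgue n)" for i
      by (rule borel_measurable_sum) auto
    then have "(\<lambda>y. \<Sum>i<d. (\<Sum>j<n. y j * G j i)\<^sup>2) \<in> borel_measurable (rlebesgue n)"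
      by (rule borel_measurable_sum[OF borel_measurable_power])
    then show ?thesis unfolding L2_set_def by measurable
  qed
  then have "{y\<in>space (rlebesgue n). L2_set (\<lambda>i. \<Sum>j<n. y j * G j i) {..<d} \<le> 1} \<in> sets (rlebesgue n)" by measurable
  then show ?thesis by (simp add: unit_ball_pullback_def)
qed

text \<open>By duality \<open>y j\<close> is the inner product of \<open>R j\<close> with a vector
  of length at most 1. The bound 1/4 leaves room to centre the scaled ellipsoid in the half-open
  unit cube.\<close>

lemma unit_ball_pullback_bounded:
  obtains s where "0 < s" "\<And>y j. y \<in> unit_ball_pullback \<Longrightarrow> j < n \<Longrightarrow> \<bar>s * y j\<bar> \<le> 1 / 4"
proof -
  define B where "B = 1 + (\<Sum>j<n. \<Sum>i<d. \<bar>R j i\<bar>)"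
  have B: "0 < B" unfolding B_def by (intro add_pos_nonneg sum_nonneg) auto
  have "\<bar>y j\<bar> \<le> B" if y: "y \<in> unit_ball_pullback" and j: "j < n" for y j
  proof -
    have "\<bar>\<Sum>l<n. y l * G l i\<bar> \<le> 1" if "i < d" for i
    proof -
      have "\<bar>\<Sum>l<n. y l * G l i\<bar> \<le> L2_set (\<lambda>i. \<bar>\<Sum>l<n. y l * G l i\<bar>) {..<d}"
        using that by (intro member_le_L2_set) auto
      also have "\<dots> \<le> 1" using y by (simp add: unit_ball_pullback_def L2_set_def)
      finally show ?thesis .
    qed
    then have "\<bar>\<Sum>i<d. R j i * (\<Sum>l<n. y l * G l i)\<bar> \<le> (\<Sum>i<d. \<bar>R j i\<bar>)"
      by (intro order_trans[OF sum_abs] sum_mono) (auto simp: abs_mult mult_left_le)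
    then have "\<bar>y j\<bar> \<le> (\<Sum>i<d. \<bar>R j i\<bar>)" by (simp add: dual_family_coeff[OF dual j])
    also have "\<dots> \<le> (\<Sum>j<n. \<Sum>i<d. \<bar>R j i\<bar>)"
      using j by (intro member_le_sum[of j "{..<n}" "\<lambda>j. \<Sum>i<d. \<bar>R j i\<bar>"]) (auto intro: sum_nonneg)
    finally show ?thesis by (simp add: B_def)
  qed
  then show thesis using B by (intro that[of "1 / (4 * B)"]) (auto simp: field_simps abs_mult)
qed

lemma rdist_unit_ball_pullback:
  assumes "x \<in> unit_ball_pullback" "y \<in> unit_ball_pullback"
  shows "rdist d (raffine_map d n b G x) (raffine_map d n b G y) \<le> 2"
proof -
  let ?X = "\<lambda>i. \<Sum>j<n. x j * G j i" and ?Y = "\<lambda>i. \<Sum>j<n. y j * G j i"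
  have "rdist d (raffine_map d n b G x) (raffine_map d n b G y) = L2_set (\<lambda>i. ?X i + - ?Y i) {..<d}"
    unfolding rdist_raffine_map by (rule L2_set_cong) (simp_all add: sum_subtractf left_diff_distrib)
  also have "\<dots> \<le> L2_set ?X {..<d} + L2_set (\<lambda>i. - ?Y i) {..<d}"
    by (rule L2_set_triangle_ineq[of ?X "\<lambda>i. - ?Y i"])
  also have "L2_set (\<lambda>i. - ?Y i) {..<d} = L2_set ?Y {..<d}"
    unfolding L2_set_def by (simp only: power2_minus)
  finally show ?thesis using assms by (simp add: unit_ball_pullback_def)
qed

text \<open>The packing bound is applied to the ellipsoid shrunk by \<open>s\<close> and centred in
  the unit cube. Its image has diameter at most \<open>2 s\<close>, so the bound is
  \<open>omega_n s ^ n\<close>, and \<open>s ^ n\<close> cancels against the scaling of Lebesgue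
  measure.\<close>

lemma hausdorff_constant_unit_ball:
  "emeasure (hausdorff_measure d n) (raffine_map d n b G ` rcube n) * emeasure (rlebesgue n) unit_ball_pullback
    \<le> ennreal (unit_ball_vol (real n))"
proof -
  let ?M = "emeasure (hausdorff_measure d n) (raffine_map d n b G ` rcube n)"
  obtain s where s: "0 < s" "\<And>y j. y \<in> unit_ball_pullback \<Longrightarrow> j < n \<Longrightarrow> \<bar>s * y j\<bar> \<le> 1 / 4"
    using unit_ball_pullback_bounded by blast
  let ?f = "\<lambda>x. \<lambda>i\<in>{..<n}. - 1 / (2 * s) + (1 / s) * x i"
  define C where "C = ?f -` unit_ball_pullback \<inter> rspace n"
  have "?f \<in> measurable (rlebesgue n) (rlebesgue n)" by measurable
  from measurable_sets[OF this unit_ball_pullback_measurable] have C: "C \<in> sets (rlebesgue n)"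
    unfolding C_def by simp
  have CQ: "C \<subseteq> rcube n"
  proof
    fix x assume x: "x \<in> C"
    have "0 \<le> x i \<and> x i < 1" if "i < n" for i
    proof -
      have "?f x \<in> unit_ball_pullback" using x unfolding C_def by blast
      from s(2)[OF this that] have "\<bar>s * ?f x i\<bar> \<le> 1 / 4" .
      moreover have "s * ?f x i = x i - 1 / 2" using that s(1) by (simp add: field_simps)
      ultimately have "\<bar>x i - 1 / 2\<bar> \<le> 1 / 4" by metis
      then show ?thesis unfolding abs_le_iff by linarith
    qed
    then show "x \<in> rcube n" using x by (auto simp: C_def rspace_def PiE_def)
  qed
  have D: "rdist d (raffine_map d n b G x) (raffine_map d n b G y) \<le> 2 * s" if "x \<in> C" "y \<in> C" for x y
  proof -
    have "?f x \<in> unit_ball_pullback" "?f y \<in> unit_ball_pullback" using that unfolding C_def by blast+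
    from rdist_unit_ball_pullback[OF this]
    have "s * rdist d (raffine_map d n b G (?f x)) (raffine_map d n b G (?f y)) \<le> s * 2"
      by (rule mult_left_mono) (use s(1) in simp)
    moreover have "rdist d (raffine_map d n b G x) (raffine_map d n b G y) =
        s * rdist d (raffine_map d n b G (?f x)) (raffine_map d n b G (?f y))"
      by (rule rdist_raffine_map_scale) (use s(1) in \<open>auto simp: field_simps\<close>)
    ultimately show ?thesis by linarith
  qed
  have "?M * emeasure (rlebesgue n) unit_ball_pullback = ?M * (ennreal ((1 / s) ^ n) * emeasure (rlebesgue n) C)"
    unfolding C_def
    using emeasure_rlebesgue_affine[of "1 / s" unit_ball_pullback n "\<lambda>_. - 1 / (2 * s)"] unit_ball_pullback_measurable s(1)
    by simp
  also have "\<dots> = ennreal ((1 / s) ^ n) * (?M * emeasure (rlebesgue n) C)" by (simp only: mult.left_commute)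
  also have "\<dots> \<le> ennreal ((1 / s) ^ n) * ennreal (unit_ball_vol (real n) * (2 * s / 2) ^ n)"
    using s(1) by (intro mult_left_mono hausdorff_constant_le C CQ D) auto
  also have "\<dots> = ennreal (unit_ball_vol (real n))"
    using s(1) by (simp add: ennreal_mult[symmetric] power_divide)
  finally show ?thesis .
qed

end

section \<open>Trace inequality on one facet\<close>

lemma dual_family_mono: "dual_family d n G R \<Longrightarrow> m \<le> n \<Longrightarrow> dual_family d m G R"
  unfolding dual_family_def by auto

context
  fixes n :: nat and b :: "nat \<Rightarrow> real" and G R :: "nat \<Rightarrow> nat \<Rightarrow> real"
  assumes dual: "dual_family (Suc n) (Suc n) G R"
    and surj: "\<And>z. z \<in> rspace (Suc n) \<Longrightarrow>
      raffine_map (Suc n) (Suc n) b G (raffine_coords (Suc n) (Suc n) b R z) = z"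
begin

lemma emeasure_rlebesgue_rcube_image_finite:
  "emeasure (rlebesgue (Suc n)) (raffine_map (Suc n) (Suc n) b G ` rcube (Suc n)) < \<infinity>"
proof -
  let ?B = "\<lambda>i. \<bar>b i\<bar> + (\<Sum>j<Suc n. \<bar>G j i\<bar>)"
  let ?Q = "\<Pi>\<^sub>E i\<in>{..<Suc n}. {- ?B i .. ?B i}"
  have "raffine_map (Suc n) (Suc n) b G ` rcube (Suc n) \<subseteq> ?Q"
  proof (rule image_subsetI)
    fix x assume x: "x \<in> rcube (Suc n)"
    have "b i + (\<Sum>j<Suc n. x j * G j i) \<in> {- ?B i .. ?B i}" for i
    proof -
      have "\<bar>\<Sum>j<Suc n. x j * G j i\<bar> \<le> (\<Sum>j<Suc n. \<bar>G j i\<bar>)"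
      proof (rule order_trans[OF sum_abs sum_mono])
        fix j assume "j \<in> {..<Suc n}"
        then have "x j \<in> {0..<1}" using x by (auto simp: PiE_def Pi_def)
        then show "\<bar>x j * G j i\<bar> \<le> \<bar>G j i\<bar>" by (auto simp: abs_mult mult_left_le_one_le)
      qed
      then show ?thesis unfolding atLeastAtMost_iff by linarith
    qed
    then show "raffine_map (Suc n) (Suc n) b G x \<in> ?Q"
      unfolding raffine_map_def restrict_PiE_iff by blast
  qed
  then have "emeasure (rlebesgue (Suc n)) (raffine_map (Suc n) (Suc n) b G ` rcube (Suc n)) \<le> emeasure (rlebesgue (Suc n)) ?Q"
    by (rule emeasure_mono) auto
  also have "\<dots> = (\<Prod>i<Suc n. emeasure lborel {- ?B i .. ?B i})"
    by (rule emeasure_rlebesgue_PiE) auto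
  also have "\<dots> = (\<Prod>i<Suc n. ennreal (2 * ?B i))"
  proof (rule prod.cong[OF refl])
    fix i
    have "0 \<le> ?B i" by (intro add_nonneg_nonneg sum_nonneg) auto
    then show "emeasure lborel {- ?B i .. ?B i} = ennreal (2 * ?B i)"
      by (subst emeasure_lborel_Icc) (simp_all del: sum.lessThan_Suc)
  qed
  also have "\<dots> = ennreal (\<Prod>i<Suc n. 2 * ?B i)"
    by (rule prod_ennreal) (intro mult_nonneg_nonneg add_nonneg_nonneg sum_nonneg; simp)
  also have "\<dots> < \<infinity>" by simp
  finally show ?thesis .
qed

text \<open>By duality \<open>R n\<close> is normal to the edges \<open>G j\<close> with
  \<open>j < n\<close> and has inner product 1 with \<open>G n\<close>, so \<open>R n\<close>
  divided by its squared length is the normal part of \<open>G n\<close>. The rest has last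
  coordinate 0, hence lies in the span of the facet edges; \<open>m\<close> holds its
  coordinates.\<close>

lemma dual_orthogonal_decomposition:
  obtains m where "\<And>i. i < Suc n \<Longrightarrow>
    (\<Sum>j<n. m j * G j i) = G n i - R n i / (\<Sum>i<Suc n. (R n i)\<^sup>2)"
proof -
  let ?u2 = "\<Sum>i<Suc n. (R n i)\<^sup>2"
  have RG: "(\<Sum>i<Suc n. R n i * G n i) = 1" using dual by (auto simp: dual_family_def)
  have u2: "?u2 \<noteq> 0"
  proof
    assume "?u2 = 0"
    then have "\<forall>i\<in>{..<Suc n}. (R n i)\<^sup>2 = 0" by (subst (asm) sum_nonneg_eq_0_iff) auto
    then have "(\<Sum>i<Suc n. R n i * G n i) = 0" by (intro sum.neutral) auto
    then show False using RG by simp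
  qed
  define z where "z = (\<lambda>i\<in>{..<Suc n}. b i + G n i - R n i / ?u2)"
  define m where "m = raffine_coords (Suc n) (Suc n) b R z"
  have z: "z \<in> rspace (Suc n)" by (simp add: z_def rspace_def)
  have "m n = (\<Sum>i<Suc n. R n i * (G n i - R n i / ?u2))"
    unfolding m_def raffine_coords_def z_def by (auto intro!: sum.cong simp del: sum.lessThan_Suc)
  also have "\<dots> = (\<Sum>i<Suc n. R n i * G n i) - ?u2 / ?u2"
    by (simp only: right_diff_distrib sum_subtractf sum_divide_distrib power2_eq_square times_divide_eq_right)
  finally have mn: "m n = 0" using RG u2 by simp
  show thesis
  proof (rule that[of m])
    fix i assume i: "i < Suc n"
    have "raffine_map (Suc n) (Suc n) b G m i = z i" using surj[OF z] by (simp add: m_def)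
    then have "b i + (\<Sum>j<Suc n. m j * G j i) = z i" using i unfolding raffine_map_def by simp
    then show "(\<Sum>j<n. m j * G j i) = G n i - R n i / ?u2" using mn i by (simp add: z_def)
  qed
qed

text \<open>Let \<open>X\<close> be a vector of length at most 1 with coordinates \<open>x\<close>.
  Its last coordinate is the inner product with \<open>R n\<close>, so Cauchy-Schwarz bounds it by
  the length of \<open>R n\<close>. Its orthogonal projection along \<open>R n\<close> is no longer
  than \<open>X\<close> and has facet coordinates \<open>x j + x n m j\<close>, which is the
  shear.\<close>

lemma unit_ball_pullback_slab:
  "emeasure (rlebesgue (Suc n)) (unit_ball_pullback (Suc n) (Suc n) G) \<le>
     ennreal (2 * L2_set (R n) {..<Suc n}) * emeasure (rlebesgue n) (unit_ball_pullback (Suc n) n G)"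
proof -
  let ?u2 = "\<Sum>i<Suc n. (R n i)\<^sup>2"
  obtain m where m: "\<And>i. i < Suc n \<Longrightarrow> (\<Sum>j<n. m j * G j i) = G n i - R n i / ?u2"
    using dual_orthogonal_decomposition by blast
  show ?thesis
  proof (rule emeasure_sheared_slab_le)
    show "unit_ball_pullback (Suc n) (Suc n) G \<in> sets (rlebesgue (Suc n))"
      by (rule unit_ball_pullback_measurable[OF dual])
    show "unit_ball_pullback (Suc n) n G \<in> sets (rlebesgue n)"
      by (rule unit_ball_pullback_measurable[OF dual_family_mono[OF dual]]) simp
    show "0 \<le> L2_set (R n) {..<Suc n}" by simp
    fix x assume x: "x \<in> unit_ball_pullback (Suc n) (Suc n) G"
    define X where "X i = (\<Sum>j<Suc n. x j * G j i)" for i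
    have X1: "L2_set X {..<Suc n} \<le> 1"
      using x unfolding unit_ball_pullback_def[OF dual] X_def[abs_def] by simp
    have xn: "(\<Sum>i<Suc n. R n i * X i) = x n"
      unfolding X_def by (rule dual_family_coeff[OF dual]) simp
    have "\<bar>x n\<bar> \<le> (\<Sum>i<Suc n. \<bar>R n i\<bar> * \<bar>X i\<bar>)"
      unfolding xn[symmetric] by (rule order_trans[OF sum_abs]) (simp only: abs_mult order_refl)
    also have "\<dots> \<le> L2_set (R n) {..<Suc n} * L2_set X {..<Suc n}" by (rule L2_set_mult_ineq)
    also have "\<dots> \<le> L2_set (R n) {..<Suc n}" using X1 by (intro mult_left_le) auto
    finally have 1: "\<bar>x n\<bar> \<le> L2_set (R n) {..<Suc n}" .
    let ?y = "\<lambda>j\<in>{..<n}. x n * m j + x j"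
    have w: "(\<Sum>j<n. ?y j * G j i) = X i - x n / ?u2 * R n i" if "i < Suc n" for i
    proof -
      have "(\<Sum>j<n. ?y j * G j i) = (\<Sum>j<n. x n * (m j * G j i) + x j * G j i)"
        by (rule sum.cong) (auto simp: algebra_simps)
      also have "\<dots> = x n * (\<Sum>j<n. m j * G j i) + (\<Sum>j<n. x j * G j i)"
        by (simp add: sum.distrib sum_distrib_left)
      also have "\<dots> = x n * (G n i - R n i / ?u2) + (\<Sum>j<n. x j * G j i)"
        using m[OF that] by simp
      finally show ?thesis by (simp add: X_def algebra_simps)
    qed
    let ?t = "x n / ?u2"
    have "(\<Sum>i<Suc n. (\<Sum>j<n. ?y j * G j i)\<^sup>2) = (\<Sum>i<Suc n. (X i - ?t * R n i)\<^sup>2)"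
      using w by (intro sum.cong) auto
    also have "\<dots> = (\<Sum>i<Suc n. (X i)\<^sup>2 - 2 * ?t * (R n i * X i) + ?t\<^sup>2 * (R n i)\<^sup>2)"
      by (rule sum.cong) (auto simp: power2_eq_square algebra_simps)
    also have "\<dots> = (\<Sum>i<Suc n. (X i)\<^sup>2) - 2 * ?t * (\<Sum>i<Suc n. R n i * X i) + ?t\<^sup>2 * ?u2"
      by (simp only: sum.distrib sum_subtractf sum_distrib_left)
    \<comment> \<open>Pythagoras: for \<open>?t = x n / ?u2\<close> the cross term is twice the
      quadratic term, so exactly one copy is subtracted.\<close>
    also have "\<dots> = (\<Sum>i<Suc n. (X i)\<^sup>2) - (x n)\<^sup>2 / ?u2"
      unfolding xn by (cases "?u2 = 0") (simp_all add: power2_eq_square field_simps del: sum.lessThan_Suc)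
    also have "\<dots> \<le> (\<Sum>i<Suc n. (X i)\<^sup>2)"
      using divide_nonneg_nonneg[OF zero_le_power2[of "x n"] sum_nonneg[of "{..<Suc n}" "\<lambda>i. (R n i)\<^sup>2"]]
      by (simp del: sum.lessThan_Suc)
    finally have "L2_set (\<lambda>i. \<Sum>j<n. ?y j * G j i) {..<Suc n} \<le> L2_set X {..<Suc n}"
      unfolding L2_set_def by (rule real_sqrt_le_mono)
    then have "?y \<in> unit_ball_pullback (Suc n) n G"
      using X1 unfolding unit_ball_pullback_def[OF dual_family_mono[OF dual le_SucI[OF order_refl]]]
      by (auto simp: rspace_def)
    then show "\<bar>x n\<bar> \<le> L2_set (R n) {..<Suc n} \<and> ?y \<in> unit_ball_pullback (Suc n) n G" using 1 by blast
  qed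
qed

lemma raffine_map_unit_ball_pullback:
  "raffine_map (Suc n) (Suc n) b G ` unit_ball_pullback (Suc n) (Suc n) G =
   (\<lambda>z. \<lambda>i\<in>{..<Suc n}. - b i + 1 * z i) -`
     ({f. sqrt (\<Sum>i<Suc n. (f i)\<^sup>2) \<le> 1} \<inter> rspace (Suc n)) \<inter> rspace (Suc n)" (is "?A ` ?D = ?R")
proof -
  have e: "(?A x \<in> ?R) = (L2_set (\<lambda>i. \<Sum>j<Suc n. x j * G j i) {..<Suc n} \<le> 1)" for x
  proof -
    have "(\<Sum>i<Suc n. ((\<lambda>i\<in>{..<Suc n}. - b i + 1 * ?A x i) i)\<^sup>2) = (\<Sum>i<Suc n. (\<Sum>j<Suc n. x j * G j i)\<^sup>2)"
      by (rule sum.cong) (auto simp: raffine_map_def simp del: sum.lessThan_Suc)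
    moreover have "(\<lambda>i\<in>{..<Suc n}. - b i + 1 * ?A x i) \<in> rspace (Suc n)" by (simp add: rspace_def)
    ultimately show ?thesis unfolding L2_set_def
      by (simp del: sum.lessThan_Suc)
  qed
  show ?thesis
  proof (intro set_eqI iffI)
    fix z assume "z \<in> ?A ` ?D"
    then show "z \<in> ?R" using e unfolding unit_ball_pullback_def[OF dual] by blast
  next
    fix z assume z: "z \<in> ?R"
    define x where "x = raffine_coords (Suc n) (Suc n) b R z"
    have "x \<in> rspace (Suc n)" by (simp add: x_def raffine_coords_def rspace_def)
    moreover have zx: "z = ?A x" using surj z unfolding x_def by auto
    ultimately have "x \<in> ?D" using z e[of x] unfolding unit_ball_pullback_def[OF dual] by blast
    then show "z \<in> ?A ` ?D" using zx by blast
  qed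
qed

text \<open>The image of the full-dimensional ellipsoid is the unit ball centred at
  \<open>b\<close>, so its volume is known; the slab bound replaces the ellipsoid by the one of the
  facet.\<close>

lemma unit_ball_vol_le_slab:
  "ennreal (unit_ball_vol (real (Suc n))) \<le>
     emeasure (rlebesgue (Suc n)) (raffine_map (Suc n) (Suc n) b G ` rcube (Suc n)) *
     (ennreal (2 * L2_set (R n) {..<Suc n}) * emeasure (rlebesgue n) (unit_ball_pullback (Suc n) n G))"
proof -
  let ?A = "raffine_map (Suc n) (Suc n) b G" and ?L = "rlebesgue (Suc n)"
  let ?B = "{f. sqrt (\<Sum>i<Suc n. (f i)\<^sup>2) \<le> 1} \<inter> rspace (Suc n)"
  note D = unit_ball_pullback_measurable[OF dual]
  have "(\<lambda>f. sqrt (\<Sum>i<Suc n. (f i)\<^sup>2)) \<in> borel_measurable ?L"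
    by (intro measurable_compose[OF _ borel_measurable_sqrt] borel_measurable_sum borel_measurable_power) auto
  then have "{f\<in>space ?L. sqrt (\<Sum>i<Suc n. (f i)\<^sup>2) \<le> 1} \<in> sets ?L" by measurable
  moreover have "{f\<in>space ?L. sqrt (\<Sum>i<Suc n. (f i)\<^sup>2) \<le> 1} = ?B" by auto
  ultimately have B: "?B \<in> sets ?L" by simp
  have "ennreal (unit_ball_vol (real (Suc n))) = emeasure ?L ?B"
    using emeasure_cball_aux[of "{..<Suc n}" 1] space_rlebesgue[of "Suc n"]
    unfolding rlebesgue_def by (simp del: sum.lessThan_Suc)
  also have "\<dots> = emeasure ?L (?A ` unit_ball_pullback (Suc n) (Suc n) G)"
    unfolding raffine_map_unit_ball_pullback using emeasure_rlebesgue_affine[OF _ B, of 1 "\<lambda>i. - b i"] by simp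
  also have "\<dots> = emeasure ?L (?A ` rcube (Suc n)) * emeasure ?L (unit_ball_pullback (Suc n) (Suc n) G)"
    by (rule emeasure_raffine_image[OF translation_invariant_rlebesgue measurable_raffine_coords
      raffine_coords_map[OF dual] emeasure_rlebesgue_rcube_image_finite D])
  also have "\<dots> \<le> emeasure ?L (?A ` rcube (Suc n)) *
     (ennreal (2 * L2_set (R n) {..<Suc n}) * emeasure (rlebesgue n) (unit_ball_pullback (Suc n) n G))"
    by (intro mult_left_mono unit_ball_pullback_slab) simp
  finally show ?thesis .
qed

text \<open>With \<open>K\<close>, \<open>c\<close>, \<open>E\<close>, \<open>u\<close> as
  abbreviated in the proof, \<open>K E \<le> omega_n\<close> and
  \<open>omega_(n+1) \<le> 2 u c E\<close>. Multiplying the second by \<open>K\<close> eliminates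
  the ellipsoid, and comparing the ball volumes removes \<open>omega_(n+1)\<close>. Geometrically
  \<open>1 / u\<close> is the height of the parallelepiped over its base, so the exact relation
  would be \<open>K = u c\<close>; the factor \<open>2 (n + 1)\<close> is the price of the
  comparison.\<close>

lemma hausdorff_facet_constant:
  "emeasure (hausdorff_measure (Suc n) n) (raffine_map (Suc n) n b G ` rcube n) \<le>
     ennreal (2 * real (Suc n) * L2_set (R n) {..<Suc n}) *
     emeasure (rlebesgue (Suc n)) (raffine_map (Suc n) (Suc n) b G ` rcube (Suc n))"
proof -
  let ?K = "emeasure (hausdorff_measure (Suc n) n) (raffine_map (Suc n) n b G ` rcube n)"
  let ?c = "emeasure (rlebesgue (Suc n)) (raffine_map (Suc n) (Suc n) b G ` rcube (Suc n))"
  let ?E = "emeasure (rlebesgue n) (unit_ball_pullback (Suc n) n G)"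
  let ?u = "L2_set (R n) {..<Suc n}" and ?w = "unit_ball_vol (real (Suc n))"
  have "ennreal ?w * ?K \<le> (?c * (ennreal (2 * ?u) * ?E)) * ?K"
    by (rule mult_right_mono[OF unit_ball_vol_le_slab]) simp
  also have "\<dots> = ?c * ennreal (2 * ?u) * (?K * ?E)" by (simp only: mult_ac)
  also have "\<dots> \<le> ?c * ennreal (2 * ?u) * ennreal (unit_ball_vol (real n))"
    by (intro mult_left_mono hausdorff_constant_unit_ball[OF dual_family_mono[OF dual le_SucI[OF order_refl]]]) auto
  also have "\<dots> \<le> ?c * ennreal (2 * ?u) * ennreal (real (Suc n) * ?w)"
    by (intro mult_left_mono ennreal_leI unit_ball_vol_Suc_ge) auto
  also have "\<dots> = ennreal ?w * (ennreal (2 * real (Suc n) * ?u) * ?c)"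
  proof -
    have "ennreal (2 * real (Suc n) * ?u) = ennreal (2 * ?u) * ennreal (real (Suc n))"
      by (subst ennreal_mult[symmetric]) (simp_all add: mult_ac)
    moreover have "ennreal (real (Suc n) * ?w) = ennreal (real (Suc n)) * ennreal ?w"
      by (rule ennreal_mult) simp_all
    ultimately show ?thesis by (simp only: mult_ac)
  qed
  finally have "ennreal ?w * ?K \<le> ennreal ?w * (ennreal (2 * real (Suc n) * ?u) * ?c)" .
  then show ?thesis
    by (subst (asm) ennreal_mult_le_mult_iff) (simp_all del: of_nat_Suc add: less_imp_neq unit_ball_vol_pos[THEN less_imp_neq] ennreal_eq_0_iff not_le)
qed

text \<open>Both integrals are pulled back by charts with the same \<open>b\<close> and
  \<open>G\<close>, under which the affine function keeps the same coefficients. The constant is the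
  product of \<open>2 (n + 1) u\<close> for the measures and \<open>2 (n + 2)\<close> for the
  cone.\<close>

lemma facet_trace_inequality:
  fixes p :: "nat \<Rightarrow> real" and q :: real
  defines "w \<equiv> \<lambda>z. (\<Sum>i<Suc n. p i * z i) + q"
  shows "(\<integral>\<^sup>+z\<in>raffine_map (Suc n) n b G ` closed_ref_simplex n. ennreal ((w z)\<^sup>2) \<partial>hausdorff_measure (Suc n) n)
    \<le> ennreal (4 * real (Suc n) * (real (Suc n) + 1) * L2_set (R n) {..<Suc n}) *
      (\<integral>\<^sup>+z\<in>raffine_map (Suc n) (Suc n) b G ` open_ref_simplex (Suc n). ennreal ((w z)\<^sup>2) \<partial>rlebesgue (Suc n))"
proof -
  let ?H = "hausdorff_measure (Suc n) n" and ?L = "rlebesgue (Suc n)"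
  let ?\<Phi> = "raffine_map (Suc n) n b G" and ?A = "raffine_map (Suc n) (Suc n) b G"
  let ?u = "L2_set (R n) {..<Suc n}"
  define a where "a j = (\<Sum>i<Suc n. p i * G j i)" for j
  define c where "c = (\<Sum>i<Suc n. p i * b i) + q"
  have w: "w (raffine_map (Suc n) k b G x) = (\<Sum>j<k. a j * x j) + c" for k x
  proof -
    have "(\<Sum>i<Suc n. p i * (\<Sum>j<k. x j * G j i)) = (\<Sum>j<k. a j * x j)"
      unfolding a_def by (simp only: sum_distrib_left sum_distrib_right mult_ac) (rule sum.swap)
    moreover have "(\<Sum>i<Suc n. p i * raffine_map (Suc n) k b G x i) =
        (\<Sum>i<Suc n. p i * b i + p i * (\<Sum>j<k. x j * G j i))"
      by (rule sum.cong) (auto simp: raffine_map_def algebra_simps)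
    ultimately show ?thesis unfolding w_def c_def by (simp only: sum.distrib)
  qed
  have wm: "(\<lambda>z. ennreal ((w z)\<^sup>2)) \<in> borel_measurable ?L"
    using affine_measurable[of p "Suc n" q] unfolding w_def by measurable
  note dual' = dual_family_mono[OF dual le_SucI[OF order_refl]]
  have "(\<integral>\<^sup>+z\<in>?\<Phi> ` closed_ref_simplex n. ennreal ((w z)\<^sup>2) \<partial>?H) =
      emeasure ?H (?\<Phi> ` rcube n) * (\<integral>\<^sup>+y\<in>closed_ref_simplex n. ennreal ((w (?\<Phi> y))\<^sup>2) \<partial>rlebesgue n)"
    by (rule nn_integral_raffine_image[OF translation_invariant_hausdorff_measure measurable_raffine_coords
      raffine_coords_map[OF dual'] emeasure_hausdorff_rcube_image_finite[OF dual'] sets_ref_simplex(2) wm])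
  also have "\<dots> \<le> (ennreal (2 * real (Suc n) * ?u) * emeasure ?L (?A ` rcube (Suc n))) *
      (ennreal (2 * (real n + 2)) * (\<integral>\<^sup>+x\<in>open_ref_simplex (Suc n). ennreal ((w (?A x))\<^sup>2) \<partial>?L))"
    unfolding w by (intro mult_mono hausdorff_facet_constant reference_trace_inequality) auto
  also have "\<dots> = (ennreal (2 * real (Suc n) * ?u) * ennreal (2 * (real n + 2))) *
      (emeasure ?L (?A ` rcube (Suc n)) * (\<integral>\<^sup>+x\<in>open_ref_simplex (Suc n). ennreal ((w (?A x))\<^sup>2) \<partial>?L))"
    by (simp only: mult_ac)
  also have "emeasure ?L (?A ` rcube (Suc n)) * (\<integral>\<^sup>+x\<in>open_ref_simplex (Suc n). ennreal ((w (?A x))\<^sup>2) \<partial>?L) =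
      (\<integral>\<^sup>+z\<in>?A ` open_ref_simplex (Suc n). ennreal ((w z)\<^sup>2) \<partial>?L)"
    by (rule nn_integral_raffine_image[OF translation_invariant_rlebesgue measurable_raffine_coords
      raffine_coords_map[OF dual] emeasure_rlebesgue_rcube_image_finite sets_ref_simplex(1) wm, symmetric])
  also have "ennreal (2 * real (Suc n) * ?u) * ennreal (2 * (real n + 2)) =
      ennreal (4 * real (Suc n) * (real (Suc n) + 1) * ?u)"
    by (subst ennreal_mult[symmetric]) (simp_all add: algebra_simps)
  finally show ?thesis .
qed

end

section \<open>Barycentric coordinates\<close>

lemma sum_fun_apply: "(\<Sum>x\<in>A. f x) i = (\<Sum>x\<in>A. f x i)" for f :: "'a \<Rightarrow> 'b \<Rightarrow> real"
  by (induction A rule: infinite_finite_induct) auto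

text \<open>Invertibility of a square matrix by a dimension count: a unit vector outside the span of
  the \<open>N\<close> independent vectors would extend them to \<open>N + 1\<close> independent
  vectors in the span of \<open>N\<close> unit vectors. Vectors are functions on all naturals cut
  off at \<open>N\<close>, so one vector space serves every dimension.\<close>

lemma square_independent_family_spans:
  fixes vec :: "'a \<Rightarrow> nat \<Rightarrow> real"
  assumes V: "finite V" "card V = N"
    and ind: "\<And>c. (\<And>i. i < N \<Longrightarrow> (\<Sum>p\<in>V. c p * vec p i) = 0) \<Longrightarrow> (\<And>p. p \<in> V \<Longrightarrow> c p = 0)"
  obtains S where "\<And>z i. i < N \<Longrightarrow> (\<Sum>p\<in>V. (\<Sum>k<N. S p k * z k) * vec p i) = z i"
proof -
  interpret fv: vector_space "\<lambda>(c::real) (f::nat \<Rightarrow> real) i. c * f i"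
    by standard (auto simp: fun_eq_iff algebra_simps)
  define W where "W p = (\<lambda>i. if i < N then vec p i else 0)" for p
  define e where "e k = (\<lambda>i::nat. if i = k then 1 else 0 :: real)" for k :: nat
  have inj: "inj_on W V"
  proof (rule inj_onI, rule ccontr)
    fix p q assume pq: "p \<in> V" "q \<in> V" "W p = W q" "p \<noteq> q"
    have "(\<Sum>r\<in>V. (if r = p then 1 else if r = q then -1 else 0) * vec r i) = 0" if "i < N" for i
    proof -
      have "(\<Sum>r\<in>V. (if r = p then 1 else if r = q then -1 else 0) * vec r i)
          = (\<Sum>r\<in>{p, q}. (if r = p then 1 else if r = q then -1 else 0) * vec r i)"
        using pq V by (intro sum.mono_neutral_right) auto
      also have "\<dots> = vec p i - vec q i" using pq(4) by simp
      also have "\<dots> = 0" using fun_cong[OF pq(3), of i] that by (simp add: W_def)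
      finally show ?thesis .
    qed
    from ind[OF this pq(1)] show False by simp
  qed
  have indW: "fv.independent (W ` V)"
  proof (rule fv.independent_if_scalars_zero)
    show "finite (W ` V)" using V by simp
    fix f x assume f: "(\<Sum>x\<in>W ` V. (\<lambda>i. f x * x i)) = 0" and x: "x \<in> W ` V"
    then obtain p where p: "p \<in> V" "x = W p" by auto
    have "(\<Sum>p\<in>V. f (W p) * vec p i) = 0" if "i < N" for i
    proof -
      have "(\<Sum>x\<in>W ` V. f x * x i) = 0" using fun_cong[OF f, of i] by (simp add: sum_fun_apply)
      then have "(\<Sum>p\<in>V. f (W p) * W p i) = 0" by (simp add: sum.reindex[OF inj])
      moreover have "W p i = vec p i" for p using that by (simp add: W_def)
      ultimately show ?thesis by simp
    qed
    from ind[of "\<lambda>p. f (W p)", OF this p(1)] show "f x = 0" using p by simp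
  qed
  have sp: "f \<in> fv.span (e ` {..<N})" if "\<And>i. N \<le> i \<Longrightarrow> f i = 0" for f
  proof -
    define g where "g = (\<Sum>k<N. (\<lambda>i. f k * e k i))"
    have "f = g"
    proof
      fix i
      have "g i = (\<Sum>k<N. if k = i then f k else 0)"
        unfolding g_def sum_fun_apply by (rule sum.cong) (auto simp: e_def)
      then show "f i = g i" using that[of i] by simp
    qed
    moreover have "g \<in> fv.span (e ` {..<N})"
      unfolding g_def by (intro fv.span_sum fv.span_scale fv.span_base imageI)
    ultimately show ?thesis by simp
  qed
  have eW: "e k \<in> fv.span (W ` V)" if k: "k < N" for k
  proof (rule ccontr)
    assume n: "e k \<notin> fv.span (W ` V)"
    have "card (insert (e k) (W ` V)) \<le> card (e ` {..<N})"
    proof (rule fv.independent_span_bound[THEN conjunct2])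
      show "fv.independent (insert (e k) (W ` V))" by (rule fv.independent_insertI[OF n indW])
      show "insert (e k) (W ` V) \<subseteq> fv.span (e ` {..<N})"
      proof -
        have "e k \<in> fv.span (e ` {..<N})" by (rule sp) (use k in \<open>simp add: e_def\<close>)
        moreover have "W p \<in> fv.span (e ` {..<N})" for p by (rule sp) (simp add: W_def)
        ultimately show ?thesis by blast
      qed
    qed simp
    also have "\<dots> \<le> N" using card_image_le[of "{..<N}" e] by simp
    finally have "card (insert (e k) (W ` V)) \<le> N" .
    moreover have "e k \<notin> W ` V" using n fv.span_base by blast
    ultimately show False using V card_image[OF inj] by simp
  qed
  have "\<exists>s. \<forall>i<N. (\<Sum>p\<in>V. s p * vec p i) = e k i" if k: "k < N" for k
  proof -
    obtain u where "e k = (\<Sum>v\<in>W ` V. (\<lambda>i. u v * v i))"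
      using eW[OF k] fv.span_finite[of "W ` V"] V by auto
    then have u: "e k i = (\<Sum>p\<in>V. u (W p) * W p i)" for i
      by (simp add: sum_fun_apply sum.reindex[OF inj])
    show ?thesis by (rule exI[of _ "\<lambda>p. u (W p)"]) (simp add: u W_def)
  qed
  then have "\<forall>k. \<exists>s. k < N \<longrightarrow> (\<forall>i<N. (\<Sum>p\<in>V. s p * vec p i) = e k i)" by blast
  then obtain s where s: "\<And>k i. k < N \<Longrightarrow> i < N \<Longrightarrow> (\<Sum>p\<in>V. s k p * vec p i) = e k i"
    by metis
  show thesis
  proof (rule that[of "\<lambda>p k. s k p"])
    fix z and i assume i: "i < N"
    have "(\<Sum>p\<in>V. (\<Sum>k<N. s k p * z k) * vec p i) = (\<Sum>p\<in>V. \<Sum>k<N. z k * (s k p * vec p i))"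
      by (simp add: sum_distrib_left sum_distrib_right mult_ac)
    also have "\<dots> = (\<Sum>k<N. z k * (\<Sum>p\<in>V. s k p * vec p i))"
      by (subst sum.swap) (simp add: sum_distrib_left)
    also have "\<dots> = (\<Sum>k<N. z k * e k i)" using s i by (intro sum.cong) auto
    also have "\<dots> = z i" using i by (simp add: e_def if_distrib cong: if_cong)
    finally show "(\<Sum>p\<in>V. (\<Sum>k<N. s k p * z k) * vec p i) = z i" .
  qed
qed

text \<open>\<open>U p\<close> is the gradient and \<open>\<alpha> p\<close> the constant term of
  the barycentric coordinate of \<open>p\<close>. The two identities say that these affine functions
  invert the vertex matrix with a row of ones added; they hold for all \<open>z\<close>, also
  outside the simplex.\<close>

locale barycentric =
  fixes d :: nat and V :: "(nat \<Rightarrow> real) set" and U :: "(nat \<Rightarrow> real) \<Rightarrow> nat \<Rightarrow> real"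
    and \<alpha> :: "(nat \<Rightarrow> real) \<Rightarrow> real"
  assumes simplex: "simplex_vertices d V"
    and repr: "\<And>z i. i < d \<Longrightarrow> (\<Sum>p\<in>V. ((\<Sum>i<d. U p i * z i) + \<alpha> p) * p i) = z i"
    and unity: "\<And>z. (\<Sum>p\<in>V. (\<Sum>i<d. U p i * z i) + \<alpha> p) = 1"
begin

definition bary :: "(nat \<Rightarrow> real) \<Rightarrow> (nat \<Rightarrow> real) \<Rightarrow> real" where
  "bary p z = (\<Sum>i<d. U p i * z i) + \<alpha> p"

lemma finite_vertices: "finite V" and card_vertices: "card V = d + 1" and vertices_rspace: "V \<subseteq> rspace d"
  using simplex by (auto simp: simplex_vertices_def)

lemma bary_repr: "i < d \<Longrightarrow> (\<Sum>p\<in>V. bary p z * p i) = z i" and sum_bary: "(\<Sum>p\<in>V. bary p z) = 1"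
  using repr unity by (auto simp: bary_def)

text \<open>Two coefficient systems of sum 1 for the same point differ by an affine relation, which
  affine independence makes trivial.\<close>

lemma bary_combination:
  assumes "(\<Sum>p\<in>V. t p) = 1" "p \<in> V"
  shows "bary p (\<lambda>i\<in>{..<d}. \<Sum>q\<in>V. t q * q i) = t p"
proof -
  let ?z = "\<lambda>i\<in>{..<d}. \<Sum>q\<in>V. t q * q i"
  have "(\<Sum>p\<in>V. bary p ?z - t p) = 0" using sum_bary assms(1) by (simp add: sum_subtractf)
  moreover have "(\<Sum>p\<in>V. (bary p ?z - t p) * p i) = 0" if "i < d" for i
    using bary_repr[OF that, of ?z] that by (simp add: left_diff_distrib sum_subtractf)
  ultimately have "\<forall>p\<in>V. bary p ?z - t p = 0"
    using simplex unfolding simplex_vertices_def raffine_independent_def by blast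
  then show ?thesis using assms(2) by simp
qed

lemma rspace_repr: "z \<in> rspace d \<Longrightarrow> z = (\<lambda>i\<in>{..<d}. \<Sum>q\<in>V. bary q z * q i)"
  by (auto simp: fun_eq_iff bary_repr rspace_def PiE_def extensional_def)

lemma bary_vertex: "p \<in> V \<Longrightarrow> q \<in> V \<Longrightarrow> bary p q = (if p = q then 1 else 0)"
proof -
  assume pq: "p \<in> V" "q \<in> V"
  let ?t = "\<lambda>r. if r = q then 1 else 0 :: real"
  have "(\<lambda>i\<in>{..<d}. \<Sum>r\<in>V. ?t r * r i) = q"
  proof
    fix i
    have "(\<Sum>r\<in>V. ?t r * r i) = (\<Sum>r\<in>V. if r = q then r i else 0)" by (rule sum.cong) simp_all
    then show "(\<lambda>i\<in>{..<d}. \<Sum>r\<in>V. ?t r * r i) i = q i"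
      using pq(2) finite_vertices vertices_rspace by (auto simp: rspace_def PiE_def extensional_def)
  qed
  moreover have "(\<Sum>r\<in>V. ?t r) = 1" using pq(2) finite_vertices by simp
  ultimately show ?thesis using bary_combination[of ?t p] pq by simp
qed

lemma open_rhull_eq: "open_rhull d V = {z\<in>rspace d. \<forall>p\<in>V. 0 < bary p z}"
proof (intro set_eqI iffI)
  fix z assume "z \<in> open_rhull d V"
  then obtain t where t: "\<forall>p\<in>V. 0 < t p" "(\<Sum>p\<in>V. t p) = 1" "z = (\<lambda>i\<in>{..<d}. \<Sum>q\<in>V. t q * q i)"
    unfolding open_rhull_def by blast
  then show "z \<in> {z\<in>rspace d. \<forall>p\<in>V. 0 < bary p z}" using bary_combination[of t] by (simp add: rspace_def)
next
  fix z assume "z \<in> {z\<in>rspace d. \<forall>p\<in>V. 0 < bary p z}"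
  then have z: "z \<in> rspace d" "\<forall>p\<in>V. 0 < bary p z" by auto
  show "z \<in> open_rhull d V" unfolding open_rhull_def mem_Collect_eq
    by (rule exI[of _ "\<lambda>p. bary p z"]) (use z rspace_repr sum_bary in blast)
qed

text \<open>The closed facet opposite to \<open>q\<close>, cut out by barycentric inequalities
  rather than written as a hull: measurability and the covering of the boundary are then
  immediate.\<close>

definition facet :: "(nat \<Rightarrow> real) \<Rightarrow> (nat \<Rightarrow> real) set" where
  "facet q = {z\<in>rspace d. (\<forall>p\<in>V. 0 \<le> bary p z) \<and> bary q z = 0}"

lemma bary_measurable [measurable]: "bary p \<in> borel_measurable (rlebesgue d)"
  unfolding bary_def[abs_def] by (rule affine_measurable)

lemma facet_measurable [measurable]: "facet q \<in> sets (rlebesgue d)"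
proof -
  have "{z\<in>space (rlebesgue d). (\<forall>p\<in>V. 0 \<le> bary p z) \<and> bary q z = 0} \<in> sets (rlebesgue d)"
    using finite_vertices by measurable
  then show ?thesis by (simp add: facet_def)
qed

lemma open_rhull_measurable [measurable]: "open_rhull d V \<in> sets (rlebesgue d)"
proof -
  have "{z\<in>space (rlebesgue d). \<forall>p\<in>V. 0 < bary p z} \<in> sets (rlebesgue d)"
    using finite_vertices by measurable
  then show ?thesis by (simp add: open_rhull_eq)
qed

text \<open>The chart is based at some vertex \<open>b\<close> other than \<open>q\<close>, and its
  last edge leads to \<open>q\<close>: dropping the last coordinate leaves the facet opposite to
  \<open>q\<close>, and \<open>R n\<close> is the gradient \<open>U q\<close>. Edges and gradients
  are dual because barycentric coordinates are 0 or 1 at the vertices.\<close>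

lemma facet_integral_le:
  fixes c :: "nat \<Rightarrow> real" and c0 :: real
  assumes d: "1 \<le> d" and q: "q \<in> V"
  shows "(\<integral>\<^sup>+z\<in>facet q. ennreal (((\<Sum>i<d. c i * z i) + c0)\<^sup>2) \<partial>hausdorff_measure d (d - 1))
    \<le> ennreal (4 * real d * (real d + 1) * L2_set (U q) {..<d}) *
      (\<integral>\<^sup>+z\<in>open_rhull d V. ennreal (((\<Sum>i<d. c i * z i) + c0)\<^sup>2) \<partial>rlebesgue d)"
proof -
  obtain n where n: "d = Suc n" using d by (cases d) auto
  have "card (V - {q}) \<noteq> 0" using q card_vertices d finite_vertices by simp
  then obtain b where b: "b \<in> V" "b \<noteq> q" by (metis Diff_iff card.empty ex_in_conv singletonI)
  have "card (V - {b, q}) = n" using b q card_vertices finite_vertices n by (simp add: card_Diff_subset)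
  then obtain P0 where P0: "bij_betw P0 {..<n} (V - {b, q})"
    using finite_vertices ex_bij_betw_nat_finite[of "V - {b, q}"] by (auto simp: atLeast0LessThan)
  define P where "P = P0(n := q)"
  have P: "bij_betw P {..<Suc n} (V - {b})"
  proof -
    have "bij_betw P {..<n} (V - {b, q})"
      by (subst bij_betw_cong[of _ P P0]) (auto simp: P_def P0)
    moreover have "bij_betw P {n} {q}" by (simp add: P_def bij_betw_def)
    ultimately have "bij_betw P ({..<n} \<union> {n}) ((V - {b, q}) \<union> {q})"
      by (rule bij_betw_combine) auto
    moreover have "(V - {b, q}) \<union> {q} = V - {b}" using q b by auto
    ultimately show ?thesis by (simp add: lessThan_Suc Un_commute)
  qed
  have Pn: "P n = q" by (simp add: P_def)
  have PV: "P j \<in> V" "P j \<noteq> b" if "j < Suc n" for j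
    using bij_betw_apply[OF P, of j] that by auto
  have Pinj: "P j = P l \<longleftrightarrow> j = l" if "j < Suc n" "l < Suc n" for j l
    using P that by (auto simp: bij_betw_def inj_on_def)
  have sumV: "(\<Sum>p\<in>V. g p) = g b + (\<Sum>j<Suc n. g (P j))" for g :: "(nat \<Rightarrow> real) \<Rightarrow> real"
    using b finite_vertices sum.reindex_bij_betw[OF P, of g] by (simp add: sum.remove)
  define G where "G j i = P j i - b i" for j i
  define R where "R j = U (P j)" for j
  let ?A = "raffine_map (Suc n) (Suc n) b G" and ?C = "raffine_coords (Suc n) (Suc n) b R"
  have diff: "(\<Sum>i<Suc n. U p i * (x i - y i)) = bary p x - bary p y" for p x y
    unfolding n[symmetric] bary_def by (simp add: right_diff_distrib sum_subtractf)
  have dual: "dual_family (Suc n) (Suc n) G R"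
    unfolding dual_family_def R_def G_def diff using PV b bary_vertex Pinj by auto
  have coords: "?C z j = bary (P j) z" if "j < Suc n" for j z
    using that unfolding raffine_coords_def R_def by (simp add: diff bary_vertex PV b del: sum.lessThan_Suc)
  have Crs: "?C z \<in> rspace (Suc n)" for z by (simp add: raffine_coords_def rspace_def)
  have surj: "?A (?C z) = z" if "z \<in> rspace (Suc n)" for z
  proof
    fix i
    show "?A (?C z) i = z i"
    proof (cases "i < Suc n")
      case True
      have "?A (?C z) i = b i + (\<Sum>j<Suc n. bary (P j) z * (P j i - b i))"
        using True coords by (simp add: raffine_map_def G_def)
      also have "\<dots> = b i * (1 - (\<Sum>j<Suc n. bary (P j) z)) + (\<Sum>j<Suc n. bary (P j) z * P j i)"
        by (simp add: right_diff_distrib sum_subtractf sum_distrib_left sum_distrib_right algebra_simps)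
      also have "1 - (\<Sum>j<Suc n. bary (P j) z) = bary b z"
        using sum_bary[of z] unfolding sumV by linarith
      also have "b i * bary b z + (\<Sum>j<Suc n. bary (P j) z * P j i) = z i"
        using bary_repr[of i z] True unfolding n sumV by (simp only: mult.commute)
      finally show ?thesis .
    next
      case False
      then show ?thesis using that by (auto simp: raffine_map_def rspace_def PiE_def extensional_def)
    qed
  qed
  have baryA: "bary (P j) (?A x) = x j" if "x \<in> rspace (Suc n)" "j < Suc n" for x j
    using coords[OF that(2), of "?A x"] raffine_coords_map[OF dual that(1)] by simp
  have baryb: "bary b z = 1 - (\<Sum>j<Suc n. bary (P j) z)" for z
    using sum_bary[of z] unfolding sumV by linarith
  have allV: "(\<forall>p\<in>V. Q p) \<longleftrightarrow> Q b \<and> (\<forall>j<Suc n. Q (P j))" for Q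
  proof -
    have "V = insert b (P ` {..<Suc n})" using bij_betw_imp_surj_on[OF P] b by auto
    then show ?thesis by auto
  qed
  have \<tau>: "?A ` open_ref_simplex (Suc n) \<subseteq> open_rhull d V"
  proof (rule image_subsetI)
    fix x assume x: "x \<in> open_ref_simplex (Suc n)"
    then have xr: "x \<in> rspace (Suc n)" by (simp add: open_ref_simplex_def)
    show "?A x \<in> open_rhull d V"
      unfolding open_rhull_eq allV baryb using x baryA[OF xr] n
      by (simp add: open_ref_simplex_def del: sum.lessThan_Suc)
  qed
  have F: "facet q \<subseteq> raffine_map (Suc n) n b G ` closed_ref_simplex n"
  proof
    fix z assume z: "z \<in> facet q"
    then have zr: "z \<in> rspace (Suc n)" and z0: "\<forall>p\<in>V. 0 \<le> bary p z" "bary q z = 0"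
      unfolding facet_def n[symmetric] by auto
    let ?y = "restrict (?C z) {..<n}"
    have "z = raffine_map (Suc n) n b G ?y"
    proof -
      have "?C z n = 0" using coords[of n z] z0 Pn by simp
      then have "?A (?C z) = raffine_map (Suc n) n b G ?y"
        unfolding raffine_map_def by (intro restrict_ext) simp
      then show ?thesis using surj[OF zr] by simp
    qed
    moreover have "?y \<in> closed_ref_simplex n"
    proof -
      have "(\<Sum>j<n. ?y j) = (\<Sum>j<n. bary (P j) z)" using coords by (intro sum.cong) auto
      also have "\<dots> = 1 - bary b z" using baryb[of z] z0 Pn by simp
      also have "\<dots> \<le> 1" using z0 b by simp
      finally show ?thesis using coords z0 PV by (simp add: closed_ref_simplex_def rspace_def)
    qed
    ultimately show "z \<in> raffine_map (Suc n) n b G ` closed_ref_simplex n" by blast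
  qed
  let ?w = "\<lambda>z. ennreal (((\<Sum>i<d. c i * z i) + c0)\<^sup>2)"
  have "(\<integral>\<^sup>+z\<in>facet q. ?w z \<partial>hausdorff_measure d (d - 1)) \<le>
      (\<integral>\<^sup>+z\<in>raffine_map (Suc n) n b G ` closed_ref_simplex n. ?w z \<partial>hausdorff_measure d (d - 1))"
    by (rule nn_integral_mono) (use F in \<open>auto simp: indicator_def\<close>)
  also have "\<dots> \<le> ennreal (4 * real d * (real d + 1) * L2_set (U q) {..<d}) *
      (\<integral>\<^sup>+z\<in>?A ` open_ref_simplex (Suc n). ?w z \<partial>rlebesgue d)"
    using facet_trace_inequality[OF dual surj, of c c0] unfolding R_def Pn n by simp
  also have "\<dots> \<le> ennreal (4 * real d * (real d + 1) * L2_set (U q) {..<d}) *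
      (\<integral>\<^sup>+z\<in>open_rhull d V. ?w z \<partial>rlebesgue d)"
    by (intro mult_left_mono nn_integral_mono) (use \<tau> in \<open>auto simp: indicator_def\<close>)
  finally show ?thesis .
qed

lemma bary_lipschitz: "\<bar>bary p x - bary p y\<bar> \<le> L2_set (U p) {..<d} * rdist d x y"
proof -
  have "\<bar>bary p x - bary p y\<bar> = \<bar>\<Sum>i<d. U p i * (x i - y i)\<bar>"
    by (simp add: bary_def right_diff_distrib sum_subtractf)
  also have "\<dots> \<le> (\<Sum>i<d. \<bar>U p i\<bar> * \<bar>x i - y i\<bar>)"
    by (rule order_trans[OF sum_abs]) (simp add: abs_mult)
  also have "\<dots> \<le> L2_set (U p) {..<d} * rdist d x y" unfolding rdist_def by (rule L2_set_mult_ineq)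
  finally show ?thesis .
qed

text \<open>Walk from the centre a distance \<open>r / 2\<close> against the gradient: the
  coordinate drops by \<open>r / 2\<close> times the gradient length and is still positive. Half the
  radius keeps the point in the open ball, at the cost of a factor 2.\<close>

lemma ball_in_simplex:
  assumes r: "0 < r" and x: "x \<in> rspace d" and sub: "rball d x r \<subseteq> open_rhull d V" and q: "q \<in> V"
  shows "r / 2 * L2_set (U q) {..<d} \<le> bary q x"
proof (cases "L2_set (U q) {..<d} = 0")
  case True
  have "x \<in> rball d x r" using r x by (simp add: rball_def)
  then show ?thesis using True sub q by (force simp: open_rhull_eq)
next
  case False
  let ?u = "L2_set (U q) {..<d}"
  have u: "0 < ?u" using False L2_set_nonneg[of "U q" "{..<d}"] by linarith
  define z where "z = (\<lambda>i\<in>{..<d}. x i - r / 2 / ?u * U q i)"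
  have "rdist d x z = L2_set (\<lambda>i. r / 2 / ?u * U q i) {..<d}"
    unfolding rdist_def by (rule L2_set_cong) (auto simp: z_def)
  also have "\<dots> = r / 2 / ?u * ?u"
    by (rule L2_set_right_distrib[symmetric]) (use r u in simp)
  also have "\<dots> = r / 2" using u by simp
  finally have "z \<in> rball d x r" using r by (simp add: rball_def z_def rspace_def)
  then have "0 < bary q z" using sub q by (auto simp: open_rhull_eq)
  moreover have "bary q z = bary q x - r / 2 / ?u * (\<Sum>i<d. (U q i)\<^sup>2)"
  proof -
    have "bary q z = (\<Sum>i<d. U q i * x i - r / 2 / ?u * (U q i)\<^sup>2) + \<alpha> q"
      unfolding bary_def by (intro arg_cong2[where f = plus] sum.cong) (auto simp: z_def power2_eq_square algebra_simps)
    also have "\<dots> = bary q x - r / 2 / ?u * (\<Sum>i<d. (U q i)\<^sup>2)"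
      unfolding bary_def sum_subtractf sum_distrib_left by simp
    finally show ?thesis .
  qed
  moreover have "(\<Sum>i<d. (U q i)\<^sup>2) = ?u * ?u" unfolding L2_set_def by (simp add: sum_nonneg)
  ultimately show ?thesis using u by simp
qed

text \<open>All coordinates of the barycentre equal \<open>1 / (d + 1)\<close>, and the Lipschitz
  bound keeps them positive nearby. This makes the supremum in \<open>inradius\<close> one over a
  nonempty set.\<close>

lemma simplex_contains_ball:
  obtains x r where "0 < r" "x \<in> rspace d" "rball d x r \<subseteq> open_rhull d V"
proof -
  let ?t = "\<lambda>_::nat \<Rightarrow> real. 1 / (real d + 1)"
  let ?x = "\<lambda>i\<in>{..<d}. \<Sum>q\<in>V. ?t q * q i"
  let ?B = "1 + (\<Sum>p\<in>V. L2_set (U p) {..<d})"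
  have B: "0 < ?B" by (intro add_pos_nonneg sum_nonneg) auto
  have bx: "bary p ?x = 1 / (real d + 1)" if "p \<in> V" for p
    using bary_combination[of ?t p] that card_vertices by simp
  show thesis
  proof (rule that[of "1 / (real d + 1) / ?B" ?x])
    show "0 < 1 / (real d + 1) / ?B" using B by simp
    show "?x \<in> rspace d" by (simp add: rspace_def)
    show "rball d ?x (1 / (real d + 1) / ?B) \<subseteq> open_rhull d V"
    proof
      fix z assume z: "z \<in> rball d ?x (1 / (real d + 1) / ?B)"
      have "0 < bary p z" if p: "p \<in> V" for p
      proof -
        have "\<bar>bary p ?x - bary p z\<bar> \<le> L2_set (U p) {..<d} * rdist d ?x z" by (rule bary_lipschitz)
        also have "\<dots> \<le> ?B * rdist d ?x z"
        proof (rule mult_right_mono)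
          have "L2_set (U p) {..<d} \<le> (\<Sum>p\<in>V. L2_set (U p) {..<d})"
            by (rule member_le_sum[OF p]) (auto simp: finite_vertices)
          then show "L2_set (U p) {..<d} \<le> ?B" by simp
        qed (simp add: rdist_def)
        also have "\<dots> < 1 / (real d + 1)" using z B by (simp add: rball_def pos_less_divide_eq mult.commute)
        finally show ?thesis using bx[OF p] by linarith
      qed
      then show "z \<in> open_rhull d V" using z by (simp add: open_rhull_eq rball_def)
    qed
  qed
qed

text \<open>The 2 is inherited from the half radius in \<open>ball_in_simplex\<close>; for
  \<open>d \<ge> 1\<close> the true value of the product is 1, since the inscribed ball touches
  every facet.\<close>

lemma inradius_gradients: "inradius d (open_rhull d V) * (\<Sum>q\<in>V. L2_set (U q) {..<d}) \<le> 2"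
proof -
  let ?g = "\<Sum>q\<in>V. L2_set (U q) {..<d}"
  let ?S = "{r. 0 < r \<and> (\<exists>x\<in>rspace d. rball d x r \<subseteq> open_rhull d V)}"
  have b: "r * ?g \<le> 2" if "r \<in> ?S" for r
  proof -
    obtain x where x: "0 < r" "x \<in> rspace d" "rball d x r \<subseteq> open_rhull d V" using \<open>r \<in> ?S\<close> by auto
    have "r / 2 * ?g = (\<Sum>q\<in>V. r / 2 * L2_set (U q) {..<d})" by (rule sum_distrib_left)
    also have "\<dots> \<le> (\<Sum>q\<in>V. bary q x)" by (rule sum_mono) (rule ball_in_simplex[OF x])
    also have "\<dots> = 1" by (rule sum_bary)
    finally show ?thesis by simp
  qed
  have g0: "0 \<le> ?g" by (simp add: sum_nonneg)
  show ?thesis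
  proof (cases "?g = 0")
    case False
    then have g: "0 < ?g" using g0 by linarith
    have "Sup ?S \<le> 2 / ?g"
    proof (rule cSup_least)
      show "?S \<noteq> {}" by (rule simplex_contains_ball) auto
      show "r \<le> 2 / ?g" if "r \<in> ?S" for r using b[OF that] g by (simp add: pos_le_divide_eq)
    qed
    then show ?thesis using g by (simp add: inradius_def pos_le_divide_eq)
  qed simp
qed

text \<open>A lower bound for the supremum in \<open>rdiam\<close> presupposes boundedness, which
  comes from barycentric coordinates lying between 0 and 1. Two points of a ball in the simplex, at
  distance \<open>r / 2\<close>, then suffice.\<close>

lemma rdiam_simplex_pos: "1 \<le> d \<Longrightarrow> 0 < rdiam d (open_rhull d V)"
proof -
  assume d: "1 \<le> d"
  let ?\<tau> = "open_rhull d V"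
  obtain x r where x: "0 < r" "x \<in> rspace d" "rball d x r \<subseteq> ?\<tau>" by (rule simplex_contains_ball)
  define y where "y = x(0 := x 0 + r / 2)"
  have "rdist d x y = L2_set (\<lambda>i. if i = 0 then - (r / 2) else 0) {..<d}"
    unfolding rdist_def by (rule L2_set_cong) (auto simp: y_def)
  also have "\<dots> = r / 2" using d x(1) unfolding L2_set_def
    by (simp add: if_distrib[of "\<lambda>x. x\<^sup>2"] cong: if_cong)
  finally have xy: "rdist d x y = r / 2" .
  have "y \<in> rspace d" using x(2) d by (auto simp: y_def rspace_def PiE_def extensional_def)
  then have in\<tau>: "x \<in> ?\<tau>" "y \<in> ?\<tau>" using x xy by (auto simp: rball_def intro!: subsetD[OF x(3)])
  let ?D = "\<Sum>i<d. 2 * (\<Sum>p\<in>V. \<bar>p i\<bar>)"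
  have c: "\<bar>z i\<bar> \<le> (\<Sum>p\<in>V. \<bar>p i\<bar>)" if z: "z \<in> ?\<tau>" and i: "i < d" for z i
  proof -
    have "bary p z \<le> 1" if "p \<in> V" for p
      using member_le_sum[OF that, of "\<lambda>p. bary p z"] sum_bary[of z] z finite_vertices
      by (auto simp: open_rhull_eq less_imp_le)
    then have "\<bar>\<Sum>p\<in>V. bary p z * p i\<bar> \<le> (\<Sum>p\<in>V. \<bar>p i\<bar>)" using z
      by (intro order_trans[OF sum_abs] sum_mono)
         (auto simp: abs_mult open_rhull_eq less_imp_le intro!: mult_left_le_one_le)
    then show ?thesis using bary_repr[OF i] by simp
  qed
  have "rdist d z z' \<le> ?D" if "z \<in> ?\<tau>" "z' \<in> ?\<tau>" for z z'
  proof -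
    have "rdist d z z' \<le> (\<Sum>i<d. \<bar>z i - z' i\<bar>)" unfolding rdist_def by (rule L2_set_le_sum_abs)
    also have "\<dots> \<le> ?D"
    proof (rule sum_mono)
      fix i assume "i \<in> {..<d}"
      then show "\<bar>z i - z' i\<bar> \<le> 2 * (\<Sum>p\<in>V. \<bar>p i\<bar>)"
        using c[OF that(1), of i] c[OF that(2), of i] by simp
    qed
    finally show ?thesis .
  qed
  then have "bdd_above ((\<lambda>(x, y). rdist d x y) ` (?\<tau> \<times> ?\<tau>))" by (auto intro!: bdd_aboveI[of _ ?D])
  then have "rdist d x y \<le> (SUP (x, y)\<in>?\<tau> \<times> ?\<tau>. rdist d x y)"
    using cSUP_upper[of "(x, y)" "?\<tau> \<times> ?\<tau>" "\<lambda>(x, y). rdist d x y"] in\<tau> by simp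
  then show ?thesis using xy x(1) in\<tau> by (auto simp: rdiam_def)
qed

end

text \<open>Homogenisation: with 1 appended as coordinate \<open>d\<close>, affine independence of
  the \<open>d + 1\<close> vertices becomes linear independence in dimension \<open>d + 1\<close>,
  and the inverse matrix holds the gradients and constant terms.\<close>

lemma simplex_barycentric:
  assumes "simplex_vertices d V"
  obtains U \<alpha> where "barycentric d V U \<alpha>"
proof -
  have V: "finite V" "card V = Suc d" "raffine_independent d V" using assms by (auto simp: simplex_vertices_def)
  let ?vec = "\<lambda>(p::nat \<Rightarrow> real) i. if i < d then p i else 1"
  obtain S where S: "\<And>z i. i < Suc d \<Longrightarrow> (\<Sum>p\<in>V. (\<Sum>k<Suc d. S p k * z k) * ?vec p i) = z i"
  proof (rule square_independent_family_spans[of V "Suc d" ?vec])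
    fix c p assume c: "\<And>i. i < Suc d \<Longrightarrow> (\<Sum>p\<in>V. c p * ?vec p i) = 0" and p: "p \<in> V"
    have "(\<Sum>p\<in>V. c p) = 0" using c[of d] by simp
    moreover have "(\<Sum>p\<in>V. c p * p i) = 0" if "i < d" for i using c[of i] that by simp
    ultimately show "c p = 0" using V(3) p unfolding raffine_independent_def by blast
  qed (use V in auto)
  have ext: "(\<Sum>k<Suc d. S p k * ?vec z k) = (\<Sum>i<d. S p i * z i) + S p d" for p z
    by simp
  have "barycentric d V S (\<lambda>p. S p d)"
  proof
    fix z :: "nat \<Rightarrow> real" and i assume "i < d"
    then show "(\<Sum>p\<in>V. ((\<Sum>i<d. S p i * z i) + S p d) * p i) = z i"
      using S[of i "?vec z"] unfolding ext by simp
  next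
    fix z :: "nat \<Rightarrow> real"
    show "(\<Sum>p\<in>V. (\<Sum>i<d. S p i * z i) + S p d) = 1"
      using S[of d "?vec z"] unfolding ext by simp
  qed (rule assms)
  then show thesis by (rule that)
qed

section \<open>Topology of simplices and polyhedral domains\<close>

lemma topspace_rtop [simp]: "topspace (rtop d) = rspace d"
  by (simp add: rtop_def rspace_def)

lemma continuous_map_component: "i < d \<Longrightarrow> continuous_map (rtop d) euclideanreal (\<lambda>x. x i)"
  unfolding rtop_def by (rule continuous_map_product_projection) simp

lemma continuous_map_affine: "continuous_map (rtop d) euclideanreal (\<lambda>x. (\<Sum>i<d. a i * x i) + c)"
  by (intro continuous_map_add continuous_map_sum continuous_map_real_mult_left continuous_map_component) auto

text \<open>The hull is the continuous image of the compact set of convex coefficients, and the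
  target space is Hausdorff.\<close>

lemma rhull_closed:
  assumes W: "finite W" "W \<subseteq> rspace d"
  shows "closedin (rtop d) (rhull d W)"
proof -
  let ?T = "product_topology (\<lambda>_. euclideanreal) W"
  let ?P = "W \<rightarrow>\<^sub>E {0..1::real}"
  let ?K = "?P \<inter> {t\<in>topspace ?T. (\<Sum>p\<in>W. t p) \<in> {1}}"
  let ?f = "\<lambda>t. \<lambda>i\<in>{..<d}. \<Sum>p\<in>W. t p * p i"
  have cont: "continuous_map ?T euclideanreal (\<lambda>t. \<Sum>p\<in>W. t p * c p)" for c
    by (intro continuous_map_sum continuous_map_real_mult_right continuous_map_product_projection W) auto
  have "closedin ?T {t\<in>topspace ?T. (\<Sum>p\<in>W. t p) \<in> {1}}"
    using cont[of "\<lambda>_. 1"] by (intro closedin_continuous_map_preimage) auto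
  moreover have "compactin ?T ?P" by (simp add: compactin_PiE)
  ultimately have "compactin ?T ?K" by (intro compact_Int_closedin)
  moreover have "continuous_map ?T (rtop d) ?f"
    unfolding rtop_def continuous_map_componentwise using cont by (auto cong: restrict_cong)
  ultimately have "compactin (rtop d) (?f ` ?K)" by (rule image_compactin)
  moreover have "?f ` ?K = rhull d W"
  proof (intro set_eqI iffI)
    fix z assume "z \<in> ?f ` ?K"
    then obtain t where t: "t \<in> ?K" "z = ?f t" by blast
    then have "\<forall>p\<in>W. 0 \<le> t p" "(\<Sum>p\<in>W. t p) = 1" by (auto simp: PiE_def Pi_def)
    then show "z \<in> rhull d W" unfolding rhull_def using t(2) by blast
  next
    fix z assume "z \<in> rhull d W"
    then obtain t where t: "\<forall>p\<in>W. 0 \<le> t p" "(\<Sum>p\<in>W. t p) = 1" "z = ?f t" unfolding rhull_def by blast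
    have "t p \<le> 1" if "p \<in> W" for p using member_le_sum[OF that, of t] t W by auto
    then have "restrict t W \<in> ?K" using t by auto
    moreover have "z = ?f (restrict t W)" unfolding t(3) by (intro restrict_ext sum.cong) auto
    ultimately show "z \<in> ?f ` ?K" by blast
  qed
  moreover have "Hausdorff_space (rtop d)" unfolding rtop_def by (simp add: Hausdorff_space_product_topology)
  ultimately show ?thesis using compactin_imp_closedin by metis
qed

lemma (in barycentric) continuous_map_bary: "continuous_map (rtop d) euclideanreal (bary p)"
  unfolding bary_def[abs_def] by (rule continuous_map_affine)

lemma (in barycentric) open_rhull_open: "openin (rtop d) (open_rhull d V)"
proof -
  have "openin (rtop d) {z\<in>rspace d. \<forall>p\<in>W. 0 < bary p z}" if "finite W" for W
    using that
  proof (induction W)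
    case empty
    then show ?case using openin_topspace[of "rtop d"] by simp
  next
    case (insert p W)
    have "openin (rtop d) {z\<in>topspace (rtop d). bary p z \<in> {0<..}}"
      by (rule openin_continuous_map_preimage[OF continuous_map_bary]) simp
    from openin_Int[OF this insert.IH] show ?case
      by (rule back_subst) auto
  qed
  then show ?thesis using finite_vertices by (simp add: open_rhull_eq)
qed

lemma (in barycentric) closure_open_rhull:
  assumes "z \<in> rtop d closure_of open_rhull d V" "p \<in> V"
  shows "0 \<le> bary p z"
proof -
  have "closedin (rtop d) {z\<in>topspace (rtop d). bary p z \<in> {0..}}"
    by (rule closedin_continuous_map_preimage[OF continuous_map_bary]) simp
  then have "rtop d closure_of open_rhull d V \<subseteq> {z\<in>topspace (rtop d). bary p z \<in> {0..}}"
    by (rule closure_of_minimal[rotated]) (use assms(2) in \<open>auto simp: open_rhull_eq less_imp_le\<close>)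
  then show ?thesis using assms by auto
qed

lemma (in barycentric) boundary_integral_le:
  fixes c :: "nat \<Rightarrow> real" and c0 :: real
  assumes d: "1 \<le> d" and r: "0 < inradius d (open_rhull d V)"
  shows "(\<integral>\<^sup>+z\<in>(\<Union>q\<in>V. facet q). ennreal (((\<Sum>i<d. c i * z i) + c0)\<^sup>2) \<partial>hausdorff_measure d (d - 1))
    \<le> ennreal (16 * (real d)\<^sup>2 / inradius d (open_rhull d V)) *
      (\<integral>\<^sup>+z\<in>open_rhull d V. ennreal (((\<Sum>i<d. c i * z i) + c0)\<^sup>2) \<partial>rlebesgue d)"
proof -
  let ?w = "\<lambda>z. ennreal (((\<Sum>i<d. c i * z i) + c0)\<^sup>2)" and ?H = "hausdorff_measure d (d - 1)"
  let ?I = "\<integral>\<^sup>+z\<in>open_rhull d V. ?w z \<partial>rlebesgue d" and ?g = "\<lambda>q. L2_set (U q) {..<d}"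
  let ?r = "inradius d (open_rhull d V)"
  have [measurable_cong]: "sets ?H = sets (rlebesgue d)" by simp
  have [measurable]: "?w \<in> borel_measurable (rlebesgue d)" using affine_measurable[of c d c0] by measurable
  have "(\<integral>\<^sup>+z\<in>(\<Union>q\<in>V. facet q). ?w z \<partial>?H) \<le> (\<integral>\<^sup>+z. (\<Sum>q\<in>V. ?w z * indicator (facet q) z) \<partial>?H)"
  proof (rule nn_integral_mono)
    fix z
    show "?w z * indicator (\<Union>q\<in>V. facet q) z \<le> (\<Sum>q\<in>V. ?w z * indicator (facet q) z)"
    proof (cases "z \<in> (\<Union>q\<in>V. facet q)")
      case True
      then obtain q where q: "q \<in> V" "z \<in> facet q" by blast
      have "?w z * indicator (facet q) z \<le> (\<Sum>q\<in>V. ?w z * indicator (facet q) z)"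
        by (rule member_le_sum[OF q(1)]) (auto simp: finite_vertices)
      then show ?thesis using True q by simp
    qed simp
  qed
  also have "\<dots> = (\<Sum>q\<in>V. \<integral>\<^sup>+z\<in>facet q. ?w z \<partial>?H)"
    by (rule nn_integral_sum) measurable
  also have "\<dots> \<le> (\<Sum>q\<in>V. ennreal (4 * real d * (real d + 1) * ?g q) * ?I)"
    by (rule sum_mono) (rule facet_integral_le[OF d])
  also have "\<dots> = ennreal (4 * real d * (real d + 1) * (\<Sum>q\<in>V. ?g q)) * ?I"
    by (simp add: sum_distrib_right[symmetric] sum_ennreal sum_distrib_left)
  also have "\<dots> \<le> ennreal (16 * (real d)\<^sup>2 / ?r) * ?I"
  proof (intro mult_right_mono ennreal_leI)
    have "?r * (\<Sum>q\<in>V. ?g q) \<le> 2" by (rule inradius_gradients)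
    then have g: "(\<Sum>q\<in>V. ?g q) \<le> 2 / ?r" using r by (simp add: pos_le_divide_eq mult.commute)
    \<comment> \<open>Here \<open>d \<ge> 1\<close> enters as \<open>d + 1 \<le> 2 d\<close>,
      trading \<open>d (d + 1)\<close> for a pure square.\<close>
    have "4 * real d * (real d + 1) * (\<Sum>q\<in>V. ?g q) \<le> (4 * real d * (2 * real d)) * (2 / ?r)"
      using d g by (intro mult_mono) (auto intro: sum_nonneg)
    then show "4 * real d * (real d + 1) * (\<Sum>q\<in>V. ?g q) \<le> 16 * (real d)\<^sup>2 / ?r"
      by (simp add: power2_eq_square)
  qed simp
  finally show ?thesis .
qed

section \<open>From one simplex to the triangulation\<close>

definition boundary_cover :: "nat \<Rightarrow> (nat \<Rightarrow> real) set \<Rightarrow> (nat \<Rightarrow> real) set \<Rightarrow> bool" where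
  "boundary_cover d \<tau> B \<longleftrightarrow>
    B \<in> sets (rlebesgue d) \<and> rtop d closure_of \<tau> \<subseteq> \<tau> \<union> B \<and>
    (\<forall>c c0. 0 < inradius d \<tau> \<longrightarrow>
      (\<integral>\<^sup>+z\<in>B. ennreal (((\<Sum>i<d. c i * z i) + c0)\<^sup>2) \<partial>hausdorff_measure d (d - 1))
      \<le> ennreal (16 * (real d)\<^sup>2 / inradius d \<tau>) *
        (\<integral>\<^sup>+z\<in>\<tau>. ennreal (((\<Sum>i<d. c i * z i) + c0)\<^sup>2) \<partial>rlebesgue d))"

lemma open_simplex_barycentric:
  assumes "open_simplex d \<tau>"
  obtains V U \<alpha> where "barycentric d V U \<alpha>" "\<tau> = open_rhull d V"
  using assms simplex_barycentric unfolding open_simplex_def by metis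

lemma open_simplex_props:
  assumes "open_simplex d \<tau>"
  shows "openin (rtop d) \<tau>" "\<tau> \<in> sets (rlebesgue d)" "1 \<le> d \<Longrightarrow> 0 < rdiam d \<tau>"
proof -
  obtain V U \<alpha> where bc: "barycentric d V U \<alpha>" and eq: "\<tau> = open_rhull d V"
    using assms by (rule open_simplex_barycentric)
  interpret barycentric d V U \<alpha> by (rule bc)
  show "openin (rtop d) \<tau>" "\<tau> \<in> sets (rlebesgue d)" "1 \<le> d \<Longrightarrow> 0 < rdiam d \<tau>"
    unfolding eq by (rule open_rhull_open open_rhull_measurable rdiam_simplex_pos; assumption)+
qed

lemma boundary_cover_exists:
  assumes \<tau>: "open_simplex d \<tau>" and d: "1 \<le> d"
  shows "\<exists>B. boundary_cover d \<tau> B"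
proof -
  obtain V U \<alpha> where bc: "barycentric d V U \<alpha>" and eq: "\<tau> = open_rhull d V"
    using \<tau> by (rule open_simplex_barycentric)
  interpret barycentric d V U \<alpha> by (rule bc)
  show ?thesis unfolding eq boundary_cover_def
  proof (intro exI[of _ "\<Union>q\<in>V. facet q"] conjI allI impI)
    show "(\<Union>q\<in>V. facet q) \<in> sets (rlebesgue d)"
      by (intro sets.finite_UN finite_vertices facet_measurable)
    show "rtop d closure_of open_rhull d V \<subseteq> open_rhull d V \<union> (\<Union>q\<in>V. facet q)"
    proof
      fix z assume z: "z \<in> rtop d closure_of open_rhull d V"
      have "z \<in> rspace d" using z closure_of_subset_topspace by fastforce
      then show "z \<in> open_rhull d V \<union> (\<Union>q\<in>V. facet q)"
        using closure_open_rhull[OF z] unfolding open_rhull_eq facet_def by (auto simp: less_le)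
    qed
  qed (rule boundary_integral_le[OF d])
qed

text \<open>The domain is the interior of a closed set, which therefore contains the closure of the
  domain, so an open part of that closure already lies in the domain. This absence of slits puts
  every open simplex inside the domain.\<close>

lemma polyhedral_domain_interior_closure:
  assumes "bounded_polyhedral_domain d \<Omega>"
  shows "openin (rtop d) \<Omega>" "openin (rtop d) S \<Longrightarrow> S \<subseteq> rtop d closure_of \<Omega> \<Longrightarrow> S \<subseteq> \<Omega>"
proof -
  obtain \<V> where \<V>: "finite \<V>" "\<forall>V\<in>\<V>. finite V \<and> V \<subseteq> rspace d"
    and \<Omega>: "\<Omega> = rtop d interior_of (\<Union>V\<in>\<V>. rhull d V)"
    using assms by (auto simp: bounded_polyhedral_domain_def)
  show "openin (rtop d) \<Omega>" unfolding \<Omega> by simp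
  have "closedin (rtop d) (\<Union>V\<in>\<V>. rhull d V)"
    using \<V> rhull_closed by (intro closedin_Union) auto
  moreover have "\<Omega> \<subseteq> (\<Union>V\<in>\<V>. rhull d V)" unfolding \<Omega> by (rule interior_of_subset)
  ultimately have "rtop d closure_of \<Omega> \<subseteq> (\<Union>V\<in>\<V>. rhull d V)" by (intro closure_of_minimal)
  then show "S \<subseteq> \<Omega>" if S: "openin (rtop d) S" "S \<subseteq> rtop d closure_of \<Omega>"
    using interior_of_maximal[OF _ S(1)] S(2) unfolding \<Omega>[symmetric] by (metis \<Omega> order_trans)
qed

text \<open>The set where a continuous function agrees with an affine one is closed, so the formula
  on the open simplex persists on its closure, where the boundary values are read off.\<close>

lemma fe_space_affine_on_closure:
  assumes T: "triangulation_of d \<Omega> T" and v: "v \<in> fe_space d \<Omega> T" and \<tau>: "\<tau> \<in> T"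
  obtains a c where "\<And>z. z \<in> rtop d closure_of \<tau> \<Longrightarrow> v z = (\<Sum>i<d. a i * z i) + c"
    "\<And>z. z \<in> \<tau> \<Longrightarrow> v z = (\<Sum>i<d. a i * z i) + c"
proof -
  let ?cl = "rtop d closure_of \<Omega>"
  obtain a c where ac: "\<And>z. z \<in> \<tau> \<Longrightarrow> v z = (\<Sum>i<d. a i * z i) + c"
    using v \<tau> by (auto simp: fe_space_def raffine_on_def)
  let ?X = "subtopology (rtop d) ?cl" and ?w = "\<lambda>z. (\<Sum>i<d. a i * z i) + c"
  have sub: "rtop d closure_of \<tau> \<subseteq> ?cl" using T \<tau> by (auto simp: triangulation_of_def)
  have "open_simplex d \<tau>" using T \<tau> by (auto simp: triangulation_of_def)
  then have "\<tau> \<subseteq> rspace d" using openin_subset[OF open_simplex_props(1)] by simp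
  then have \<tau>cl: "\<tau> \<subseteq> ?cl" using sub closure_of_subset[of \<tau> "rtop d"] by auto
  have "continuous_map ?X euclideanreal v" using v by (simp add: fe_space_def)
  moreover have "continuous_map ?X euclideanreal ?w"
    by (rule continuous_map_from_subtopology[OF continuous_map_affine])
  ultimately have "continuous_map ?X euclideanreal (\<lambda>z. v z - ?w z)" by (rule continuous_map_diff)
  then have "closedin ?X {z\<in>topspace ?X. v z - ?w z \<in> {0}}"
    by (rule closedin_continuous_map_preimage) simp
  then have cl: "closedin (rtop d) {z\<in>topspace ?X. v z - ?w z \<in> {0}}"
    by (rule closedin_trans_full) (rule closedin_closure_of)
  have "rtop d closure_of \<tau> \<subseteq> {z\<in>topspace ?X. v z - ?w z \<in> {0}}"
    by (rule closure_of_minimal[OF _ cl]) (use ac \<tau>cl \<open>\<tau> \<subseteq> rspace d\<close> in auto)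
  then have "v z = ?w z" if "z \<in> rtop d closure_of \<tau>" for z using that by auto
  then show thesis using that ac by blast
qed

text \<open>A boundary point lies in the closure of some simplex but not in the simplex, which is
  part of the domain; hence it lies in one of its facets. Charging interior facets too is harmless:
  each simplex pays for its own facets, and the simplices are disjoint.\<close>

lemma boundary_trace_integral:
  assumes d: "1 \<le> d" and \<Omega>: "bounded_polyhedral_domain d \<Omega>" and T: "triangulation_of d \<Omega> T"
    and qu: "quasi_uniform d \<rho> \<sigma> T" and v: "v \<in> fe_space d \<Omega> T"
  shows "0 < mesh_size d T"
    and "(\<integral>\<^sup>+z\<in>rtop d frontier_of \<Omega>. ennreal ((v z)\<^sup>2) \<partial>hausdorff_measure d (d - 1)) \<le>
      ennreal (16 * (real d)\<^sup>2 * \<rho> / (\<sigma> * mesh_size d T)) * (\<integral>\<^sup>+z\<in>\<Omega>. ennreal ((v z)\<^sup>2) \<partial>rlebesgue d)"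
proof -
  let ?H = "hausdorff_measure d (d - 1)" and ?L = "rlebesgue d" and ?h = "mesh_size d T"
  have fin: "finite T" and simp\<tau>: "\<And>\<tau>. \<tau> \<in> T \<Longrightarrow> open_simplex d \<tau>" and disj: "disjoint T"
    and cov: "(\<Union>\<tau>\<in>T. rtop d closure_of \<tau>) = rtop d closure_of \<Omega>"
    using T by (auto simp: triangulation_of_def)
  obtain B where "\<And>\<tau>. \<tau> \<in> T \<Longrightarrow> boundary_cover d \<tau> (B \<tau>)"
    using boundary_cover_exists[OF simp\<tau> d] by metis
  then have B: "\<And>\<tau>. \<tau> \<in> T \<Longrightarrow> B \<tau> \<in> sets ?L" "\<And>\<tau>. \<tau> \<in> T \<Longrightarrow> rtop d closure_of \<tau> \<subseteq> \<tau> \<union> B \<tau>"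
    "\<And>\<tau> c c0. \<tau> \<in> T \<Longrightarrow> 0 < inradius d \<tau> \<Longrightarrow>
      (\<integral>\<^sup>+z\<in>B \<tau>. ennreal (((\<Sum>i<d. c i * z i) + c0)\<^sup>2) \<partial>?H)
      \<le> ennreal (16 * (real d)\<^sup>2 / inradius d \<tau>) *
        (\<integral>\<^sup>+z\<in>\<tau>. ennreal (((\<Sum>i<d. c i * z i) + c0)\<^sup>2) \<partial>?L)"
    unfolding boundary_cover_def by simp_all
  note \<tau>_open = open_simplex_props(1)[OF simp\<tau>]
  have "T \<noteq> {}"
  proof
    assume "T = {}"
    then have "rtop d closure_of \<Omega> = {}" using cov by simp
    moreover have "\<Omega> \<subseteq> rtop d closure_of \<Omega>"
      using openin_subset[OF polyhedral_domain_interior_closure(1)[OF \<Omega>]] by (rule closure_of_subset)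
    ultimately show False using \<Omega> by (auto simp: bounded_polyhedral_domain_def)
  qed
  then obtain \<tau>0 where "\<tau>0 \<in> T" by auto
  then have "rdiam d \<tau>0 \<le> ?h" using fin by (simp add: mesh_size_def)
  then show h: "0 < ?h" using open_simplex_props(3)[OF simp\<tau>[OF \<open>\<tau>0 \<in> T\<close>] d] by linarith
  have \<rho>: "0 < \<rho>" and \<sigma>: "0 < \<sigma>" using qu by (auto simp: quasi_uniform_def)
  \<comment> \<open>Chaining the two bounds on the diameter: the inradius is at least
    \<open>\<sigma> h / \<rho>\<close>.\<close>
  have inr: "\<sigma> * ?h \<le> \<rho> * inradius d \<tau>" if "\<tau> \<in> T" for \<tau>
    using qu that by (auto simp: quasi_uniform_def intro: order_trans)
  have inr_pos: "0 < inradius d \<tau>" if "\<tau> \<in> T" for \<tau>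
  proof -
    have "0 < \<sigma> * ?h" using \<sigma> h by simp
    then show ?thesis using inr[OF that] \<rho> by (metis less_le_trans zero_less_mult_pos)
  qed
  let ?K = "ennreal (16 * (real d)\<^sup>2 * \<rho> / (\<sigma> * ?h))"
  have K: "ennreal (16 * (real d)\<^sup>2 / inradius d \<tau>) \<le> ?K" if "\<tau> \<in> T" for \<tau>
  proof (rule ennreal_leI)
    have "1 / inradius d \<tau> \<le> \<rho> / (\<sigma> * ?h)"
      using inr[OF that] inr_pos[OF that] \<sigma> h by (simp add: field_simps)
    then have "16 * (real d)\<^sup>2 * (1 / inradius d \<tau>) \<le> 16 * (real d)\<^sup>2 * (\<rho> / (\<sigma> * ?h))"
      by (rule mult_left_mono) simp
    then show "16 * (real d)\<^sup>2 / inradius d \<tau> \<le> 16 * (real d)\<^sup>2 * \<rho> / (\<sigma> * ?h)" by simp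
  qed
  have "\<forall>\<tau>\<in>T. \<exists>a c. \<forall>z. (z \<in> rtop d closure_of \<tau> \<longrightarrow> v z = (\<Sum>i<d. a i * z i) + c) \<and>
      (z \<in> \<tau> \<longrightarrow> v z = (\<Sum>i<d. a i * z i) + c)"
    using fe_space_affine_on_closure[OF T v] by (intro ballI) metis
  then obtain a c where ac: "\<And>\<tau> z. \<tau> \<in> T \<Longrightarrow> z \<in> rtop d closure_of \<tau> \<Longrightarrow> v z = (\<Sum>i<d. a \<tau> i * z i) + c \<tau>"
    "\<And>\<tau> z. \<tau> \<in> T \<Longrightarrow> z \<in> \<tau> \<Longrightarrow> v z = (\<Sum>i<d. a \<tau> i * z i) + c \<tau>"
    by metis
  \<comment> \<open>Each piece is replaced by its affine function on the whole space, which is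
    measurable; \<open>v\<close> itself is compared with it only pointwise, through monotonicity of
    the integral.\<close>
  define w where "w \<tau> z = ennreal (((\<Sum>i<d. a \<tau> i * z i) + c \<tau>)\<^sup>2)" for \<tau> z
  have [measurable]: "w \<tau> \<in> borel_measurable ?L" for \<tau>
    unfolding w_def[abs_def] using affine_measurable[of "a \<tau>" d "c \<tau>"] by measurable
  have [measurable_cong]: "sets ?H = sets ?L" by simp
  note [measurable] = B(1) open_simplex_props(2)[OF simp\<tau>]
  have in\<Omega>: "\<tau> \<subseteq> \<Omega>" if "\<tau> \<in> T" for \<tau>
  proof (rule polyhedral_domain_interior_closure(2)[OF \<Omega> \<tau>_open[OF that]])
    show "\<tau> \<subseteq> rtop d closure_of \<Omega>"
      using cov that closure_of_subset[OF openin_subset[OF \<tau>_open[OF that]]] by blast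
  qed
  have "(\<integral>\<^sup>+z\<in>rtop d frontier_of \<Omega>. ennreal ((v z)\<^sup>2) \<partial>?H) \<le> (\<integral>\<^sup>+z. (\<Sum>\<tau>\<in>T. w \<tau> z * indicator (B \<tau>) z) \<partial>?H)"
  proof (rule nn_integral_mono)
    fix z
    show "ennreal ((v z)\<^sup>2) * indicator (rtop d frontier_of \<Omega>) z \<le> (\<Sum>\<tau>\<in>T. w \<tau> z * indicator (B \<tau>) z)"
    proof (cases "z \<in> rtop d frontier_of \<Omega>")
      case True
      then have z: "z \<in> rtop d closure_of \<Omega>" "z \<notin> \<Omega>"
        using interior_of_openin[OF polyhedral_domain_interior_closure(1)[OF \<Omega>]] by (auto simp: frontier_of_def)
      then obtain \<tau> where \<tau>: "\<tau> \<in> T" "z \<in> rtop d closure_of \<tau>" using cov by blast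
      then have zB: "z \<in> B \<tau>" using B(2)[OF \<tau>(1)] in\<Omega>[OF \<tau>(1)] z(2) by blast
      have "w \<tau> z * indicator (B \<tau>) z \<le> (\<Sum>\<tau>\<in>T. w \<tau> z * indicator (B \<tau>) z)"
        by (rule member_le_sum[OF \<tau>(1)]) (auto simp: fin)
      moreover have "w \<tau> z = ennreal ((v z)\<^sup>2)" using ac(1)[OF \<tau>] by (simp add: w_def)
      ultimately show ?thesis using True zB by simp
    qed simp
  qed
  also have "\<dots> = (\<Sum>\<tau>\<in>T. \<integral>\<^sup>+z\<in>B \<tau>. w \<tau> z \<partial>?H)"
    by (rule nn_integral_sum) measurable
  also have "\<dots> \<le> (\<Sum>\<tau>\<in>T. ?K * (\<integral>\<^sup>+z\<in>\<tau>. w \<tau> z \<partial>?L))"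
  proof (rule sum_mono)
    fix \<tau> assume \<tau>: "\<tau> \<in> T"
    have "(\<integral>\<^sup>+z\<in>B \<tau>. w \<tau> z \<partial>?H) \<le> ennreal (16 * (real d)\<^sup>2 / inradius d \<tau>) * (\<integral>\<^sup>+z\<in>\<tau>. w \<tau> z \<partial>?L)"
      unfolding w_def by (rule B(3)[OF \<tau> inr_pos[OF \<tau>]])
    also have "\<dots> \<le> ?K * (\<integral>\<^sup>+z\<in>\<tau>. w \<tau> z \<partial>?L)" by (rule mult_right_mono[OF K[OF \<tau>]]) simp
    finally show "(\<integral>\<^sup>+z\<in>B \<tau>. w \<tau> z \<partial>?H) \<le> ?K * (\<integral>\<^sup>+z\<in>\<tau>. w \<tau> z \<partial>?L)" .
  qed
  also have "\<dots> = ?K * (\<integral>\<^sup>+z. (\<Sum>\<tau>\<in>T. w \<tau> z * indicator \<tau> z) \<partial>?L)"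
    unfolding sum_distrib_left[symmetric] by (subst nn_integral_sum) measurable
  also have "\<dots> \<le> ?K * (\<integral>\<^sup>+z\<in>\<Omega>. ennreal ((v z)\<^sup>2) \<partial>?L)"
  proof (intro mult_left_mono nn_integral_mono)
    fix z
    show "(\<Sum>\<tau>\<in>T. w \<tau> z * indicator \<tau> z) \<le> ennreal ((v z)\<^sup>2) * indicator \<Omega> z"
    proof (cases "\<exists>\<tau>\<in>T. z \<in> \<tau>")
      case True
      then obtain \<tau> where \<tau>: "\<tau> \<in> T" "z \<in> \<tau>" by blast
      have "z \<notin> \<tau>'" if "\<tau>' \<in> T - {\<tau>}" for \<tau>'
        using disj that \<tau> by (auto simp: disjoint_def)
      then have "(\<Sum>\<tau>\<in>T. w \<tau> z * indicator \<tau> z) = w \<tau> z"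
        using \<tau> fin by (subst sum.remove[OF fin \<tau>(1)]) (auto intro!: sum.neutral)
      also have "\<dots> = ennreal ((v z)\<^sup>2)" using ac(2)[OF \<tau>] by (simp add: w_def)
      finally show ?thesis using in\<Omega>[OF \<tau>(1)] \<tau>(2) by auto
    next
      case False
      then have "(\<Sum>\<tau>\<in>T. w \<tau> z * indicator \<tau> z) = 0" by (intro sum.neutral) auto
      then show ?thesis by simp
    qed
  qed simp
  finally show "(\<integral>\<^sup>+z\<in>rtop d frontier_of \<Omega>. ennreal ((v z)\<^sup>2) \<partial>?H) \<le> ?K * (\<integral>\<^sup>+z\<in>\<Omega>. ennreal ((v z)\<^sup>2) \<partial>?L)" .
qed

text \<open>The norm is infinite exactly when its integral is. An infinite right-hand side is
  harmless since \<open>k > 0\<close>; a finite one forces the left integral to be finite, and then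
  square roots can be compared.\<close>

lemma L2_norm_on_le:
  assumes k: "0 < k" and le: "(\<integral>\<^sup>+x\<in>A. ennreal ((v x)\<^sup>2) \<partial>M) \<le> ennreal (k\<^sup>2) * (\<integral>\<^sup>+x\<in>B. ennreal ((v x)\<^sup>2) \<partial>N)"
  shows "L2_norm_on M A v \<le> ennreal k * L2_norm_on N B v"
proof (cases "(\<integral>\<^sup>+x\<in>B. ennreal ((v x)\<^sup>2) \<partial>N) = \<infinity>")
  case True
  then show ?thesis using k by (simp add: L2_norm_on_def ennreal_mult_top)
next
  case False
  then obtain y where y: "(\<integral>\<^sup>+x\<in>B. ennreal ((v x)\<^sup>2) \<partial>N) = ennreal y" "0 \<le> y"
    by (cases "\<integral>\<^sup>+x\<in>B. ennreal ((v x)\<^sup>2) \<partial>N") auto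
  have le': "(\<integral>\<^sup>+x\<in>A. ennreal ((v x)\<^sup>2) \<partial>M) \<le> ennreal (k\<^sup>2 * y)"
    using le y by (simp add: ennreal_mult)
  then have "(\<integral>\<^sup>+x\<in>A. ennreal ((v x)\<^sup>2) \<partial>M) \<noteq> \<infinity>" by (auto simp: top_unique)
  then obtain x where x: "(\<integral>\<^sup>+x\<in>A. ennreal ((v x)\<^sup>2) \<partial>M) = ennreal x" "0 \<le> x"
    by (cases "\<integral>\<^sup>+x\<in>A. ennreal ((v x)\<^sup>2) \<partial>M") auto
  have "x \<le> k\<^sup>2 * y" using le' x y by (simp add: ennreal_le_iff)
  then have "sqrt x \<le> sqrt (k\<^sup>2 * y)" by (rule real_sqrt_le_mono)
  also have "\<dots> = k * sqrt y" using k by (simp add: real_sqrt_mult)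
  finally show ?thesis using x y k by (simp add: L2_norm_on_def ennreal_mult[symmetric] ennreal_leI)
qed

theorem lemma4p7:
  shows "\<exists>C::real. C > 0 \<and>
    (\<forall>(d::nat) (\<Omega>::(nat \<Rightarrow> real) set) (T::(nat \<Rightarrow> real) set set) (\<rho>::real) (\<sigma>::real) (h::real).
       d \<ge> 1 \<longrightarrow> bounded_polyhedral_domain d \<Omega> \<longrightarrow> triangulation_of d \<Omega> T \<longrightarrow>
       quasi_uniform d \<rho> \<sigma> T \<longrightarrow> h = mesh_size d T \<longrightarrow>
       (\<forall>v\<in>fe_space d \<Omega> T.
          L2_norm_on (hausdorff_measure d (d - 1)) (rtop d frontier_of \<Omega>) v
            \<le> ennreal (C * \<rho> powr (1/2) * \<sigma> powr (-1/2) * real d * h powr (-1/2))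
              * L2_norm_on (rlebesgue d) \<Omega> v))"
proof (intro exI[of _ 4] conjI allI impI ballI)
  fix d :: nat and \<Omega> :: "(nat \<Rightarrow> real) set" and T :: "(nat \<Rightarrow> real) set set" and \<rho> \<sigma> h :: real and v
  assume d: "1 \<le> d" and \<Omega>: "bounded_polyhedral_domain d \<Omega>" and T: "triangulation_of d \<Omega> T"
    and qu: "quasi_uniform d \<rho> \<sigma> T" and h: "h = mesh_size d T" and v: "v \<in> fe_space d \<Omega> T"
  note b = boundary_trace_integral[OF d \<Omega> T qu v, folded h]
  have pos: "0 < \<rho>" "0 < \<sigma>" using qu by (auto simp: quasi_uniform_def)
  \<comment> \<open>The 4 is the root of the 16 in \<open>boundary_trace_integral\<close>, and the
    powers are the root of \<open>\<rho> / (\<sigma> h)\<close>.\<close>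
  let ?k = "4 * \<rho> powr (1/2) * \<sigma> powr (-1/2) * real d * h powr (-1/2)"
  have "(x powr (1/2))\<^sup>2 = x" "(x powr (-1/2))\<^sup>2 = 1 / x" if "0 < x" for x :: real
    using that by (simp_all add: power2_eq_square powr_add[symmetric] powr_minus_divide)
  then have "?k\<^sup>2 = 16 * (real d)\<^sup>2 * \<rho> / (\<sigma> * h)"
    using pos b(1) by (simp add: power_mult_distrib)
  moreover have "0 < ?k" using pos b(1) d by simp
  ultimately show "L2_norm_on (hausdorff_measure d (d - 1)) (rtop d frontier_of \<Omega>) v \<le>
      ennreal ?k * L2_norm_on (rlebesgue d) \<Omega> v"
    using b(2) by (intro L2_norm_on_le) auto
qed simp

end
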